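(* Let $Q=0$ and let the real functions $(\alpha,\beta)\in\mathscr H_3\times\mathscr H_3$ satisfy the normalization $\int_0^1\big(\frac{b}{a}\big)^{1/4}dx=1$ and the condition $\kappa(0)=\kappa(1)$. Then the eigenvalues $\lambda_n$ of the operator $\mathcal E$ satisfy $\lambda_n=(\pi n)^4$ for all $n\ge1$ if and only if $a=b=1$ (identically on $[0,1]$).
   Context: For an integer $m\ge 0$, $\mathscr H_m=\{f\in L^1(0,1): f^{(m)}\in L^1(0,1)\}$ (Sobolev space). Given real $\alpha,\beta,Q$ with $(\alpha,\beta,Q)\in\mathscr H_3\times\mathscr H_3\times\mathscr H_0$ and a number $b(0)>0$, set $$a(x)=e^{4\int_0^x\alpha(s)ds}>0,\qquad b(x)=b(0)e^{4\int_0^x\beta(s)ds}>0$$ (so $a(0)=1$). The Euler-Bernoulli operator $\mathcal E$ acts in $L^2((0,1),b(x)dx)$ by $$\mathcal E u=\frac1b(au'')''+Qu$$ with the boundary conditions $u=0$ and $u''+2(\alpha+\beta)u'=0$ at $x=0$ and at $x=1$. It is self-adjoint with purely discrete real spectrum; its eigenvalues are labeled $\lambda_1\le\lambda_2\le\lambda_3\le\dots$, counted with multiplicity. Define $\xi=\big(\frac ba\big)^{1/4}$ and $\kappa=\frac{3\alpha+5\beta}{2\xi}$ on $[0,1]$. *)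

theory Defs
  imports "HOL-Analysis.Analysis" "HOL-Library.Function_Algebras"
begin

definition test_function :: "(real \<Rightarrow> real) \<Rightarrow> bool" where
  "test_function \<phi> \<longleftrightarrow>
     (\<forall>k x. (deriv ^^ k) \<phi> field_differentiable (at x)) \<and>
     (\<exists>c d. 0 < c \<and> d < 1 \<and> (\<forall>x. x \<notin> {c..d} \<longrightarrow> \<phi> x = 0))"

definition weak_deriv :: "nat \<Rightarrow> (real \<Rightarrow> 'b::euclidean_space) \<Rightarrow> (real \<Rightarrow> 'b) \<Rightarrow> bool" where
  "weak_deriv m f g \<longleftrightarrow>
     (\<forall>\<phi>. test_function \<phi> \<longrightarrow>
        integral {0<..<1} (\<lambda>x. (deriv ^^ m) \<phi> x *\<^sub>R f x) =
        (-1) ^ m *\<^sub>R integral {0<..<1} (\<lambda>x. \<phi> x *\<^sub>R g x))"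

text \<open>Membership in the Sobolev space depends only on the restriction of the function to
  the open interval, and there only up to null sets.\<close>

definition sobolev :: "nat \<Rightarrow> (real \<Rightarrow> real) set" where
  "sobolev m = {f. f absolutely_integrable_on {0<..<1} \<and>
     (\<exists>g. g absolutely_integrable_on {0<..<1} \<and> weak_deriv m f g)}"

definition coeff_a :: "(real \<Rightarrow> real) \<Rightarrow> real \<Rightarrow> real" where
  "coeff_a \<alpha> x = exp (4 * integral {0..x} \<alpha>)"

definition coeff_b :: "real \<Rightarrow> (real \<Rightarrow> real) \<Rightarrow> real \<Rightarrow> real" where
  "coeff_b b0 \<beta> x = b0 * exp (4 * integral {0..x} \<beta>)"

definition xi :: "(real \<Rightarrow> real) \<Rightarrow> real \<Rightarrow> (real \<Rightarrow> real) \<Rightarrow> real \<Rightarrow> real" where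
  "xi \<alpha> b0 \<beta> x = (coeff_b b0 \<beta> x / coeff_a \<alpha> x) powr (1 / 4)"

definition kappa :: "(real \<Rightarrow> real) \<Rightarrow> real \<Rightarrow> (real \<Rightarrow> real) \<Rightarrow> real \<Rightarrow> real" where
  "kappa \<alpha> b0 \<beta> x = (3 * \<alpha> x + 5 * \<beta> x) / (2 * xi \<alpha> b0 \<beta> x)"

definition L2_weighted :: "(real \<Rightarrow> real) \<Rightarrow> (real \<Rightarrow> complex) \<Rightarrow> bool" where
  "L2_weighted b g \<longleftrightarrow>
     g \<in> borel_measurable (lebesgue_on {0<..<1}) \<and>
     (\<lambda>x. b x * (cmod (g x))\<^sup>2) absolutely_integrable_on {0<..<1}"

text \<open>Derivative on the closed unit interval, one-sided at the end points.\<close>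

definition D01 :: "(real \<Rightarrow> complex) \<Rightarrow> real \<Rightarrow> complex" where
  "D01 u x = vector_derivative u (at x within {0..1})"

definition C2_01 :: "(real \<Rightarrow> complex) \<Rightarrow> bool" where
  "C2_01 u \<longleftrightarrow>
     (\<forall>x\<in>{0..1}. u differentiable (at x within {0..1})) \<and>
     (\<forall>x\<in>{0..1}. D01 u differentiable (at x within {0..1})) \<and>
     continuous_on {0..1} (D01 (D01 u))"

text \<open>
  The graph of the Euler-Bernoulli operator on its maximal domain, \<open>EB_graph \<alpha> b0 \<beta> Q u g\<close>
  meaning that \<open>u\<close> is in the domain and \<open>\<E> u = g\<close>.  An element \<open>u\<close> of the domain is a class
  modulo null sets with \<open>u''\<close> and \<open>(a u'')''\<close> in \<open>L\<^sup>1(0,1)\<close>.  Then \<open>a u''\<close> and hence \<open>u''\<close> are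
  continuously differentiable, so that the class has exactly one representative that is
  \<open>C\<^sup>2\<close> on the closed interval and zero outside.  Domain elements are identified with that
  representative; \<open>w\<close> is \<open>(a u'')''\<close>.
\<close>

definition EB_graph ::
  "(real \<Rightarrow> real) \<Rightarrow> real \<Rightarrow> (real \<Rightarrow> real) \<Rightarrow> (real \<Rightarrow> real) \<Rightarrow>
     (real \<Rightarrow> complex) \<Rightarrow> (real \<Rightarrow> complex) \<Rightarrow> bool" where
  "EB_graph \<alpha> b0 \<beta> Q u g \<longleftrightarrow>
     C2_01 u \<and> (\<forall>x. x \<notin> {0..1} \<longrightarrow> u x = 0) \<and>
     L2_weighted (coeff_b b0 \<beta>) u \<and> L2_weighted (coeff_b b0 \<beta>) g \<and>
     (\<exists>w. w absolutely_integrable_on {0<..<1} \<and>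
          weak_deriv 2 (\<lambda>x. coeff_a \<alpha> x *\<^sub>R D01 (D01 u) x) w \<and>
          (AE x in lebesgue_on {0<..<1}. g x = (1 / coeff_b b0 \<beta> x) *\<^sub>R w x + Q x *\<^sub>R u x)) \<and>
     (\<forall>x\<in>{0, 1}. u x = 0 \<and> D01 (D01 u) x + (2 * (\<alpha> x + \<beta> x)) *\<^sub>R D01 u x = 0)"

definition eigenspace ::
  "(real \<Rightarrow> real) \<Rightarrow> real \<Rightarrow> (real \<Rightarrow> real) \<Rightarrow> (real \<Rightarrow> real) \<Rightarrow> complex \<Rightarrow> (real \<Rightarrow> complex) set" where
  "eigenspace \<alpha> b0 \<beta> Q \<mu> = {u. EB_graph \<alpha> b0 \<beta> Q u (\<lambda>x. \<mu> * u x)}"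

definition fscale :: "complex \<Rightarrow> (real \<Rightarrow> complex) \<Rightarrow> real \<Rightarrow> complex" where
  "fscale c u = (\<lambda>x. c * u x)"

lemma vector_space_fscale: "vector_space fscale"
  by unfold_locales (auto simp: fscale_def fun_eq_iff algebra_simps)

definition multiplicity_EB ::
  "(real \<Rightarrow> real) \<Rightarrow> real \<Rightarrow> (real \<Rightarrow> real) \<Rightarrow> (real \<Rightarrow> real) \<Rightarrow> complex \<Rightarrow> nat" where
  "multiplicity_EB \<alpha> b0 \<beta> Q \<mu> = vector_space.dim fscale (eigenspace \<alpha> b0 \<beta> Q \<mu>)"

text \<open>
  \<open>ev 1 \<le> ev 2 \<le> \<dots>\<close> lists all eigenvalues, each repeated according to its multiplicity;
  the value \<open>ev 0\<close> is irrelevant.  A number that is not an eigenvalue has multiplicity 0.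
  Such a listing exists, and is unique on \<open>n \<ge> 1\<close>, because the operator is self-adjoint with
  discrete spectrum and is bounded below.
\<close>

definition eigenvalue_labelling ::
  "(real \<Rightarrow> real) \<Rightarrow> real \<Rightarrow> (real \<Rightarrow> real) \<Rightarrow> (real \<Rightarrow> real) \<Rightarrow> (nat \<Rightarrow> real) \<Rightarrow> bool" where
  "eigenvalue_labelling \<alpha> b0 \<beta> Q ev \<longleftrightarrow>
     (\<forall>n\<ge>1. ev n \<le> ev (Suc n)) \<and>
     (\<forall>\<mu>::complex. finite {n. 1 \<le> n \<and> complex_of_real (ev n) = \<mu>} \<and>
        card {n. 1 \<le> n \<and> complex_of_real (ev n) = \<mu>} = multiplicity_EB \<alpha> b0 \<beta> Q \<mu>)"

end

theory Submission
  imports Defs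
begin

text \<open>
  In the variable \<open>T(x) = \<integral>\<^sub>0\<^sup>x \<xi>\<close>, with \<open>u = \<rho> y\<close>, \<open>\<rho>\<^sup>2 = \<xi> / b\<close> and \<open>D\<close> the derivative with
  respect to \<open>T\<close>, the eigenvalue equation becomes
  \<open>D\<^sup>4 y + D (p D y + q y) + d D\<^sup>2 y + e D y + h y = k\<^sup>4 y\<close> with \<open>y = D\<^sup>2 y = 0\<close> at both ends, and
  \<open>- (p + d) = 2 D \<kappa> + 2 (A + B)\<^sup>2 + (B - A)\<^sup>2 / 2\<close> where \<open>A = \<alpha>/\<xi>\<close> and \<open>B = \<beta>/\<xi>\<close>.

  Suppose that \<open>(\<pi>n)\<^sup>4\<close> is an eigenvalue and put \<open>k = \<pi>n\<close>.  Testing the equation with \<open>y\<close> itself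
  bounds \<open>D y\<close> and \<open>D\<^sup>2 y\<close> by \<open>O(k)\<close> and \<open>O(k\<^sup>2)\<close> for normalized \<open>y\<close>; testing it with
  \<open>v = D\<^sup>2 y + k\<^sup>2 y\<close>, on which the leading part is definite, gives \<open>v = O(1)\<close>, so \<open>y\<close> is
  \<open>O(1/k)\<close>-close to a multiple of \<open>sin (k T)\<close>.  Since \<open>k\<close> is exactly the free frequency, testing
  with \<open>sin (k T)\<close> cancels the leading terms and leaves \<open>\<integral> (p + d) cos\<^sup>2 (k T) dT = O(1/k)\<close>.
  Letting \<open>n \<rightarrow> \<infinity>\<close>, the mean of \<open>p + d\<close> vanishes; as \<open>\<kappa>(0) = \<kappa>(1)\<close>, this forces \<open>A = B = 0\<close>.

  Conversely, if \<open>a = b = 1\<close> then \<open>v\<close> solves \<open>D\<^sup>2 v = k\<^sup>2 v\<close> with zero boundary values, so \<open>v = 0\<close> and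
  the eigenfunctions are the functions \<open>sin (\<pi>nx)\<close>.
\<close>

section \<open>Smooth bumps\<close>

text \<open>The factor \<open>exp (- inverse w)\<close> is the classical smooth function that is
  flat at 0. The powers of \<open>inverse w\<close> are carried along because differentiation
  produces them.\<close>

definition flat :: "nat \<Rightarrow> real \<Rightarrow> real" where
  "flat j w = (if w > 0 then exp (- inverse w) * inverse w ^ j else 0)"

lemma flat_tendsto_0: "(flat j \<longlongrightarrow> 0) (at 0)"
proof -
  have "((\<lambda>z::real. z ^ j / exp z) \<longlongrightarrow> 0) at_top"
    by (rule tendsto_power_div_exp_0)
  then have "((\<lambda>w::real. inverse w ^ j / exp (inverse w)) \<longlongrightarrow> 0) (at_right 0)"
    by (rule filterlim_compose[OF _ filterlim_inverse_at_top_right])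
  moreover have "\<forall>\<^sub>F w in at_right 0. inverse w ^ j / exp (inverse w) = flat j w"
    by (auto simp: eventually_at_filter flat_def exp_minus field_simps)
  ultimately have r: "(flat j \<longlongrightarrow> 0) (at_right 0)"
    by (rule Lim_transform_eventually)
  have "\<forall>\<^sub>F w in at_left 0. 0 = flat j w"
    by (auto simp: eventually_at_filter flat_def)
  then have "(flat j \<longlongrightarrow> 0) (at_left 0)"
    by (rule Lim_transform_eventually[OF tendsto_const])
  with r show ?thesis
    by (simp add: filterlim_split_at)
qed

lemma flat_has_derivative:
  "(flat j has_real_derivative flat (j + 2) w - real j * flat (j + 1) w) (at w)"
proof -
  consider "w > 0" | "w < 0" | "w = 0" by linarith
  then show ?thesis
  proof cases
    case 1
    have "((\<lambda>w. exp (- inverse w) * inverse w ^ j) has_real_derivative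
        exp (- inverse w) * inverse w ^ 2 * inverse w ^ j
          - exp (- inverse w) * inverse w ^ 2 * (real j * inverse w ^ (j - 1))) (at w)"
      using 1 by (auto intro!: derivative_eq_intros simp: power2_eq_square algebra_simps)
    moreover have "exp (- inverse w) * inverse w ^ 2 * inverse w ^ j
        - exp (- inverse w) * inverse w ^ 2 * (real j * inverse w ^ (j - 1))
        = flat (j + 2) w - real j * flat (j + 1) w"
      using 1 by (cases j) (simp_all add: flat_def power2_eq_square algebra_simps)
    ultimately have "((\<lambda>w. exp (- inverse w) * inverse w ^ j) has_real_derivative
        flat (j + 2) w - real j * flat (j + 1) w) (at w)"
      by simp
    then show ?thesis
      by (rule has_field_derivative_transform_within_open[where S = "{0<..}"])
        (use 1 in \<open>auto simp: flat_def\<close>)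
  next
    case 2
    have "((\<lambda>w. 0) has_real_derivative flat (j + 2) w - real j * flat (j + 1) w) (at w)"
      using 2 by (simp add: flat_def)
    then show ?thesis
      by (rule has_field_derivative_transform_within_open[where S = "{..<0}"])
        (use 2 in \<open>auto simp: flat_def\<close>)
  next
    \<comment> \<open>At 0 the difference quotient of \<open>flat j\<close> is
      \<open>flat (Suc j)\<close>, which tends to 0.\<close>
    case 3
    have "\<forall>\<^sub>F z in at 0. flat (Suc j) z = (flat j z - flat j 0) / (z - 0)"
      by (auto simp: eventually_at_filter flat_def field_simps)
    then have "((\<lambda>z. (flat j z - flat j 0) / (z - 0)) \<longlongrightarrow> 0) (at 0)"
      by (rule Lim_transform_eventually[OF flat_tendsto_0])
    then show ?thesis
      using 3 by (simp add: has_field_derivative_iff flat_def)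
  qed
qed

text \<open>A class of functions that differentiation maps into itself, so that membership gives
  derivatives of all orders without a formula for them.\<close>

inductive_set bump_span :: "real \<Rightarrow> real \<Rightarrow> (real \<Rightarrow> real) set" for c d where
  base: "(\<lambda>x. poly q x * flat j ((x - c) * (d - x))) \<in> bump_span c d"
| add: "f \<in> bump_span c d \<Longrightarrow> g \<in> bump_span c d \<Longrightarrow> (\<lambda>x. f x + g x) \<in> bump_span c d"

lemma bump_span_derivative:
  assumes "f \<in> bump_span c d"
  shows "\<exists>f'\<in>bump_span c d. \<forall>x. (f has_real_derivative f' x) (at x)"
  using assms
proof induction
  case (base q j)
  let ?w = "\<lambda>x. (x - c) * (d - x)"
  \<comment> \<open>The derivative \<open>c + d - 2 * x\<close> of \<open>?w\<close> is recorded as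
    a polynomial, so that each of the three terms of the product rule is again a generator.\<close>
  let ?w' = "[:c + d, - 2:]"
  have D: "((\<lambda>x. poly q x * flat j (?w x)) has_real_derivative
      poly (pderiv q) x * flat j (?w x) + (poly (q * ?w') x * flat (j + 2) (?w x)
        + poly (smult (- real j) (q * ?w')) x * flat (j + 1) (?w x))) (at x)" for x
  proof -
    have "(?w has_real_derivative poly ?w' x) (at x)"
      by (auto intro!: derivative_eq_intros simp: algebra_simps)
    from DERIV_chain2[OF flat_has_derivative this]
    have "((\<lambda>x. flat j (?w x)) has_real_derivative
      (flat (j + 2) (?w x) - real j * flat (j + 1) (?w x)) * poly ?w' x) (at x)" .
    from DERIV_mult[OF poly_DERIV[of q x] this] show ?thesis
      by (simp add: algebra_simps)
  qed
  show ?case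
    by (intro bexI allI, rule D) (intro bump_span.intros)
next
  case (add f g)
  then obtain f' g' where "f' \<in> bump_span c d" "\<And>x. (f has_real_derivative f' x) (at x)"
    "g' \<in> bump_span c d" "\<And>x. (g has_real_derivative g' x) (at x)" by blast
  then show ?case
    by (intro bexI[where x = "\<lambda>x. f' x + g' x"] allI DERIV_add bump_span.add) auto
qed

lemma bump_span_higher_deriv:
  assumes "f \<in> bump_span c d"
  shows "(deriv ^^ k) f \<in> bump_span c d"
proof (induction k)
  case (Suc k)
  then obtain f' where "f' \<in> bump_span c d"
    and "\<And>x. ((deriv ^^ k) f has_real_derivative f' x) (at x)"
    using bump_span_derivative by blast
  then have "deriv ((deriv ^^ k) f) = f'" by (auto intro: DERIV_imp_deriv)
  with \<open>f' \<in> _\<close> show ?case by simp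
qed (use assms in simp)

text \<open>The bump is \<open>exp (- 1 / ((x - c) * (d - x)))\<close> between \<open>c\<close> and
  \<open>d\<close>; elsewhere the product \<open>(x - c) * (d - x)\<close> is not positive, so
  \<open>flat\<close> cuts it off.\<close>

lemma bump_exists:
  assumes "0 < c" "c < d" "d < 1"
  obtains \<theta> where "test_function \<theta>" "\<And>x. \<theta> x \<ge> 0" "\<And>x. x \<notin> {c..d} \<Longrightarrow> \<theta> x = 0"
    "\<And>x. x \<in> {c<..<d} \<Longrightarrow> \<theta> x > 0"
proof -
  define \<theta> where "\<theta> = (\<lambda>x. poly 1 x * flat 0 ((x - c) * (d - x)))"
  have "\<theta> \<in> bump_span c d" unfolding \<theta>_def by (rule bump_span.base)
  then have "(deriv ^^ k) \<theta> field_differentiable at x" for k x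
    using bump_span_derivative[OF bump_span_higher_deriv] field_differentiable_def by blast
  moreover have 0: "\<theta> x = 0" if "x \<notin> {c..d}" for x
    using that assms by (auto simp: \<theta>_def flat_def zero_less_mult_iff)
  ultimately have "test_function \<theta>"
    unfolding test_function_def using assms by blast
  then show thesis
    by (rule that) (use 0 in \<open>auto simp: \<theta>_def flat_def\<close>)
qed

lemma test_function_deriv:
  assumes "test_function \<phi>"
  shows "((deriv ^^ k) \<phi> has_real_derivative (deriv ^^ Suc k) \<phi> x) (at x)"
  using assms by (simp add: test_function_def DERIV_deriv_iff_field_differentiable)

lemma test_function_continuous:
  assumes "test_function \<phi>"
  shows "continuous_on S ((deriv ^^ k) \<phi>)"
  by (meson DERIV_continuous_on assms has_field_derivative_at_within test_function_deriv)

lemma test_function_support: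
  assumes "test_function \<phi>" "x \<le> 0 \<or> x \<ge> 1"
  shows "\<phi> x = 0"
  using assms unfolding test_function_def by force

lemma test_function_diff:
  assumes \<phi>: "test_function \<phi>" and \<psi>: "test_function \<psi>"
  shows "test_function (\<lambda>x. \<phi> x - c * \<psi> x)"
    and "(deriv ^^ k) (\<lambda>x. \<phi> x - c * \<psi> x) = (\<lambda>x. (deriv ^^ k) \<phi> x - c * (deriv ^^ k) \<psi> x)"
proof -
  have *: "((\<lambda>x. (deriv ^^ k) \<phi> x - c * (deriv ^^ k) \<psi> x) has_real_derivative
      ((deriv ^^ Suc k) \<phi> x - c * (deriv ^^ Suc k) \<psi> x)) (at x)" for k x
    by (intro derivative_intros DERIV_cmult test_function_deriv \<phi> \<psi>)
  show eq: "(deriv ^^ k) (\<lambda>x. \<phi> x - c * \<psi> x) = (\<lambda>x. (deriv ^^ k) \<phi> x - c * (deriv ^^ k) \<psi> x)" for k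
  proof (induction k)
    case (Suc k)
    have "deriv (\<lambda>x. (deriv ^^ k) \<phi> x - c * (deriv ^^ k) \<psi> x) =
        (\<lambda>x. (deriv ^^ Suc k) \<phi> x - c * (deriv ^^ Suc k) \<psi> x)"
      using DERIV_imp_deriv[OF *] by blast
    with Suc show ?case by simp
  qed simp
  obtain a b a' b' where ab: "0 < a" "b < 1" "\<And>x. x \<notin> {a..b} \<Longrightarrow> \<phi> x = 0"
    "0 < a'" "b' < 1" "\<And>x. x \<notin> {a'..b'} \<Longrightarrow> \<psi> x = 0"
    using \<phi> \<psi> unfolding test_function_def by metis
  show "test_function (\<lambda>x. \<phi> x - c * \<psi> x)"
    unfolding test_function_def
  proof (intro conjI allI)
    show "(deriv ^^ k) (\<lambda>x. \<phi> x - c * \<psi> x) field_differentiable at x" for k x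
      unfolding eq field_differentiable_def using * by blast
    have "\<phi> x - c * \<psi> x = 0" if "x \<notin> {min a a'..max b b'}" for x
    proof -
      have "x \<notin> {a..b}" "x \<notin> {a'..b'}" using that by auto
      then show ?thesis using ab by simp
    qed
    moreover have "0 < min a a'" "max b b' < 1" using ab by auto
    ultimately show "\<exists>a b. 0 < a \<and> b < 1 \<and> (\<forall>x. x \<notin> {a..b} \<longrightarrow> \<phi> x - c * \<psi> x = 0)"
      by blast
  qed
qed

text \<open>The primitive is the integral from 0, which vanishes to the left of the support of
  \<eta>; the zero mean is what makes it vanish again to the right.\<close>

lemma test_function_primitive:
  assumes \<eta>: "test_function \<eta>" and "integral {0..1} \<eta> = 0"
  obtains \<phi> where "test_function \<phi>" "\<And>k. (deriv ^^ Suc k) \<phi> = (deriv ^^ k) \<eta>"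
proof -
  obtain c d where cd: "0 < c" "d < 1" "\<And>x. x \<notin> {c..d} \<Longrightarrow> \<eta> x = 0"
    using \<eta> unfolding test_function_def by metis
  have cont: "continuous_on S \<eta>" for S
    using test_function_continuous[OF \<eta>, of S 0] by simp
  note int = integrable_continuous_real[OF cont]
  define \<phi> where "\<phi> x = integral {0..x} \<eta>" for x
  have neg: "integral {a..b} \<eta> = 0" if "b < c" for a b
  proof -
    have "integral {a..b} \<eta> = integral {a..b} (\<lambda>_. 0)"
      by (rule integral_cong) (use that cd in auto)
    then show ?thesis by simp
  qed
  have pos: "integral {a..b} \<eta> = 0" if "a > d" for a b
  proof -
    have "integral {a..b} \<eta> = integral {a..b} (\<lambda>_. 0)"
      by (rule integral_cong) (use that cd in auto)
    then show ?thesis by simp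
  qed
  have deriv_phi: "(\<phi> has_real_derivative \<eta> x) (at x)" for x
  proof -
    \<comment> \<open>For negative \<open>x\<close> the set \<open>{0..x}\<close> is empty, so the
      fundamental theorem is applied from a base point to the left of both 0 and \<open>x\<close>.
      The added piece contributes nothing because \<eta> vanishes there.\<close>
    let ?a = "min x 0 - 1"
    have "((\<lambda>x. integral {?a..x} \<eta>) has_real_derivative \<eta> x) (at x within {?a..x+1})"
      by (rule integral_has_real_derivative) (auto intro: cont)
    moreover have "at x within {?a..x+1} = at x"
      by (rule at_within_interior) (simp add: min_def)
    moreover have "integral {?a..z} \<eta> = \<phi> z" if "z > ?a" for z
    proof (cases "z \<ge> 0")
      case True
      then show ?thesis
        using Henstock_Kurzweil_Integration.integral_combine[of ?a 0 z \<eta>] neg[of 0 ?a] cd int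
        by (auto simp: \<phi>_def)
    next
      case False
      then show ?thesis using neg[of z ?a] cd by (auto simp: \<phi>_def)
    qed
    ultimately have D: "((\<lambda>x. integral {?a..x} \<eta>) has_real_derivative \<eta> x) (at x)"
      and eq: "\<And>z. z \<in> {?a<..} \<Longrightarrow> integral {?a..z} \<eta> = \<phi> z"
      by (simp_all only: greaterThan_iff)
    show ?thesis
      by (rule has_field_derivative_transform_within_open[where S = "{?a<..}", OF D _ _ eq])
        auto
  qed
  then have "deriv \<phi> = \<eta>" by (intro ext DERIV_imp_deriv)
  then have eq: "(deriv ^^ Suc k) \<phi> = (deriv ^^ k) \<eta>" for k
    by (simp add: funpow_Suc_right del: funpow.simps)
  have "test_function \<phi>"
    unfolding test_function_def
  proof (intro conjI allI)
    show "(deriv ^^ k) \<phi> field_differentiable at x" for k x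
    proof (cases k)
      case 0
      then show ?thesis using deriv_phi by (auto simp: field_differentiable_def)
    next
      case (Suc j)
      then show ?thesis using \<eta> eq by (simp add: test_function_def del: funpow.simps)
    qed
    \<comment> \<open>The new ends lie strictly outside the old support: \<open>c / 2\<close>
      between 0 and \<open>c\<close>, the right end between \<open>max 0 d\<close> and 1. The
      maximum covers an empty \<open>{c..d}\<close> with negative \<open>d\<close>.\<close>
    have "\<phi> x = 0" if x: "x \<notin> {c / 2..(1 + max 0 d) / 2}" for x
    proof (cases "x < c / 2")
      case True
      then show ?thesis using neg[of x 0] cd by (simp add: \<phi>_def)
    next
      case False
      then have gt: "x > (1 + max 0 d) / 2" using x by auto
      then have "x > 0" "x > d" using cd by auto
      show ?thesis
      proof (cases "x \<le> 1")
        case True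
        have "integral {0..x} \<eta> + integral {x..1} \<eta> = integral {0..1} \<eta>"
          using True \<open>x > 0\<close> int by (intro Henstock_Kurzweil_Integration.integral_combine) auto
        then show ?thesis using assms(2) pos[of x 1] \<open>x > d\<close> by (simp add: \<phi>_def)
      next
        case False
        have "integral {0..1} \<eta> + integral {1..x} \<eta> = integral {0..x} \<eta>"
          using False int by (intro Henstock_Kurzweil_Integration.integral_combine) auto
        then show ?thesis using assms(2) pos[of 1 x] cd by (simp add: \<phi>_def)
      qed
    qed
    moreover have "0 < c / 2" "(1 + max 0 d) / 2 < 1" using cd by auto
    ultimately show "\<exists>c d. 0 < c \<and> d < 1 \<and> (\<forall>x. x \<notin> {c..d} \<longrightarrow> \<phi> x = 0)"
      by blast
  qed
  then show thesis using eq that by blast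
qed

section \<open>Weak and classical derivatives\<close>

lemma integral_by_parts_C1:
  fixes f g :: "real \<Rightarrow> real"
  assumes "a \<le> b"
    and f: "\<And>x. x \<in> {a..b} \<Longrightarrow> (f has_real_derivative f' x) (at x within {a..b})"
    and g: "\<And>x. x \<in> {a..b} \<Longrightarrow> (g has_real_derivative g' x) (at x within {a..b})"
    and "continuous_on {a..b} f'" "continuous_on {a..b} g'"
  shows "integral {a..b} (\<lambda>x. f' x * g x)
    = f b * g b - f a * g a - integral {a..b} (\<lambda>x. f x * g' x)"
proof -
  have cont: "continuous_on {a..b} f" "continuous_on {a..b} g"
    using DERIV_continuous_on[OF f] DERIV_continuous_on[OF g] by blast+
  have "((\<lambda>x. f' x * g x + f x * g' x) has_integral f b * g b - f a * g a) {a..b}"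
  proof (rule fundamental_theorem_of_calculus[OF \<open>a \<le> b\<close>])
    fix x assume "x \<in> {a..b}"
    from DERIV_mult[OF f g, OF this this]
    show "((\<lambda>x. f x * g x) has_vector_derivative f' x * g x + f x * g' x) (at x within {a..b})"
      by (simp add: has_real_derivative_iff_has_vector_derivative[symmetric] mult_ac)
  qed
  then have "integral {a..b} (\<lambda>x. f' x * g x + f x * g' x) = f b * g b - f a * g a"
    by (rule integral_unique)
  moreover have "integral {a..b} (\<lambda>x. f' x * g x + f x * g' x)
    = integral {a..b} (\<lambda>x. f' x * g x) + integral {a..b} (\<lambda>x. f x * g' x)"
    using assms cont
    by (intro Henstock_Kurzweil_Integration.integral_add integrable_continuous_real
        continuous_intros)
  ultimately show ?thesis by simp
qed

lemma integral_by_parts_indefinite: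
  fixes f g :: "real \<Rightarrow> real"
  assumes g: "g absolutely_integrable_on {0..1}"
    and f: "\<And>x. x \<in> {0..1} \<Longrightarrow> (f has_real_derivative f' x) (at x within {0..1})"
    and f': "continuous_on {0..1} f'"
  shows "integral {0..1} (\<lambda>x. f x * g x)
    = f 1 * integral {0..1} g - integral {0..1} (\<lambda>x. f' x * integral {0..x} g)"
proof -
  define G where "G x = integral {0..x} g" for x
  define H where "H x = integral {0..x} (\<lambda>x. \<bar>g x\<bar>)" for x
  define F where "F x = integral {0..x} (\<lambda>x. f x * g x)
      + integral {0..x} (\<lambda>x. f' x * G x) - f x * G x" for x
  have g01: "g integrable_on {0..1}" "(\<lambda>x. \<bar>g x\<bar>) integrable_on {0..1}"
    using g by (auto simp: absolutely_integrable_on_def)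
  have G: "continuous_on {0..1} G" and H: "continuous_on {0..1} H"
    unfolding G_def H_def by (intro indefinite_integral_continuous_1 g01)+
  have f_cont: "continuous_on {0..1} f" using f by (rule DERIV_continuous_on)
  have "(\<lambda>x. f x * g x) absolutely_integrable_on {0..1}"
    by (rule absolutely_integrable_bounded_measurable_product_real
        [OF continuous_imp_measurable_on_sets_lebesgue _ _ g])
      (auto intro: f_cont compact_imp_bounded compact_continuous_image)
  then have fg01: "(\<lambda>x. f x * g x) integrable_on {0..1}"
    by (simp add: absolutely_integrable_on_def)
  have f'G01: "(\<lambda>x. f' x * G x) integrable_on {0..1}"
    by (intro integrable_continuous_real continuous_intros f' G)
  obtain C where C: "\<And>x. x \<in> {0..1} \<Longrightarrow> \<bar>f' x\<bar> \<le> C" "C \<ge> 0"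
    using compact_imp_bounded[OF compact_continuous_image[OF f' compact_Icc]]
    by (force simp: bounded_iff intro: order_trans[OF abs_ge_zero])
  have lip: "\<bar>f y - f x\<bar> \<le> C * \<bar>y - x\<bar>" if "x \<in> {0..1}" "y \<in> {0..1}" for x y
    using field_differentiable_bound[of "{0..1}" f f' C y x] f C that by simp
  \<comment> \<open>The increment of \<open>F\<close> splits into the integrals of
    \<open>(f s - f y) * g s\<close> and of \<open>f' s * (G s - G x)\<close>. In the first,
    \<open>f\<close> is Lipschitz with constant \<open>C\<close>; in the second, \<open>G\<close>
    varies by at most \<open>H y - H x\<close>. So each is at most
    \<open>C * (y - x) * (H y - H x)\<close>, and \<open>H\<close> is continuous.\<close>
  have bound: "\<bar>F y - F x\<bar> \<le> 2 * C * \<bar>y - x\<bar> * \<bar>H y - H x\<bar>"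
    if xy: "0 \<le> x" "x \<le> y" "y \<le> 1" for x y
  proof -
    have sub: "h integrable_on {x..y}" if "h integrable_on {0..1}" for h :: "real \<Rightarrow> real"
      using that by (rule integrable_on_subinterval) (use xy in auto)
    have split: "integral {0..y} h = integral {0..x} h + integral {x..y} h"
      if "h integrable_on {0..1}" for h :: "real \<Rightarrow> real"
      by (rule Henstock_Kurzweil_Integration.integral_combine[symmetric])
        (use xy in \<open>auto intro: integrable_on_subinterval[OF that]\<close>)
    have ftc: "integral {x..y} f' = f y - f x"
      by (rule integral_unique, rule fundamental_theorem_of_calculus)
        (use f xy in \<open>auto simp: has_real_derivative_iff_has_vector_derivative[symmetric]
          intro!: DERIV_subset[OF f]\<close>)
    have HG: "\<bar>G s - G x\<bar> \<le> H y - H x" if "s \<in> {x..y}" for s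
    proof -
      have "G s - G x = integral {x..s} g" "H y - H x = integral {x..y} (\<lambda>x. \<bar>g x\<bar>)"
        using Henstock_Kurzweil_Integration.integral_combine[of 0 x s g] that xy
          split[OF g01(2)] integrable_on_subinterval[OF g01(1)]
        by (auto simp: G_def H_def)
      moreover have "\<bar>integral {x..s} g\<bar> \<le> integral {x..s} (\<lambda>x. \<bar>g x\<bar>)"
        using integral_norm_bound_integral[of g "{x..s}" "\<lambda>x. \<bar>g x\<bar>"] that xy
          integrable_on_subinterval[OF g01(1)] integrable_on_subinterval[OF g01(2)] by auto
      moreover have "integral {x..s} (\<lambda>x. \<bar>g x\<bar>) \<le> integral {x..y} (\<lambda>x. \<bar>g x\<bar>)"
        by (rule integral_subset_le)
          (use that xy in \<open>auto intro: integrable_on_subinterval[OF g01(2)]\<close>)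
      ultimately show ?thesis by simp
    qed
    have "\<bar>integral {x..y} (\<lambda>s. (f s - f y) * g s)\<bar> \<le> integral {x..y} (\<lambda>s. C * (y - x) * \<bar>g s\<bar>)"
    proof -
      have "norm (integral {x..y} (\<lambda>s. (f s - f y) * g s))
          \<le> integral {x..y} (\<lambda>s. C * (y - x) * \<bar>g s\<bar>)"
      proof (rule integral_norm_bound_integral)
        show "(\<lambda>s. (f s - f y) * g s) integrable_on {x..y}"
          unfolding left_diff_distrib
          by (intro Henstock_Kurzweil_Integration.integrable_diff integrable_on_mult_right
              sub[OF fg01] sub[OF g01(1)])
        show "(\<lambda>s. C * (y - x) * \<bar>g s\<bar>) integrable_on {x..y}"
          by (intro integrable_on_mult_right sub g01)
        fix s assume s: "s \<in> {x..y}"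
        have "\<bar>f s - f y\<bar> \<le> C * \<bar>s - y\<bar>" using lip[of y s] s xy by auto
        also have "\<dots> \<le> C * (y - x)" using s C(2) by (intro mult_left_mono) auto
        finally show "norm ((f s - f y) * g s) \<le> C * (y - x) * \<bar>g s\<bar>"
          by (simp add: abs_mult mult_right_mono)
      qed
      then show ?thesis by simp
    qed
    also have "\<dots> = C * (y - x) * (H y - H x)"
      using split[OF g01(2)] by (simp add: H_def)
    finally have 1: "\<bar>integral {x..y} (\<lambda>s. (f s - f y) * g s)\<bar> \<le> C * (y - x) * (H y - H x)" .
    have "\<bar>integral {x..y} (\<lambda>s. f' s * (G s - G x))\<bar> \<le> integral {x..y} (\<lambda>s. C * (H y - H x))"
    proof -
      have "norm (integral {x..y} (\<lambda>s. f' s * (G s - G x))) \<le> integral {x..y} (\<lambda>s. C * (H y - H x))"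
      proof (rule integral_norm_bound_integral)
        show "(\<lambda>s. f' s * (G s - G x)) integrable_on {x..y}"
          by (intro sub integrable_continuous_real continuous_intros f' G)
        fix s assume s: "s \<in> {x..y}"
        show "norm (f' s * (G s - G x)) \<le> C * (H y - H x)"
          using C HG[OF s] s xy by (auto simp: abs_mult intro!: mult_mono)
      qed auto
      then show ?thesis by simp
    qed
    also have "\<dots> = C * (y - x) * (H y - H x)" using xy by simp
    finally have 2: "\<bar>integral {x..y} (\<lambda>s. f' s * (G s - G x))\<bar> \<le> C * (y - x) * (H y - H x)" .
    have e1: "integral {x..y} (\<lambda>s. (f s - f y) * g s)
        = integral {x..y} (\<lambda>s. f s * g s) - f y * (G y - G x)"
      unfolding left_diff_distrib using split[OF g01(1)]
      by (subst Henstock_Kurzweil_Integration.integral_diff)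
        (auto intro!: integrable_on_mult_right sub fg01 g01 simp: G_def)
    have e2: "integral {x..y} (\<lambda>s. f' s * (G s - G x))
        = integral {x..y} (\<lambda>s. f' s * G s) - (f y - f x) * G x"
      unfolding right_diff_distrib ftc[symmetric]
      by (subst Henstock_Kurzweil_Integration.integral_diff)
        (simp_all add: sub[OF f'G01] integrable_on_mult_left[OF sub[OF integrable_continuous_real[OF f']]])
    have "F y - F x = integral {x..y} (\<lambda>s. (f s - f y) * g s)
        + integral {x..y} (\<lambda>s. f' s * (G s - G x))"
      unfolding e1 e2 F_def split[OF fg01] split[OF f'G01] by (simp add: algebra_simps)
    moreover have "H y - H x \<ge> 0" using HG[of x] xy by auto
    ultimately show ?thesis using 1 2 xy by simp
  qed
  have bound': "\<bar>F y - F x\<bar> \<le> 2 * C * \<bar>y - x\<bar> * \<bar>H y - H x\<bar>"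
    if "x \<in> {0..1}" "y \<in> {0..1}" for x y
    using bound[of x y] bound[of y x] that by (cases "x \<le> y") (auto simp: abs_minus_commute)
  have "(F has_real_derivative 0) (at x within {0..1})" if x: "x \<in> {0..1}" for x
    unfolding has_field_derivative_iff
  proof (rule Lim_null_comparison)
    show "\<forall>\<^sub>F y in at x within {0..1}. norm ((F y - F x) / (y - x)) \<le> 2 * C * \<bar>H y - H x\<bar>"
      using bound'[OF x]
      by (auto simp: eventually_at_filter divide_le_eq mult_ac abs_minus_commute)
    have "(H \<longlongrightarrow> H x) (at x within {0..1})" using H x by (auto simp: continuous_on)
    then show "((\<lambda>y. 2 * C * \<bar>H y - H x\<bar>) \<longlongrightarrow> 0) (at x within {0..1})"
      by (auto intro!: tendsto_eq_intros)
  qed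
  from has_field_derivative_zero_constant[OF convex_real_interval(5) this]
  have "F 1 = F 0" by (metis atLeastAtMost_iff order_refl zero_le_one)
  then show ?thesis by (simp add: F_def G_def)
qed

section \<open>Regularity of functions with weak derivatives\<close>

text \<open>The du Bois-Reymond argument: up to a multiple of one fixed bump \<theta> of nonzero
  mean, every test function is the derivative of a test function, to which the equation of order
  \<open>Suc m\<close> applies. The multiple of \<theta> accounts for the constant of
  integration.\<close>

lemma weak_deriv_Suc:
  fixes f g :: "real \<Rightarrow> real"
  assumes f: "continuous_on {0..1} f" and g: "g absolutely_integrable_on {0..1}"
    and fg: "weak_deriv (Suc m) f g"
  shows "\<exists>C. weak_deriv m f (\<lambda>x. integral {0..x} g + C)"
proof -
  define G where "G x = integral {0..x} g" for x
  have G: "continuous_on {0..1} G"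
    unfolding G_def using g
    by (intro indefinite_integral_continuous_1) (simp add: absolutely_integrable_on_def)
  obtain \<theta> where \<theta>: "test_function \<theta>" and \<theta>_nonneg: "\<And>x. \<theta> x \<ge> 0"
    and \<theta>_pos: "\<And>x. x \<in> {1/4<..<3/4} \<Longrightarrow> \<theta> x > 0"
    by (rule bump_exists[of "1/4" "3/4"]) auto
  have cont: "continuous_on S \<psi>" if "test_function \<psi>" for \<psi> S
    using test_function_continuous[OF that, of S 0] by simp
  define J where "J = integral {0..1} \<theta>"
  have "J \<noteq> 0"
    unfolding J_def using \<theta>_pos[of "1/2"] \<theta>_nonneg cont[OF \<theta>]
    by (subst integral_eq_0_iff) (auto intro!: bexI[of _ "1/2"])
  \<comment> \<open>\<open>K\<close> is the defect of the equation of order \<open>m\<close> for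
    \<theta> with trial derivative \<open>G\<close>; adding \<open>(-1) ^ m * K / J\<close> to
    \<open>G\<close> removes it.\<close>
  define K where "K = integral {0..1} (\<lambda>x. (deriv ^^ m) \<theta> x * f x)
    - (-1) ^ m * integral {0..1} (\<lambda>x. \<theta> x * G x)"
  have "integral {0..1} (\<lambda>x. (deriv ^^ m) \<psi> x * f x)
    = (-1) ^ m * integral {0..1} (\<lambda>x. \<psi> x * (G x + (-1) ^ m * K / J))"
    if \<psi>: "test_function \<psi>" for \<psi>
  proof -
    \<comment> \<open>This \<open>c\<close> gives \<open>\<eta> = \<psi> - c * \<theta>\<close> zero
      mean, so \<eta> has a primitive \<phi> among the test functions, and \<phi> is inserted into
      the given equation.\<close>
    define c where "c = integral {0..1} \<psi> / J"
    define \<eta> where "\<eta> x = \<psi> x - c * \<theta> x" for x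
    have \<eta>: "test_function \<eta>" "(deriv ^^ k) \<eta> = (\<lambda>x. (deriv ^^ k) \<psi> x - c * (deriv ^^ k) \<theta> x)" for k
      unfolding \<eta>_def using test_function_diff[OF \<psi> \<theta>] by auto
    have "integral {0..1} \<eta> = 0"
      unfolding \<eta>_def using \<open>J \<noteq> 0\<close>
      by (subst Henstock_Kurzweil_Integration.integral_diff)
        (auto intro!: integrable_continuous_real continuous_intros cont[OF \<psi>] cont[OF \<theta>] simp: c_def J_def)
    from test_function_primitive[OF \<eta>(1) this]
    obtain \<phi> where \<phi>: "test_function \<phi>" "\<And>k. (deriv ^^ Suc k) \<phi> = (deriv ^^ k) \<eta>" by blast
    have d\<phi>: "(\<phi> has_real_derivative \<eta> x) (at x within {0..1})" for x
      using test_function_deriv[OF \<phi>(1), of 0 x] \<phi>(2)[of 0]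
      by (auto intro: has_field_derivative_at_within)
    have "integral {0..1} (\<lambda>x. (deriv ^^ m) \<eta> x * f x) = (-1) ^ Suc m * integral {0..1} (\<lambda>x. \<phi> x * g x)"
      using fg \<phi>(1) unfolding weak_deriv_def integral_open_interval_real[symmetric] real_scaleR_def \<phi>(2)[symmetric]
      by blast
    also have "integral {0..1} (\<lambda>x. \<phi> x * g x) = - integral {0..1} (\<lambda>x. \<eta> x * G x)"
      using integral_by_parts_indefinite[OF g d\<phi> cont[OF \<eta>(1)]] test_function_support[OF \<phi>(1), of 1]
      by (simp add: G_def)
    finally have *: "integral {0..1} (\<lambda>x. (deriv ^^ m) \<eta> x * f x)
      = (-1) ^ m * integral {0..1} (\<lambda>x. \<eta> x * G x)" by simp
    have "integral {0..1} (\<lambda>x. (deriv ^^ m) \<eta> x * f x)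
      = integral {0..1} (\<lambda>x. (deriv ^^ m) \<psi> x * f x - c * ((deriv ^^ m) \<theta> x * f x))"
      by (simp add: \<eta>(2) algebra_simps)
    also have "\<dots> = integral {0..1} (\<lambda>x. (deriv ^^ m) \<psi> x * f x)
      - c * integral {0..1} (\<lambda>x. (deriv ^^ m) \<theta> x * f x)"
      by (subst Henstock_Kurzweil_Integration.integral_diff)
        (auto intro!: integrable_continuous_real continuous_intros test_function_continuous[OF \<psi>] test_function_continuous[OF \<theta>] f)
    finally have 1: "integral {0..1} (\<lambda>x. (deriv ^^ m) \<eta> x * f x)
      = integral {0..1} (\<lambda>x. (deriv ^^ m) \<psi> x * f x)
      - c * integral {0..1} (\<lambda>x. (deriv ^^ m) \<theta> x * f x)" .
    have "integral {0..1} (\<lambda>x. \<eta> x * G x)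
      = integral {0..1} (\<lambda>x. \<psi> x * G x - c * (\<theta> x * G x))"
      by (simp add: \<eta>_def algebra_simps)
    also have "\<dots> = integral {0..1} (\<lambda>x. \<psi> x * G x) - c * integral {0..1} (\<lambda>x. \<theta> x * G x)"
      by (subst Henstock_Kurzweil_Integration.integral_diff)
        (auto intro!: integrable_continuous_real continuous_intros cont[OF \<psi>] cont[OF \<theta>] G)
    finally have 2: "integral {0..1} (\<lambda>x. \<eta> x * G x)
      = integral {0..1} (\<lambda>x. \<psi> x * G x) - c * integral {0..1} (\<lambda>x. \<theta> x * G x)" .
    have "integral {0..1} (\<lambda>x. \<psi> x * (G x + (-1) ^ m * K / J))
      = integral {0..1} (\<lambda>x. \<psi> x * G x) + integral {0..1} (\<lambda>x. \<psi> x * ((-1) ^ m * K / J))"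
      unfolding distrib_left
      by (intro Henstock_Kurzweil_Integration.integral_add)
        (auto intro!: integrable_continuous_real continuous_intros cont[OF \<psi>] G \<open>J \<noteq> 0\<close>)
    also have "integral {0..1} (\<lambda>x. \<psi> x * ((-1) ^ m * K / J)) = (-1) ^ m * K * c"
      by (simp add: c_def)
    finally have 3: "integral {0..1} (\<lambda>x. \<psi> x * (G x + (-1) ^ m * K / J))
      = integral {0..1} (\<lambda>x. \<psi> x * G x) + (-1) ^ m * K * c" .
    have sgn: "(-1) ^ m * ((-1) ^ m * z) = z" for z :: real
      by (cases "even m") simp_all
    have "integral {0..1} (\<lambda>x. (deriv ^^ m) \<psi> x * f x)
      = (-1) ^ m * integral {0..1} (\<lambda>x. \<psi> x * G x) + K * c"
      using * unfolding 1 2 K_def by (simp add: algebra_simps)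
    then show ?thesis unfolding 3 by (simp add: distrib_left sgn mult.assoc)
  qed
  then show ?thesis
    unfolding weak_deriv_def integral_open_interval_real[symmetric] G_def by auto
qed

text \<open>Fundamental lemma of the calculus of variations: near an interior point where
  \<open>f - g\<close> does not vanish its sign is constant, and a bump there would give a nonzero
  integral. The end points follow by continuity.\<close>

lemma weak_deriv_0_imp_eq:
  fixes f g :: "real \<Rightarrow> real"
  assumes f: "continuous_on {0..1} f" and g: "continuous_on {0..1} g"
    and fg: "weak_deriv 0 f g" and "x \<in> {0..1}"
  shows "f x = g x"
proof -
  define h where "h x = f x - g x" for x
  have h: "continuous_on {0..1} h" unfolding h_def by (intro continuous_intros f g)
  have "h x = 0" if x: "x \<in> {0<..<1}" for x
  proof (rule ccontr)
    assume "h x \<noteq> 0"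
    \<comment> \<open>Multiplying by the sign of \<open>h x\<close> reduces both cases to a function
      that is positive at \<open>x\<close>.\<close>
    define s where "s y = sgn (h x) * h y" for y
    have "s x > 0" using \<open>h x \<noteq> 0\<close> by (simp add: s_def sgn_mult_self_eq abs_sgn[symmetric] mult.commute)
    have s: "continuous_on {0..1} s" unfolding s_def by (intro continuous_intros h)
    then have "isCont s x" using x continuous_on_interior[of "{0..1}" s x] by simp
    then have "(s \<longlongrightarrow> s x) (nhds x)"
      by (simp add: isCont_def tendsto_at_iff_tendsto_nhds)
    from order_tendstoD(1)[OF this \<open>s x > 0\<close>] have "\<forall>\<^sub>F y in nhds x. s y > 0" .
    then obtain e where "e > 0" and e: "\<And>y. \<bar>y - x\<bar> < e \<Longrightarrow> s y > 0"
      by (auto simp: eventually_nhds_metric dist_real_def)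
    \<comment> \<open>Halving keeps \<open>{c..d}\<close> strictly inside both the
      \<open>e\<close>-neighbourhood of \<open>x\<close> and the open unit interval.\<close>
    define c d where "c = x - min (e / 2) (x / 2)" and "d = x + min (e / 2) ((1 - x) / 2)"
    have cd: "0 < c" "c < x" "x < d" "d < 1" "x - c < e" "d - x < e"
      using \<open>e > 0\<close> x by (auto simp: c_def d_def min_def field_simps)
    obtain \<theta> where \<theta>: "test_function \<theta>" and nonneg: "\<And>y. \<theta> y \<ge> 0"
      and zero: "\<And>y. y \<notin> {c..d} \<Longrightarrow> \<theta> y = 0" and pos: "\<And>y. y \<in> {c<..<d} \<Longrightarrow> \<theta> y > 0"
      using bump_exists[of c d] cd by auto
    have \<theta>_cont: "continuous_on {0..1} \<theta>" using test_function_continuous[OF \<theta>, of _ 0] by simp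
    have "integral {0..1} (\<lambda>y. \<theta> y * s y)
        = sgn (h x) * integral {0..1} (\<lambda>y. \<theta> y * f y - \<theta> y * g y)"
      by (simp add: s_def h_def algebra_simps flip: integral_mult_right)
    also have "integral {0..1} (\<lambda>y. \<theta> y * f y - \<theta> y * g y) = 0"
      using fg \<theta>
      by (subst Henstock_Kurzweil_Integration.integral_diff)
        (auto intro!: integrable_continuous_real continuous_intros \<theta>_cont f g
          simp: weak_deriv_def integral_open_interval_real[symmetric])
    finally have "integral {0..1} (\<lambda>y. \<theta> y * s y) = 0" by simp
    moreover have "\<theta> y * s y \<ge> 0" for y
      using e[of y] cd nonneg[of y] zero[of y] by (cases "y \<in> {c..d}") (auto simp: less_imp_le)
    ultimately have "\<theta> x * s x = 0"
      using integral_eq_0_iff[OF continuous_on_mult[OF \<theta>_cont s]] x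
      by (auto simp del: mult_eq_0_iff)
    then show False using \<open>s x > 0\<close> pos[of x] cd by simp
  qed
  then have "h x = 0"
    using continuous_constant_on_closure[of "{0<..<1}" h 0 x] h assms(4) by simp
  then show ?thesis by (simp add: h_def)
qed

lemma has_derivative_indefinite_integral:
  fixes g :: "real \<Rightarrow> real"
  assumes "continuous_on {0..1} g" "x \<in> {0..1}"
  shows "((\<lambda>x. integral {0..x} g + C) has_real_derivative g x) (at x within {0..1})"
  using DERIV_add[OF integral_has_real_derivative[OF assms] DERIV_const[of C]] by simp

text \<open>Two reductions of the order lead to an equation of order 0 with a twofold primitive of
  \<open>g\<close>, which for continuous functions is a pointwise identity.\<close>

lemma weak_deriv_2_classical:
  fixes f g :: "real \<Rightarrow> real"
  assumes f: "continuous_on {0..1} f" and g: "continuous_on {0..1} g" and "weak_deriv 2 f g"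
  obtains f1 where "\<And>x. x \<in> {0..1} \<Longrightarrow> (f has_real_derivative f1 x) (at x within {0..1})"
    "\<And>x. x \<in> {0..1} \<Longrightarrow> (f1 has_real_derivative g x) (at x within {0..1})"
proof -
  from weak_deriv_Suc[OF f absolutely_integrable_continuous_real[OF g], of 1] assms(3)
  obtain C1 where "weak_deriv 1 f (\<lambda>x. integral {0..x} g + C1)" (is "weak_deriv 1 f ?f1")
    by (auto simp: eval_nat_numeral)
  have f1: "(?f1 has_real_derivative g x) (at x within {0..1})" if "x \<in> {0..1}" for x
    using has_derivative_indefinite_integral[OF g that] .
  then have c1: "continuous_on {0..1} ?f1" by (rule DERIV_continuous_on)
  from weak_deriv_Suc[OF f absolutely_integrable_continuous_real[OF this], of 0] \<open>weak_deriv 1 f ?f1\<close>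
  obtain C2 where w0: "weak_deriv 0 f (\<lambda>x. integral {0..x} ?f1 + C2)" (is "weak_deriv 0 f ?f0")
    by auto
  have f0: "(?f0 has_real_derivative ?f1 x) (at x within {0..1})" if "x \<in> {0..1}" for x
    using has_derivative_indefinite_integral[OF c1 that] .
  then have "continuous_on {0..1} ?f0" by (rule DERIV_continuous_on)
  from weak_deriv_0_imp_eq[OF f this w0] have "f x = ?f0 x" if "x \<in> {0..1}" for x
    using that .
  then have "(f has_real_derivative ?f1 x) (at x within {0..1})" if "x \<in> {0..1}" for x
    using that by (intro has_field_derivative_transform_within[OF f0[OF that] zero_less_one that]) auto
  then show thesis using f1 by (rule that)
qed

text \<open>One reduction of the order replaces the merely integrable third derivative by a
  continuous second one.\<close>

lemma sobolev_3_classical: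
  assumes "f \<in> sobolev 3" and f: "continuous_on {0..1} f"
  obtains f1 f2 where "\<And>x. x \<in> {0..1} \<Longrightarrow> (f has_real_derivative f1 x) (at x within {0..1})"
    "\<And>x. x \<in> {0..1} \<Longrightarrow> (f1 has_real_derivative f2 x) (at x within {0..1})"
    "continuous_on {0..1} f2"
proof -
  obtain g where "g absolutely_integrable_on {0<..<1}" and w: "weak_deriv 3 f g"
    using assms by (auto simp: sobolev_def)
  then have g: "g absolutely_integrable_on {0..1}"
    by (simp add: absolutely_integrable_on_Icc_iff_Ioo)
  obtain C where C: "weak_deriv 2 f (\<lambda>x. integral {0..x} g + C)"
    using weak_deriv_Suc[OF f g, of 2] w by (auto simp: eval_nat_numeral)
  have cont: "continuous_on {0..1} (\<lambda>x. integral {0..x} g + C)"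
    using g by (intro continuous_intros indefinite_integral_continuous_1)
      (simp add: absolutely_integrable_on_def)
  show thesis
    by (rule weak_deriv_2_classical[OF f cont C], rule that[OF _ _ cont])
qed

section \<open>Weak derivatives under linear maps, of classical functions, and modulo null
  sets\<close>

text \<open>Used to pass between complex and real functions: to components of an eigenfunction in
  one direction, by the embedding of the reals in the other.\<close>

lemma weak_deriv_linear:
  fixes f g :: "real \<Rightarrow> 'b::euclidean_space" and L :: "'b \<Rightarrow> 'c::euclidean_space"
  assumes L: "bounded_linear L"
    and f: "continuous_on {0..1} f" and g: "continuous_on {0..1} g"
    and "weak_deriv m f g"
  shows "weak_deriv m (\<lambda>x. L (f x)) (\<lambda>x. L (g x))"
  unfolding weak_deriv_def
proof (intro allI impI)
  fix \<phi> assume \<phi>: "test_function \<phi>"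
  interpret L: bounded_linear L by fact
  have *: "integral {0..1} (\<lambda>x. \<psi> x *\<^sub>R L (h x)) = L (integral {0..1} (\<lambda>x. \<psi> x *\<^sub>R h x))"
    if "continuous_on {0..1} \<psi>" "continuous_on {0..1} h" for \<psi> :: "real \<Rightarrow> real" and h
    using integral_linear[OF integrable_continuous_real L, of 0 1 "\<lambda>x. \<psi> x *\<^sub>R h x"] that
    by (simp add: o_def L.scaleR continuous_on_scaleR)
  have "continuous_on {0..1} ((deriv ^^ m) \<phi>)" "continuous_on {0..1} \<phi>"
    using test_function_continuous[OF \<phi>, of "{0..1}" m]
      test_function_continuous[OF \<phi>, of "{0..1}" 0] by auto
  then show "integral {0<..<1} (\<lambda>x. (deriv ^^ m) \<phi> x *\<^sub>R L (f x))
    = (-1) ^ m *\<^sub>R integral {0<..<1} (\<lambda>x. \<phi> x *\<^sub>R L (g x))"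
    using assms(4) \<phi> f g
    by (simp add: weak_deriv_def integral_open_interval_real[symmetric] * L.scaleR)
qed

text \<open>The converse direction, needed to show that the sine functions belong to the domain of
  the operator.\<close>

lemma classical_weak_deriv_2:
  fixes f g :: "real \<Rightarrow> real"
  assumes f: "\<And>x. x \<in> {0..1} \<Longrightarrow> (f has_real_derivative f1 x) (at x within {0..1})"
    and f1: "\<And>x. x \<in> {0..1} \<Longrightarrow> (f1 has_real_derivative g x) (at x within {0..1})"
    and g: "continuous_on {0..1} g"
  shows "weak_deriv 2 f g"
  unfolding weak_deriv_def integral_open_interval_real[symmetric]
proof (intro allI impI)
  fix \<phi> assume \<phi>: "test_function \<phi>"
  have d: "((deriv ^^ k) \<phi> has_real_derivative (deriv ^^ Suc k) \<phi> x) (at x within {0..1})" for k x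
    by (rule has_field_derivative_at_within[OF test_function_deriv[OF \<phi>]])
  obtain c d where cd: "0 < c" "d < 1" "\<And>x. x \<notin> {c..d} \<Longrightarrow> \<phi> x = 0"
    using \<phi> unfolding test_function_def by metis
  \<comment> \<open>Both \<phi> and its derivative vanish at 0 and 1, so neither integration by
    parts leaves boundary terms.\<close>
  have "deriv \<phi> x = 0" if "x \<notin> {c..d}" for x
  proof -
    have "(\<phi> has_real_derivative 0) (at x)"
      by (rule has_field_derivative_transform_within_open[where f = "\<lambda>_. 0" and S = "- {c..d}"])
        (use that cd in auto)
    then show ?thesis by (rule DERIV_imp_deriv)
  qed
  then have z: "\<phi> 0 = 0" "\<phi> 1 = 0" "deriv \<phi> 0 = 0" "deriv \<phi> 1 = 0" using cd by auto
  have c1: "continuous_on {0..1} f1" using f1 by (rule DERIV_continuous_on)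
  have "integral {0..1} (\<lambda>x. (deriv ^^ 2) \<phi> x * f x) = - integral {0..1} (\<lambda>x. deriv \<phi> x * f1 x)"
    using integral_by_parts_C1[OF zero_le_one d[where k = 1] f test_function_continuous[OF \<phi>, where k = "Suc 1"] c1] z
    by (simp add: numeral_2_eq_2)
  also have "\<dots> = integral {0..1} (\<lambda>x. \<phi> x * g x)"
    using integral_by_parts_C1[OF zero_le_one d[where k = 0] f1 test_function_continuous[OF \<phi>, where k = "Suc 0"] g] z
    by simp
  finally show "integral {0..1} (\<lambda>x. (deriv ^^ 2) \<phi> x *\<^sub>R f x)
    = (-1) ^ 2 *\<^sub>R integral {0..1} (\<lambda>x. \<phi> x *\<^sub>R g x)" by simp
qed

lemma weak_deriv_cong_AE:
  fixes f g g' :: "real \<Rightarrow> 'b::euclidean_space"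
  assumes "weak_deriv m f g" "AE x in lebesgue_on {0<..<1}. g x = g' x"
  shows "weak_deriv m f g'"
proof -
  have "AE x in lebesgue. x \<in> {0<..<1} \<longrightarrow> g x = g' x"
    using assms(2) by (subst (asm) AE_restrict_space_iff) auto
  then obtain N where "N \<in> null_sets lebesgue" and N: "{x. \<not> (x \<in> {0<..<1} \<longrightarrow> g x = g' x)} \<subseteq> N"
    unfolding completion.AE_iff_null_sets by auto
  then have "negligible N" by (simp add: negligible_iff_null_sets)
  then have "integral {0<..<1} (\<lambda>x. \<phi> x *\<^sub>R g x) = integral {0<..<1} (\<lambda>x. \<phi> x *\<^sub>R g' x)" for \<phi>
    by (rule integral_spike) (use N in auto)
  with assms(1) show ?thesis by (simp add: weak_deriv_def)
qed

lemma weak_deriv_cong: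
  fixes f g f' g' :: "real \<Rightarrow> 'b::euclidean_space"
  assumes "weak_deriv m f g"
    and "\<And>x. x \<in> {0..1} \<Longrightarrow> f x = f' x" "\<And>x. x \<in> {0..1} \<Longrightarrow> g x = g' x"
  shows "weak_deriv m f' g'"
proof -
  have "integral {0<..<1} (\<lambda>x. \<psi> x *\<^sub>R f x) = integral {0<..<1} (\<lambda>x. \<psi> x *\<^sub>R f' x)"
    "integral {0<..<1} (\<lambda>x. \<psi> x *\<^sub>R g x) = integral {0<..<1} (\<lambda>x. \<psi> x *\<^sub>R g' x)" for \<psi> :: "real \<Rightarrow> real"
    by (rule integral_cong; use assms in simp)+
  with assms(1) show ?thesis by (simp add: weak_deriv_def)
qed

section \<open>The equation in the variable T\<close>

text \<open>Everything stays a function of \<open>x\<close>, so that \<open>T\<close> is never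
  inverted; the measure \<open>\<xi> dx\<close> is \<open>dT\<close>. The normalization of \<xi>
  enters as \<open>T 1 = 1\<close>.\<close>

locale time_change =
  fixes \<xi> T :: "real \<Rightarrow> real"
  assumes \<xi>_cont: "continuous_on {0..1} \<xi>"
    and \<xi>_pos: "x \<in> {0..1} \<Longrightarrow> \<xi> x > 0"
    and T_deriv: "x \<in> {0..1} \<Longrightarrow> (T has_real_derivative \<xi> x) (at x within {0..1})"
    and T_0: "T 0 = 0" and T_1: "T 1 = 1"
begin

abbreviation cont :: "(real \<Rightarrow> real) \<Rightarrow> bool" where
  "cont f \<equiv> continuous_on {0..1} f"

text \<open>The derivative with respect to \<open>T\<close>, that is
  \<open>(1 / \<xi>) d/dx\<close>, as a relation, so that every derivative in use has an explicit
  name.\<close>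

definition DD :: "(real \<Rightarrow> real) \<Rightarrow> (real \<Rightarrow> real) \<Rightarrow> bool" where
  "DD f f' \<longleftrightarrow> (\<forall>x\<in>{0..1}. (f has_real_derivative \<xi> x * f' x) (at x within {0..1}))"

text \<open>The inner product of \<open>L^2(dT)\<close>.\<close>

definition ip :: "(real \<Rightarrow> real) \<Rightarrow> (real \<Rightarrow> real) \<Rightarrow> real" where
  "ip f g = integral {0..1} (\<lambda>x. f x * g x * \<xi> x)"

definition nrm :: "(real \<Rightarrow> real) \<Rightarrow> real" where
  "nrm f = sqrt (ip f f)"

section \<open>Calculus and inner product for the variable T\<close>

lemma DD_D: "DD f f' \<Longrightarrow> x \<in> {0..1} \<Longrightarrow>
    (f has_real_derivative \<xi> x * f' x) (at x within {0..1})"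
  by (simp add: DD_def)

lemma DD_cont: "DD f f' \<Longrightarrow> cont f"
  using DERIV_continuous_on[of "{0..1}" f "\<lambda>x. \<xi> x * f' x"] by (simp add: DD_def)

lemma DD_add: "DD f f' \<Longrightarrow> DD g g' \<Longrightarrow> DD (\<lambda>x. f x + g x) (\<lambda>x. f' x + g' x)"
  unfolding DD_def distrib_left by (intro ballI DERIV_add) blast+

lemma DD_diff: "DD f f' \<Longrightarrow> DD g g' \<Longrightarrow> DD (\<lambda>x. f x - g x) (\<lambda>x. f' x - g' x)"
  unfolding DD_def right_diff_distrib by (intro ballI DERIV_diff) blast+

lemma DD_mult: "DD f f' \<Longrightarrow> DD g g' \<Longrightarrow> DD (\<lambda>x. f x * g x) (\<lambda>x. f' x * g x + f x * g' x)"
  unfolding DD_def by (intro ballI, rule DERIV_cong[OF DERIV_mult]) (auto simp: algebra_simps)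

lemma DD_cmult: "DD f f' \<Longrightarrow> DD (\<lambda>x. c * f x) (\<lambda>x. c * f' x)"
  unfolding DD_def by (intro ballI, rule DERIV_cong[OF DERIV_cmult]) (auto simp: algebra_simps)

lemma DD_sin: "DD (\<lambda>x. sin (k * T x)) (\<lambda>x. k * cos (k * T x))"
  and DD_cos: "DD (\<lambda>x. cos (k * T x)) (\<lambda>x. - k * sin (k * T x))"
  unfolding DD_def
  by (intro ballI, rule DERIV_cong[OF DERIV_chain2[OF DERIV_sin DERIV_cmult[OF T_deriv]]], simp_all)
    (intro ballI, rule DERIV_cong[OF DERIV_chain2[OF DERIV_cos DERIV_cmult[OF T_deriv]]], simp_all)

lemma T_cont: "cont T"
  using T_deriv by (rule DERIV_continuous_on)

lemma ip_commute: "ip f g = ip g f"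
  by (simp add: ip_def mult_ac)

lemma ip_int: "cont f \<Longrightarrow> cont g \<Longrightarrow> (\<lambda>x. f x * g x * \<xi> x) integrable_on {0..1}"
  by (intro integrable_continuous_real continuous_intros \<xi>_cont)

lemma ip_add: "cont f \<Longrightarrow> cont g \<Longrightarrow> cont h \<Longrightarrow> ip (\<lambda>x. f x + g x) h = ip f h + ip g h"
  unfolding ip_def distrib_right
  by (intro Henstock_Kurzweil_Integration.integral_add ip_int)

lemma ip_diff: "cont f \<Longrightarrow> cont g \<Longrightarrow> cont h \<Longrightarrow> ip (\<lambda>x. f x - g x) h = ip f h - ip g h"
  unfolding ip_def left_diff_distrib
  by (intro Henstock_Kurzweil_Integration.integral_diff ip_int)

lemma ip_scale: "ip (\<lambda>x. c * f x) h = c * ip f h"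
  by (simp add: ip_def mult.assoc)

lemma ip_add': "cont f \<Longrightarrow> cont g \<Longrightarrow> cont h \<Longrightarrow> ip h (\<lambda>x. f x + g x) = ip h f + ip h g"
  using ip_add[of f g h] by (simp add: ip_commute)

lemma ip_diff': "cont f \<Longrightarrow> cont g \<Longrightarrow> cont h \<Longrightarrow> ip h (\<lambda>x. f x - g x) = ip h f - ip h g"
  using ip_diff[of f g h] by (simp add: ip_commute)

lemma ip_scale': "ip h (\<lambda>x. c * f x) = c * ip h f"
  using ip_scale[of c f h] by (simp add: ip_commute)

lemma ip_assoc: "ip (\<lambda>x. p x * f x) g = ip f (\<lambda>x. p x * g x)"
  by (simp add: ip_def mult_ac)

lemma ip_cong:
  assumes "\<And>x. x \<in> {0..1} \<Longrightarrow> f x = f' x" "\<And>x. x \<in> {0..1} \<Longrightarrow> g x = g' x"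
  shows "ip f g = ip f' g'"
  unfolding ip_def by (rule integral_cong) (simp add: assms)

lemma ip_nonneg: "cont f \<Longrightarrow> ip f f \<ge> 0"
  unfolding ip_def using \<xi>_pos
  by (intro Henstock_Kurzweil_Integration.integral_nonneg ip_int) (auto simp: less_imp_le)

lemma ip_mono:
  assumes "cont f" "cont g" "cont f'" "cont g'"
    and "\<And>x. x \<in> {0..1} \<Longrightarrow> f x * g x \<le> f' x * g' x"
  shows "ip f g \<le> ip f' g'"
  unfolding ip_def using assms \<xi>_pos
  by (intro integral_le ip_int) (auto intro!: mult_right_mono simp: less_imp_le)

lemma ip_self_eq_0: "cont f \<Longrightarrow> ip f f = 0 \<Longrightarrow> x \<in> {0..1} \<Longrightarrow> f x = 0"
  using integral_eq_0_iff[OF continuous_on_mult[OF continuous_on_mult \<xi>_cont], of f f] \<xi>_pos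
  by (fastforce simp: ip_def less_imp_le)

lemma ip_one: "ip (\<lambda>_. 1) (\<lambda>_. 1) = 1"
proof -
  have "(\<xi> has_integral T 1 - T 0) {0..1}"
    by (rule fundamental_theorem_of_calculus)
      (use T_deriv in \<open>auto simp: has_real_derivative_iff_has_vector_derivative[symmetric]\<close>)
  then show ?thesis by (simp add: ip_def integral_unique T_0 T_1)
qed

lemma ip_parts:
  assumes "DD f f'" "DD g g'" "cont f'" "cont g'"
  shows "ip f' g = f 1 * g 1 - f 0 * g 0 - ip f g'"
  using integral_by_parts_C1[OF zero_le_one DD_D[OF assms(1)] DD_D[OF assms(2)]]
  by (simp add: ip_def mult_ac continuous_on_mult assms \<xi>_cont)

lemma ip_square_one: "ip (\<lambda>x. f x * f x) (\<lambda>_. 1) = ip f f"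
  by (simp add: ip_def)

lemma nrm_ge_0: "cont f \<Longrightarrow> nrm f \<ge> 0"
  by (simp add: nrm_def ip_nonneg)

lemma nrm_sq: "cont f \<Longrightarrow> (nrm f)\<^sup>2 = ip f f"
  by (simp add: nrm_def ip_nonneg)

lemma Cauchy_Schwarz:
  assumes f: "cont f" and g: "cont g"
  shows "\<bar>ip f g\<bar> \<le> nrm f * nrm g"
proof -
  have "ip f f * t\<^sup>2 + 2 * ip f g * t + ip g g \<ge> 0" for t
  proof -
    have "0 \<le> ip (\<lambda>x. t * f x + g x) (\<lambda>x. t * f x + g x)"
      by (intro ip_nonneg continuous_intros f g)
    also have "\<dots> = ip f f * t\<^sup>2 + 2 * ip f g * t + ip g g"
      using f g by (simp add: ip_add ip_add' ip_scale ip_scale' continuous_on_add continuous_on_mult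
          power2_eq_square algebra_simps ip_commute[of g f])
    finally show ?thesis .
  qed
  note nonneg = this
  have "(ip f g)\<^sup>2 \<le> ip f f * ip g g"
  proof (cases "ip f f = 0")
    case True
    then have "f x = 0" if "x \<in> {0..1}" for x using ip_self_eq_0[OF f] that by blast
    then have "ip f g = ip (\<lambda>_. 0) g" by (intro ip_cong) auto
    then show ?thesis using True by (simp add: ip_def)
  next
    case False
    then have pos: "ip f f > 0" using ip_nonneg[OF f] by simp
    \<comment> \<open>The nonnegative quadratic is evaluated at its minimizer.\<close>
    have "0 \<le> ip f f * (ip f f * (- ip f g / ip f f)\<^sup>2 + 2 * ip f g * (- ip f g / ip f f) + ip g g)"
      using nonneg[of "- ip f g / ip f f"] pos by (intro mult_nonneg_nonneg) simp_all
    also have "\<dots> = ip f f * ip g g - (ip f g)\<^sup>2"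
      using pos by (simp add: field_simps power2_eq_square)
    finally show ?thesis by simp
  qed
  then have "\<bar>ip f g\<bar> \<le> sqrt (ip f f * ip g g)"
    by (metis real_sqrt_abs real_sqrt_le_iff)
  then show ?thesis by (simp add: nrm_def real_sqrt_mult)
qed

lemma ip_bound:
  assumes p: "cont p" and f: "cont f" and g: "cont g" and "\<And>x. x \<in> {0..1} \<Longrightarrow> \<bar>p x\<bar> \<le> K"
  shows "\<bar>ip (\<lambda>x. p x * f x) g\<bar> \<le> K * (nrm f * nrm g)"
proof -
  have "K \<ge> 0" using assms(4)[of 0] by simp
  have "norm (ip (\<lambda>x. p x * f x) g) \<le> integral {0..1} (\<lambda>x. K * (\<bar>f x\<bar> * \<bar>g x\<bar> * \<xi> x))"
    unfolding ip_def
  proof (rule integral_norm_bound_integral)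
    show "(\<lambda>x. p x * f x * g x * \<xi> x) integrable_on {0..1}"
      "(\<lambda>x. K * (\<bar>f x\<bar> * \<bar>g x\<bar> * \<xi> x)) integrable_on {0..1}"
      by (intro integrable_continuous_real continuous_intros p f g \<xi>_cont)+
    fix x :: real assume "x \<in> {0..1}"
    then show "norm (p x * f x * g x * \<xi> x) \<le> K * (\<bar>f x\<bar> * \<bar>g x\<bar> * \<xi> x)"
      using assms(4) \<xi>_pos[of x] by (auto simp: abs_mult mult.assoc intro!: mult_right_mono)
  qed
  also have "\<dots> = K * ip (\<lambda>x. \<bar>f x\<bar>) (\<lambda>x. \<bar>g x\<bar>)" by (simp add: ip_def)
  also have "ip (\<lambda>x. \<bar>f x\<bar>) (\<lambda>x. \<bar>g x\<bar>) \<le> nrm (\<lambda>x. \<bar>f x\<bar>) * nrm (\<lambda>x. \<bar>g x\<bar>)"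
    using Cauchy_Schwarz[of "\<lambda>x. \<bar>f x\<bar>" "\<lambda>x. \<bar>g x\<bar>"] f g by (simp add: continuous_on_rabs)
  also have "\<dots> = nrm f * nrm g" by (simp add: nrm_def ip_def)
  finally show ?thesis using \<open>K \<ge> 0\<close> by (simp add: mult_left_mono)
qed

lemma nrm_triangle:
  assumes f: "cont f" and g: "cont g"
  shows "nrm (\<lambda>x. f x + g x) \<le> nrm f + nrm g"
proof (rule power2_le_imp_le)
  have "(nrm (\<lambda>x. f x + g x))\<^sup>2 = ip f f + 2 * ip f g + ip g g"
    using f g by (simp add: nrm_sq ip_add ip_add' continuous_on_add ip_commute[of g f])
  also have "\<dots> \<le> (nrm f + nrm g)\<^sup>2"
    using Cauchy_Schwarz[OF f g] f g by (simp add: power2_sum nrm_sq)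
  finally show "(nrm (\<lambda>x. f x + g x))\<^sup>2 \<le> (nrm f + nrm g)\<^sup>2" .
qed (use f g in \<open>simp add: nrm_ge_0\<close>)

lemma nrm_scale: "nrm (\<lambda>x. c * f x) = \<bar>c\<bar> * nrm f"
  by (simp add: nrm_def ip_scale ip_scale' real_sqrt_mult flip: mult.assoc)

lemma nrm_le_1:
  assumes "cont f" "\<And>x. x \<in> {0..1} \<Longrightarrow> \<bar>f x\<bar> \<le> 1"
  shows "nrm f \<le> 1"
proof -
  have "ip f f \<le> ip (\<lambda>_. 1) (\<lambda>_. 1)"
    using assms by (intro ip_mono) (auto simp: abs_square_le_1 simp flip: power2_eq_square)
  then show ?thesis by (simp add: nrm_def ip_one)
qed

section \<open>Estimates for eigenfunctions of large frequency\<close>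

text \<open>For \<open>D\<^sup>2 z + k\<^sup>2 z = v\<close> with zero initial data, the energy
  \<open>E\<close> has \<open>T\<close>-derivative \<open>2 * z1 * v\<close>. Young's inequality
  bounds \<open>E\<close> by \<open>M\<close> everywhere; taking the mean of \<open>E\<close> then
  absorbs the part of \<open>M\<close> that contains \<open>z1\<close>.\<close>

lemma oscillator_energy:
  assumes z: "DD z z1" and z1: "DD z1 (\<lambda>x. v x - k\<^sup>2 * z x)" and v: "cont v"
    and "z 0 = 0" "z1 0 = 0"
  shows "nrm z1 \<le> 2 * nrm v" and "\<bar>k\<bar> * nrm z \<le> 2 * nrm v"
proof -
  note c = DD_cont[OF z] DD_cont[OF z1] v
  define E where "E x = z1 x * z1 x + k\<^sup>2 * (z x * z x)" for x
  define M where "M = ip z1 z1 / 2 + 2 * ip v v"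
  have E: "E x \<le> M" if x: "x \<in> {0..1}" for x
  proof -
    have "((\<lambda>s. 2 * z1 s * v s * \<xi> s) has_integral E x - E 0) {0..x}"
    proof (rule fundamental_theorem_of_calculus)
      fix s assume s: "s \<in> {0..x}"
      then have s01: "s \<in> {0..1}" using x by simp
      have "(E has_real_derivative 2 * z1 s * v s * \<xi> s) (at s within {0..1})"
        unfolding E_def
        by (rule DERIV_cong[OF DERIV_add[OF DERIV_mult[OF DD_D[OF z1 s01] DD_D[OF z1 s01]]
            DERIV_cmult[OF DERIV_mult[OF DD_D[OF z s01] DD_D[OF z s01]]]]])
          (simp add: algebra_simps)
      then show "(E has_vector_derivative 2 * z1 s * v s * \<xi> s) (at s within {0..x})"
        using x by (auto simp: has_real_derivative_iff_has_vector_derivative[symmetric]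
            intro: DERIV_subset)
    qed (use x in simp)
    moreover have "E 0 = 0" using assms by (simp add: E_def)
    ultimately have "E x = integral {0..x} (\<lambda>s. 2 * z1 s * v s * \<xi> s)"
      by (simp add: integral_unique)
    also have "\<dots> \<le> integral {0..x} (\<lambda>s. (z1 s * z1 s / 2 + 2 * (v s * v s)) * \<xi> s)"
    proof (rule integral_le)
      show "(\<lambda>s. 2 * z1 s * v s * \<xi> s) integrable_on {0..x}"
        "(\<lambda>s. (z1 s * z1 s / 2 + 2 * (v s * v s)) * \<xi> s) integrable_on {0..x}"
        using x by (auto intro!: integrable_continuous_real continuous_intros
            continuous_on_subset[OF c(2)] continuous_on_subset[OF v] continuous_on_subset[OF \<xi>_cont])
      fix s assume "s \<in> {0..x}"
      then have "\<xi> s \<ge> 0" using x \<xi>_pos[of s] by auto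
      \<comment> \<open>The weights leave only half of \<open>ip z1 z1\<close> in \<open>M\<close>,
        which the left-hand side can absorb.\<close>
      moreover have "2 * z1 s * v s \<le> z1 s * z1 s / 2 + 2 * (v s * v s)"
        using zero_le_power2[of "z1 s - 2 * v s"] by (simp add: power2_eq_square algebra_simps)
      ultimately show "2 * z1 s * v s * \<xi> s \<le> (z1 s * z1 s / 2 + 2 * (v s * v s)) * \<xi> s"
        by (rule mult_right_mono[rotated])
    qed
    also have "\<dots> \<le> integral {0..1} (\<lambda>s. (z1 s * z1 s / 2 + 2 * (v s * v s)) * \<xi> s)"
    proof (rule integral_subset_le)
      show "(\<lambda>s. (z1 s * z1 s / 2 + 2 * (v s * v s)) * \<xi> s) integrable_on {0..x}"
        "(\<lambda>s. (z1 s * z1 s / 2 + 2 * (v s * v s)) * \<xi> s) integrable_on {0..1}"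
        using x by (auto intro!: integrable_continuous_real continuous_intros
            continuous_on_subset[OF c(2)] continuous_on_subset[OF v] continuous_on_subset[OF \<xi>_cont])
    qed (use x \<xi>_pos in \<open>auto simp: less_imp_le\<close>)
    also have "\<dots> = ip (\<lambda>s. (1 / 2) * (z1 s * z1 s) + 2 * (v s * v s)) (\<lambda>_. 1)"
      by (simp add: ip_def)
    also have "\<dots> = M"
      unfolding M_def using c
      by (subst ip_add) (auto simp only: ip_scale ip_square_one intro!: continuous_intros)
    finally show ?thesis .
  qed
  have "ip E (\<lambda>_. 1) \<le> ip (\<lambda>_. M) (\<lambda>_. 1)"
    using E unfolding E_def by (intro ip_mono) (auto intro!: continuous_intros c)
  also have "ip (\<lambda>_. M) (\<lambda>_. 1) = M"
    using ip_scale[of M "\<lambda>_. 1" "\<lambda>_. 1"] ip_one by simp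
  also have "ip E (\<lambda>_. 1) = ip z1 z1 + k\<^sup>2 * ip z z"
    unfolding E_def using c by (simp add: ip_add ip_scale continuous_on_mult) (simp add: ip_def)
  finally have *: "(nrm z1)\<^sup>2 + k\<^sup>2 * (nrm z)\<^sup>2 \<le> (nrm z1)\<^sup>2 / 2 + 2 * (nrm v)\<^sup>2"
    using c by (simp add: M_def nrm_sq)
  have "k\<^sup>2 * (nrm z)\<^sup>2 \<ge> 0" by simp
  with * have "(nrm z1)\<^sup>2 \<le> 4 * (nrm v)\<^sup>2" by linarith
  then have "(nrm z1)\<^sup>2 \<le> (2 * nrm v)\<^sup>2" by (simp add: power_mult_distrib)
  then show "nrm z1 \<le> 2 * nrm v"
    using nrm_ge_0[OF v] by (intro power2_le_imp_le[of "nrm z1"]) auto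
  have "(nrm z1)\<^sup>2 \<ge> 0" "(nrm v)\<^sup>2 \<ge> 0" by simp_all
  with * have "k\<^sup>2 * (nrm z)\<^sup>2 \<le> 4 * (nrm v)\<^sup>2" by linarith
  then have "(\<bar>k\<bar> * nrm z)\<^sup>2 \<le> (2 * nrm v)\<^sup>2" by (simp add: power_mult_distrib)
  then show "\<bar>k\<bar> * nrm z \<le> 2 * nrm v"
    using nrm_ge_0[OF v] by (intro power2_le_imp_le[of "\<bar>k\<bar> * nrm z"]) auto
qed

lemmas ip_linear = ip_add ip_add' ip_diff ip_diff' ip_scale ip_scale'
  continuous_on_add continuous_on_diff continuous_on_mult

text \<open>The estimates are explicit in a bound \<open>K\<close> for the coefficients, so that
  \<open>k\<close> can later tend to infinity with \<open>K\<close> fixed. The lower bound on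
  \<open>k\<close> keeps the amplitude of the sine part of \<open>y\<close> away from 0.\<close>

lemma eigenfunction_close_to_sine:
  fixes K k :: real
  assumes y: "DD y y1" "DD y1 y2" "DD y2 y3" and y3: "cont y3"
    and bc: "y 0 = 0" "y 1 = 0" "y2 0 = 0" "y2 1 = 0"
    and cc: "cont p" "cont q" "cont e" "cont h" "cont d1" and d: "DD d d1"
    and weak: "\<And>s s1. DD s s1 \<Longrightarrow> cont s1 \<Longrightarrow> s 0 = 0 \<Longrightarrow> s 1 = 0 \<Longrightarrow>
      - ip (\<lambda>x. y3 x + p x * y1 x + q x * y x) s1
        + ip (\<lambda>x. d x * y2 x + e x * y1 x + h x * y x) s = k ^ 4 * ip y s"
    and bounds: "\<And>x. x \<in> {0..1} \<Longrightarrow> \<bar>p x\<bar> \<le> K" "\<And>x. x \<in> {0..1} \<Longrightarrow> \<bar>q x\<bar> \<le> K"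
      "\<And>x. x \<in> {0..1} \<Longrightarrow> \<bar>e x\<bar> \<le> K" "\<And>x. x \<in> {0..1} \<Longrightarrow> \<bar>h x\<bar> \<le> K"
      "\<And>x. x \<in> {0..1} \<Longrightarrow> \<bar>d x\<bar> \<le> K" "\<And>x. x \<in> {0..1} \<Longrightarrow> \<bar>d1 x\<bar> \<le> K"
    and K: "K \<ge> 1" and k: "k \<ge> 32 * K\<^sup>2" and sink: "sin k = 0"
    and norm: "nrm y = 1"
  shows "\<bar>ip (\<lambda>x. p x + d x) (\<lambda>x. (cos (k * T x))\<^sup>2)\<bar> \<le> 76 * K ^ 3 / k"
proof -
  note c = DD_cont[OF y(1)] DD_cont[OF y(2)] DD_cont[OF y(3)] y3 cc DD_cont[OF d]
  have K2: "K \<le> K\<^sup>2" "1 \<le> K\<^sup>2"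
    using K mult_mono[of 1 K 1 K] mult_left_mono[of 1 K K] by (auto simp: power2_eq_square)
  have k1: "k \<ge> 1" using k K2 by linarith
  define U W where "U = nrm y1" and "W = nrm y2"
  have UW0: "U \<ge> 0" "W \<ge> 0" by (auto simp: U_def W_def nrm_ge_0 c)

  have weak': "- ip y3 s1 - ip (\<lambda>x. p x * y1 x) s1 - ip (\<lambda>x. q x * y x) s1
      + ip (\<lambda>x. d x * y2 x) s + ip (\<lambda>x. e x * y1 x) s + ip (\<lambda>x. h x * y x) s = k ^ 4 * ip y s"
    if s: "DD s s1" "cont s1" "s 0 = 0" "s 1 = 0" for s s1
    using weak[OF s] c s(2) DD_cont[OF s(1)] by (simp add: ip_linear)

  \<comment> \<open>Interpolation: one integration by parts, Cauchy-Schwarz and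
    \<open>nrm y = 1\<close>.\<close>
  have y11: "U\<^sup>2 \<le> W"
  proof -
    have "ip y1 y1 = - ip y y2" using ip_parts[OF y(1,2)] c bc by simp
    then show ?thesis
      using Cauchy_Schwarz[of y y2] c by (simp add: U_def W_def nrm_sq norm)
  qed
  have "W\<^sup>2 \<le> k ^ 4 + 3 * K * W + 2 * K"
  proof -
    \<comment> \<open>The weak equation is tested with \<open>y\<close> itself.\<close>
    have "ip y3 y1 = - ip y2 y2" using ip_parts[OF y(3,2)] c bc by simp
    then have "W\<^sup>2 = k ^ 4 + ip (\<lambda>x. p x * y1 x) y1 + ip (\<lambda>x. q x * y x) y1
        - ip (\<lambda>x. d x * y2 x) y - ip (\<lambda>x. e x * y1 x) y - ip (\<lambda>x. h x * y x) y"
      using weak'[OF y(1) c(2) bc(1,2)] nrm_sq[OF c(1)] nrm_sq[OF c(3)] by (simp add: W_def norm)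
    moreover have "\<bar>ip (\<lambda>x. p x * y1 x) y1\<bar> \<le> K * U\<^sup>2"
      using ip_bound[OF cc(1) c(2,2) bounds(1)] by (simp add: U_def power2_eq_square)
    moreover have "\<bar>ip (\<lambda>x. q x * y x) y1\<bar> \<le> K * U"
      using ip_bound[OF cc(2) c(1,2) bounds(2)] by (simp add: U_def norm)
    moreover have "\<bar>ip (\<lambda>x. d x * y2 x) y\<bar> \<le> K * W"
      using ip_bound[OF DD_cont[OF d] c(3,1) bounds(5)] by (simp add: W_def norm)
    moreover have "\<bar>ip (\<lambda>x. e x * y1 x) y\<bar> \<le> K * U"
      using ip_bound[OF cc(3) c(2,1) bounds(3)] by (simp add: U_def norm)
    moreover have "\<bar>ip (\<lambda>x. h x * y x) y\<bar> \<le> K"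
      using ip_bound[OF cc(4) c(1,1) bounds(4)] by (simp add: norm)
    moreover have "K * U\<^sup>2 \<le> K * W" using y11 K by (intro mult_left_mono) auto
    \<comment> \<open>The terms linear in \<open>U\<close> are traded for \<open>W\<close> by
      \<open>2 * U \<le> U\<^sup>2 + 1\<close>.\<close>
    moreover have "K * (2 * U) \<le> K * (W + 1)"
      using y11 K zero_le_power2[of "U - 1"] by (intro mult_left_mono) (auto simp: power2_diff)
    ultimately show ?thesis by (simp add: algebra_simps abs_le_iff)
  qed
  \<comment> \<open>Young's inequality \<open>6 * K * W \<le> W\<^sup>2 + 9 * K\<^sup>2\<close>
    absorbs the linear term. The resulting coefficients \<open>2 + 9 + 4 = 15\<close> stay below 16,
    the square of the 4 in the final bound.\<close>
  then have "W\<^sup>2 \<le> 2 * k ^ 4 + 9 * K\<^sup>2 + 4 * K"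
    using zero_le_power2[of "W - 3 * K"] by (simp add: power2_diff power_mult_distrib mult_ac)
  also have "\<dots> \<le> 2 * (K\<^sup>2 * k ^ 4) + 9 * (K\<^sup>2 * k ^ 4) + 4 * (K\<^sup>2 * k ^ 4)"
  proof -
    have "1 \<le> k ^ 4" using k1 by simp
    then have "K\<^sup>2 \<le> K\<^sup>2 * k ^ 4" "k ^ 4 \<le> K\<^sup>2 * k ^ 4"
      using K2 mult_left_mono[of 1 "k ^ 4" "K\<^sup>2"] mult_right_mono[of 1 "K\<^sup>2" "k ^ 4"] by auto
    then show ?thesis using K2 by linarith
  qed
  also have "\<dots> \<le> (4 * K * k\<^sup>2)\<^sup>2"
    by (simp add: power_mult_distrib flip: power_mult)
  finally have W: "W \<le> 4 * K * k\<^sup>2"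
    by (rule power2_le_imp_le) (use K in simp)
  have "U\<^sup>2 \<le> (2 * K * k)\<^sup>2"
    using y11 W mult_right_mono[OF K2(1), of "4 * k\<^sup>2"] by (simp add: power_mult_distrib)
  then have U: "U \<le> 2 * K * k"
    by (rule power2_le_imp_le) (use K k1 in simp)

  \<comment> \<open>The unperturbed operator \<open>D\<^sup>4 - k\<^sup>4\<close> factors as
    \<open>(D\<^sup>2 - k\<^sup>2) (D\<^sup>2 + k\<^sup>2)\<close>; \<open>v\<close> is the image of
    \<open>y\<close> under the second factor and would vanish for
    \<open>y = sin (k T)\<close>.\<close>
  define v where "v x = y2 x + k\<^sup>2 * y x" for x
  define v1 where "v1 x = y3 x + k\<^sup>2 * y1 x" for x
  have v: "DD v v1" unfolding v_def v1_def by (intro DD_add DD_cmult y)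
  have v1: "cont v1" unfolding v1_def by (intro continuous_intros c)
  note cv = DD_cont[OF v] v1
  have bcv: "v 0 = 0" "v 1 = 0" by (simp_all add: v_def bc)
  define V X where "V = nrm v" and "X = nrm v1"
  have VX0: "V \<ge> 0" "X \<ge> 0" by (auto simp: V_def X_def nrm_ge_0 cv)
  have V: "V \<le> 8 * K\<^sup>2"
  proof -
    \<comment> \<open>The weak equation is tested with \<open>v\<close>. The terms
      \<open>k\<^sup>2 * ip y2 v\<close> arising on both sides cancel, which leaves the definite
      form \<open>X\<^sup>2 + k\<^sup>2 * V\<^sup>2\<close>.\<close>
    have e1: "ip y3 v1 = X\<^sup>2 - k\<^sup>2 * ip y1 v1"
    proof -
      have "y3 = (\<lambda>x. v1 x - k\<^sup>2 * y1 x)" by (auto simp: v1_def)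
      then have "ip y3 v1 = ip (\<lambda>x. v1 x - k\<^sup>2 * y1 x) v1" by simp
      also have "\<dots> = ip v1 v1 - k\<^sup>2 * ip y1 v1" using c cv by (simp add: ip_linear)
      finally show ?thesis using cv by (simp add: X_def nrm_sq)
    qed
    have e2: "ip y1 v1 = - ip y2 v"
      using ip_parts[OF v y(2)] c cv bcv by (simp add: ip_commute[of _ v1] ip_commute[of _ v])
    have e3: "k ^ 4 * ip y v = k\<^sup>2 * (V\<^sup>2 - ip y2 v)"
    proof -
      have "ip v v = ip (\<lambda>x. y2 x + k\<^sup>2 * y x) v" by (simp add: v_def[abs_def])
      also have "\<dots> = ip y2 v + k\<^sup>2 * ip y v" using c cv by (simp add: ip_linear)
      finally show ?thesis using cv by (simp add: V_def nrm_sq flip: power_add)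
    qed
    have "X\<^sup>2 + k\<^sup>2 * V\<^sup>2 = - ip (\<lambda>x. p x * y1 x) v1 - ip (\<lambda>x. q x * y x) v1
        + ip (\<lambda>x. d x * y2 x) v + ip (\<lambda>x. e x * y1 x) v + ip (\<lambda>x. h x * y x) v"
      using weak'[OF v v1 bcv] unfolding e3 e1 e2 by (simp add: algebra_simps)
    moreover have "\<bar>ip (\<lambda>x. p x * y1 x) v1\<bar> \<le> K * (U * X)"
      using ip_bound[OF cc(1) c(2) v1 bounds(1)] by (simp add: U_def X_def)
    moreover have "\<bar>ip (\<lambda>x. q x * y x) v1\<bar> \<le> K * X"
      using ip_bound[OF cc(2) c(1) v1 bounds(2)] by (simp add: X_def norm)
    moreover have "\<bar>ip (\<lambda>x. d x * y2 x) v\<bar> \<le> K * (W * V)"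
      using ip_bound[OF DD_cont[OF d] c(3) cv(1) bounds(5)] by (simp add: W_def V_def)
    moreover have "\<bar>ip (\<lambda>x. e x * y1 x) v\<bar> \<le> K * (U * V)"
      using ip_bound[OF cc(3) c(2) cv(1) bounds(3)] by (simp add: U_def V_def)
    moreover have "\<bar>ip (\<lambda>x. h x * y x) v\<bar> \<le> K * V"
      using ip_bound[OF cc(4) c(1) cv(1) bounds(4)] by (simp add: V_def norm)
    ultimately have "X\<^sup>2 + k\<^sup>2 * V\<^sup>2 \<le> (K * U + K) * X + (K * W + K * U + K) * V"
      by (simp add: algebra_simps abs_le_iff)
    also have "\<dots> \<le> (3 * (K\<^sup>2 * k)) * X + (7 * (K\<^sup>2 * k\<^sup>2)) * V"
    proof (intro add_mono mult_right_mono)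
      have kk: "k \<le> k\<^sup>2" using k1 by (simp add: power2_eq_square)
      have KU: "K * U \<le> 2 * (K\<^sup>2 * k)"
        using mult_left_mono[OF U, of K] K by (simp add: power2_eq_square mult_ac)
      have KW: "K * W \<le> 4 * (K\<^sup>2 * k\<^sup>2)"
        using mult_left_mono[OF W, of K] K by (simp add: power2_eq_square mult_ac)
      have Kk: "K \<le> K\<^sup>2 * k" using K2(1) k1 K mult_mono[of K "K\<^sup>2" 1 k] by simp
      have "K\<^sup>2 * k \<le> K\<^sup>2 * k\<^sup>2" using kk by (intro mult_left_mono) auto
      then show "K * U + K \<le> 3 * (K\<^sup>2 * k)" "K * W + K * U + K \<le> 7 * (K\<^sup>2 * k\<^sup>2)"
        using KU KW Kk by linarith+
    qed (use VX0 in auto)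
    \<comment> \<open>Completing the square removes \<open>X\<close> altogether; what remains is
      divisible by \<open>k\<^sup>2\<close>.\<close>
    also have "(3 * (K\<^sup>2 * k)) * X \<le> X\<^sup>2 + 9 / 4 * (K\<^sup>2 * k)\<^sup>2"
      using zero_le_power2[of "X - 3 / 2 * (K\<^sup>2 * k)"]
      by (simp add: power2_eq_square algebra_simps)
    finally have "k\<^sup>2 * V\<^sup>2 \<le> k\<^sup>2 * (9 / 4 * (K\<^sup>2)\<^sup>2 + 7 * K\<^sup>2 * V)"
      by (simp add: algebra_simps power_mult_distrib)
    then have *: "V\<^sup>2 \<le> 9 / 4 * (K\<^sup>2)\<^sup>2 + 7 * K\<^sup>2 * V"
      using k1 by (simp add: mult_le_cancel_left_pos)
    \<comment> \<open>The larger root of the quadratic lies below \<open>8 * K\<^sup>2\<close>: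
      beyond that value the spare \<open>K\<^sup>2 * V\<close> already exceeds the constant
      term.\<close>
    show ?thesis
    proof (rule ccontr)
      assume "\<not> V \<le> 8 * K\<^sup>2"
      then have "8 * K\<^sup>2 < V" by simp
      then have "K\<^sup>2 * (8 * K\<^sup>2) \<le> K\<^sup>2 * V" "8 * K\<^sup>2 * V \<le> V * V"
        using K2 by (auto intro!: mult_left_mono mult_right_mono)
      moreover have "(K\<^sup>2)\<^sup>2 > 0" using K by simp
      ultimately show False using * by (simp add: power2_eq_square)
    qed
  qed

  define S C where "S x = sin (k * T x)" and "C x = cos (k * T x)" for x
  have S: "DD S (\<lambda>x. k * C x)" and C: "DD C (\<lambda>x. - k * S x)"
    unfolding S_def C_def by (rule DD_sin DD_cos)+
  note cs = DD_cont[OF S] DD_cont[OF C]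
  have S01: "S 0 = 0" "S 1 = 0" by (simp_all add: S_def T_0 T_1 sink)
  have nS: "nrm S \<le> 1" and nC: "nrm C \<le> 1"
    using nrm_le_1[OF cs(1)] nrm_le_1[OF cs(2)] by (simp_all add: S_def C_def)
  \<comment> \<open>The amplitude is chosen to give \<open>z\<close> zero initial data, so that the
    energy estimate applies to it.\<close>
  define A where "A = y1 0 / k"
  define z where "z x = y x - A * S x" for x
  define z1 where "z1 x = y1 x - A * (k * C x)" for x
  have z: "DD z z1" unfolding z_def z1_def by (intro DD_diff DD_cmult y S)
  have "DD z1 (\<lambda>x. y2 x - A * (k * (- k * S x)))"
    unfolding z1_def by (intro DD_diff DD_cmult y C)
  moreover have "(\<lambda>x. y2 x - A * (k * (- k * S x))) = (\<lambda>x. v x - k\<^sup>2 * z x)"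
    by (auto simp: v_def z_def power2_eq_square algebra_simps)
  ultimately have z1: "DD z1 (\<lambda>x. v x - k\<^sup>2 * z x)" by simp
  note cz = DD_cont[OF z] DD_cont[OF z1]
  have z0: "z 0 = 0" "z1 0 = 0"
    using k1 by (simp_all add: z_def z1_def bc S01 A_def C_def T_0)
  have z1_bound: "nrm z1 \<le> 16 * K\<^sup>2" and z_bound: "k * nrm z \<le> 16 * K\<^sup>2"
    using oscillator_energy[OF z z1 cv(1) z0] V k1 by (simp_all add: V_def)
  \<comment> \<open>\<open>1 = nrm y \<le> \<bar>A\<bar> + nrm z\<close>, and
    \<open>nrm z \<le> 16 * K\<^sup>2 / k\<close> is at most a half by the size of
    \<open>k\<close>.\<close>
  have A: "\<bar>A\<bar> \<ge> 1 / 2"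
  proof -
    have "y = (\<lambda>x. A * S x + z x)" by (auto simp: z_def)
    then have "1 \<le> nrm (\<lambda>x. A * S x) + nrm z"
      using nrm_triangle[of "\<lambda>x. A * S x" z] cs cz norm by (simp add: continuous_on_mult)
    also have "nrm (\<lambda>x. A * S x) \<le> \<bar>A\<bar> * 1"
      unfolding nrm_scale using nS by (intro mult_left_mono) auto
    also have "nrm z \<le> 1 / 2"
    proof -
      have "K\<^sup>2 * (32 * nrm z) \<le> k * nrm z"
        using mult_right_mono[OF k nrm_ge_0[OF cz(1)]] by (simp add: mult_ac)
      also have "\<dots> \<le> K\<^sup>2 * 16" using z_bound by simp
      finally show ?thesis using K by (simp add: mult_le_cancel_left)
    qed
    finally show ?thesis by simp
  qed

  define P where "P x = p x + d x" for x
  have cP: "cont P" unfolding P_def by (intro continuous_intros c)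
  \<comment> \<open>The weak equation is tested with \<open>S\<close>. Three integrations by parts
    turn the term with \<open>y3\<close> into a multiple of \<open>ip y S\<close> that cancels the
    eigenvalue term, because \<open>k\<close> is exactly the frequency of \<open>S\<close>. One more
    moves a derivative off \<open>y2\<close> in the term with \<open>d\<close>, so that
    \<open>p\<close> and \<open>d\<close> enter through their sum \<open>P\<close>.\<close>
  have main: "ip (\<lambda>x. P x * y1 x) (\<lambda>x. k * C x) = - ip (\<lambda>x. q x * y x) (\<lambda>x. k * C x)
      + ip (\<lambda>x. e x * y1 x) S - ip (\<lambda>x. d1 x * y1 x) S + ip (\<lambda>x. h x * y x) S"
  proof -
    have ckC: "cont (\<lambda>x. k * C x)" and ckS: "cont (\<lambda>x. - k * S x)"
      by (intro continuous_intros cs)+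
    have "ip y3 (\<lambda>x. k * C x) = k * ip y3 C" by (simp add: ip_scale')
    also have "ip y3 C = - ip y2 (\<lambda>x. - k * S x)"
      using ip_parts[OF y(3) C y3 ckS] bc by simp
    also have "\<dots> = k * ip y2 S" by (simp only: ip_scale')
    also have "ip y2 S = - ip y1 (\<lambda>x. k * C x)"
      using ip_parts[OF y(2) S c(3) ckC] S01 by simp
    also have "\<dots> = - k * ip y1 C" by (simp add: ip_scale')
    also have "ip y1 C = - ip y (\<lambda>x. - k * S x)"
      using ip_parts[OF y(1) C c(2) ckS] bc by simp
    also have "\<dots> = k * ip y S" by (simp only: ip_scale')
    finally have y3: "ip y3 (\<lambda>x. k * C x) = - (k ^ 4 * ip y S)" by (simp add: power4_eq_xxxx)
    have "ip (\<lambda>x. d x * y2 x) S = ip y2 (\<lambda>x. d x * S x)" by (rule ip_assoc)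
    also have "\<dots> = - ip y1 (\<lambda>x. d1 x * S x + d x * (k * C x))"
      using ip_parts[OF y(2) DD_mult[OF d S] c(3)] S01
      by (simp add: c cs ckC continuous_on_add continuous_on_mult)
    also have "\<dots> = - ip (\<lambda>x. d1 x * y1 x) S - ip (\<lambda>x. d x * y1 x) (\<lambda>x. k * C x)"
      using c cs ckC by (simp add: ip_add' continuous_on_mult ip_assoc)
    finally have dy2: "ip (\<lambda>x. d x * y2 x) S
      = - ip (\<lambda>x. d1 x * y1 x) S - ip (\<lambda>x. d x * y1 x) (\<lambda>x. k * C x)" .
    have "ip (\<lambda>x. P x * y1 x) (\<lambda>x. k * C x)
      = ip (\<lambda>x. p x * y1 x) (\<lambda>x. k * C x) + ip (\<lambda>x. d x * y1 x) (\<lambda>x. k * C x)"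
      unfolding P_def distrib_right using c ckC by (simp add: ip_add continuous_on_mult cs)
    then show ?thesis
      using weak'[OF S ckC S01] unfolding y3 dy2 by simp
  qed
  \<comment> \<open>The six units are one from \<open>q\<close>, two each from \<open>e\<close> and
    \<open>d1\<close>, and one from \<open>h\<close>.\<close>
  have Ib: "\<bar>ip (\<lambda>x. P x * y1 x) (\<lambda>x. k * C x)\<bar> \<le> 6 * (K\<^sup>2 * k)"
  proof -
    have KS: "K * (a * nrm S) \<le> K * a" "K * (a * nrm C) \<le> K * a" if "a \<ge> 0" for a
      using nS nC K that by (auto intro!: mult_left_mono mult_left_le)
    have "\<bar>ip (\<lambda>x. q x * y x) (\<lambda>x. k * C x)\<bar> \<le> K * (nrm y * nrm (\<lambda>x. k * C x))"
      using c cs by (intro ip_bound bounds continuous_intros)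
    also have "\<dots> \<le> K * k" using KS(2)[of k] k1 by (simp add: norm nrm_scale)
    finally have 1: "\<bar>ip (\<lambda>x. q x * y x) (\<lambda>x. k * C x)\<bar> \<le> K * k" .
    have 2: "\<bar>ip (\<lambda>x. e x * y1 x) S\<bar> \<le> K * U" "\<bar>ip (\<lambda>x. d1 x * y1 x) S\<bar> \<le> K * U"
      using ip_bound[OF cc(3) c(2) cs(1) bounds(3)] ip_bound[OF cc(5) c(2) cs(1) bounds(6)]
        KS(1)[OF UW0(1)] by (simp_all add: U_def)
    have 3: "\<bar>ip (\<lambda>x. h x * y x) S\<bar> \<le> K"
      using ip_bound[OF cc(4) c(1) cs(1) bounds(4)] KS(1)[of 1] by (simp add: norm)
    have "K * U \<le> 2 * (K\<^sup>2 * k)"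
      using mult_left_mono[OF U, of K] K by (simp add: power2_eq_square mult_ac)
    moreover have "K \<le> K\<^sup>2 * k" "K * k \<le> K\<^sup>2 * k"
      using K2(1) k1 K mult_mono[of K "K\<^sup>2" 1 k] by (auto intro: mult_right_mono)
    ultimately show ?thesis using main 1 2 3 by linarith
  qed
  \<comment> \<open>Inserting \<open>y1 = A * (k * C) + z1\<close> isolates the integral of
    \<open>P\<close> against the squared cosine with a factor of order \<open>k\<^sup>2\<close>,
    while the remaining terms are of order \<open>k\<close>.\<close>
  have split: "ip (\<lambda>x. P x * y1 x) (\<lambda>x. k * C x)
      = A * k\<^sup>2 * ip P (\<lambda>x. (C x)\<^sup>2) + k * ip (\<lambda>x. P x * z1 x) C"
  proof -
    have "y1 = (\<lambda>x. A * (k * C x) + z1 x)" by (auto simp: z1_def)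
    then have "ip (\<lambda>x. P x * y1 x) (\<lambda>x. k * C x)
      = ip (\<lambda>x. (A * k) * (P x * C x) + P x * z1 x) (\<lambda>x. k * C x)"
      by (intro ip_cong) (simp_all add: algebra_simps)
    also have "\<dots> = (A * k) * (k * ip (\<lambda>x. P x * C x) C) + k * ip (\<lambda>x. P x * z1 x) C"
      using cP cs cz by (simp add: ip_linear distrib_left)
    also have "ip (\<lambda>x. P x * C x) C = ip P (\<lambda>x. (C x)\<^sup>2)"
      by (simp add: ip_def power2_eq_square mult_ac)
    finally show ?thesis by (simp add: power2_eq_square)
  qed
  have Rb: "\<bar>k * ip (\<lambda>x. P x * z1 x) C\<bar> \<le> 32 * (K ^ 3 * k)"
  proof -
    have "\<bar>P x\<bar> \<le> 2 * K" if "x \<in> {0..1}" for x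
      using bounds(1,5)[OF that] by (simp add: P_def)
    then have "\<bar>ip (\<lambda>x. P x * z1 x) C\<bar> \<le> 2 * K * (nrm z1 * nrm C)"
      by (intro ip_bound cP cz cs)
    also have "nrm z1 * nrm C \<le> (16 * K\<^sup>2) * 1"
      using z1_bound nC by (intro mult_mono nrm_ge_0 cz cs) auto
    finally have "\<bar>ip (\<lambda>x. P x * z1 x) C\<bar> \<le> 32 * K ^ 3"
      using K by (simp add: power3_eq_cube power2_eq_square)
    then show ?thesis using k1 mult_left_mono[of _ "32 * K ^ 3" k] by (simp add: abs_mult mult_ac)
  qed
  have "K\<^sup>2 * k \<le> K ^ 3 * k"
    using K k1 by (intro mult_right_mono power_increasing) auto
  \<comment> \<open>The constant is \<open>38 = 6 + 32\<close>; removing the factor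
    \<open>\<bar>A\<bar> \<ge> 1 / 2\<close> doubles it to 76.\<close>
  with Ib Rb split have "\<bar>A * k\<^sup>2 * ip P (\<lambda>x. (C x)\<^sup>2)\<bar> \<le> 38 * (K ^ 3 * k)" by linarith
  moreover have "1 / 2 * (k\<^sup>2 * \<bar>ip P (\<lambda>x. (C x)\<^sup>2)\<bar>) \<le> \<bar>A\<bar> * (k\<^sup>2 * \<bar>ip P (\<lambda>x. (C x)\<^sup>2)\<bar>)"
    using A by (intro mult_right_mono) auto
  ultimately have "1 / 2 * (k\<^sup>2 * \<bar>ip P (\<lambda>x. (C x)\<^sup>2)\<bar>) \<le> 38 * (K ^ 3 * k)"
    unfolding abs_mult abs_power2 mult.assoc by linarith
  then have "k * (k * \<bar>ip P (\<lambda>x. (C x)\<^sup>2)\<bar>) \<le> k * (76 * K ^ 3)"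
    unfolding power2_eq_square[of k] by (simp only: mult.assoc mult.commute mult.left_commute)
  then have "k * \<bar>ip P (\<lambda>x. (C x)\<^sup>2)\<bar> \<le> 76 * K ^ 3"
    using k1 by (simp add: mult_le_cancel_left_pos)
  then show ?thesis
    using k1 by (simp add: P_def[abs_def] C_def field_simps)
qed

lemma cont_bound:
  assumes "cont f"
  obtains K where "K \<ge> 0" "\<And>x. x \<in> {0..1} \<Longrightarrow> \<bar>f x\<bar> \<le> K"
proof -
  obtain K where "\<forall>x\<in>{0..1}. \<bar>f x\<bar> \<le> K"
    using compact_imp_bounded[OF compact_continuous_image[OF assms compact_Icc]]
    by (auto simp: bounded_iff)
  then show thesis by (intro that[of "max K 0"]) (auto simp: le_max_iff_disj)
qed

text \<open>The weak form of \<open>D\<^sup>4 y + D (p D y + q y) + d D\<^sup>2 y + e D y + h y = k\<^sup>4 y\<close>, where \<open>D\<close> is the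
  derivative with respect to \<open>T\<close>.\<close>

definition weak_mode where
  "weak_mode p q d e h k y y1 y2 y3 \<longleftrightarrow> DD y y1 \<and> DD y1 y2 \<and> DD y2 y3 \<and> cont y3 \<and>
    y 0 = 0 \<and> y 1 = 0 \<and> y2 0 = 0 \<and> y2 1 = 0 \<and>
    (\<forall>s s1. DD s s1 \<longrightarrow> cont s1 \<longrightarrow> s 0 = 0 \<longrightarrow> s 1 = 0 \<longrightarrow>
      - ip (\<lambda>x. y3 x + p x * y1 x + q x * y x) s1
      + ip (\<lambda>x. d x * y2 x + e x * y1 x + h x * y x) s = k ^ 4 * ip y s)"

text \<open>The squared cosine is 1/2 plus an oscillating part, whose integral against the
  continuously differentiable \<open>p + d\<close> is \<open>O(1/k)\<close>. So the mean of
  \<open>p + d\<close> is at most \<open>M / k\<close> in modulus for arbitrarily large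
  \<open>k\<close>.\<close>

lemma mean_zero_of_sine_eigenvalues:
  assumes cc: "cont p" "cont q" "cont e" "cont h" "cont d1" and d: "DD d d1"
    and P: "DD (\<lambda>x. p x + d x) P1" and P1: "cont P1"
    and ex: "\<And>n. n \<ge> 1 \<Longrightarrow> \<exists>y y1 y2 y3.
      weak_mode p q d e h (pi * real n) y y1 y2 y3 \<and> (\<exists>x\<in>{0..1}. y x \<noteq> 0)"
  shows "ip (\<lambda>x. p x + d x) (\<lambda>_. 1) = 0"
proof -
  obtain K1 where K1: "K1 \<ge> 0" "\<And>x. x \<in> {0..1} \<Longrightarrow> \<bar>p x\<bar> \<le> K1"
    by (rule cont_bound[OF cc(1)]) blast
  obtain K2 where K2: "K2 \<ge> 0" "\<And>x. x \<in> {0..1} \<Longrightarrow> \<bar>q x\<bar> \<le> K2"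
    by (rule cont_bound[OF cc(2)]) blast
  obtain K3 where K3: "K3 \<ge> 0" "\<And>x. x \<in> {0..1} \<Longrightarrow> \<bar>e x\<bar> \<le> K3"
    by (rule cont_bound[OF cc(3)]) blast
  obtain K4 where K4: "K4 \<ge> 0" "\<And>x. x \<in> {0..1} \<Longrightarrow> \<bar>h x\<bar> \<le> K4"
    by (rule cont_bound[OF cc(4)]) blast
  obtain K5 where K5: "K5 \<ge> 0" "\<And>x. x \<in> {0..1} \<Longrightarrow> \<bar>d x\<bar> \<le> K5"
    by (rule cont_bound[OF DD_cont[OF d]]) blast
  obtain K6 where K6: "K6 \<ge> 0" "\<And>x. x \<in> {0..1} \<Longrightarrow> \<bar>d1 x\<bar> \<le> K6"
    by (rule cont_bound[OF cc(5)]) blast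
  \<comment> \<open>The summand 1 ensures \<open>K \<ge> 1\<close>, as the quantitative estimate
    demands.\<close>
  define K where "K = K1 + K2 + K3 + K4 + K5 + K6 + 1"
  have bounds: "\<bar>p x\<bar> \<le> K" "\<bar>q x\<bar> \<le> K" "\<bar>e x\<bar> \<le> K" "\<bar>h x\<bar> \<le> K" "\<bar>d x\<bar> \<le> K" "\<bar>d1 x\<bar> \<le> K"
    if "x \<in> {0..1}" for x
    using K1(2)[OF that] K2(2)[OF that] K3(2)[OF that] K4(2)[OF that] K5(2)[OF that]
      K6(2)[OF that] K1(1) K2(1) K3(1) K4(1) K5(1) K6(1) by (auto simp: K_def)
  have "K \<ge> 1" using K1(1) K2(1) K3(1) K4(1) K5(1) K6(1) by (simp add: K_def)
  define Q where "Q x = p x + d x" for x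
  have Q: "DD Q P1" "cont Q" using P DD_cont[OF P] by (auto simp: Q_def[abs_def])
  \<comment> \<open>Twice the constant 76 of the sine approximation, plus the contribution of the
    oscillating part.\<close>
  define M where "M = 152 * K ^ 3 + nrm P1 / 2"
  have bound: "\<bar>ip Q (\<lambda>_. 1)\<bar> \<le> M / k" if n: "n \<ge> 1" "k = pi * real n" "k \<ge> 32 * K\<^sup>2" for n k
  proof -
    have "k > 0" using n by simp
    obtain y y1 y2 y3 where mode: "weak_mode p q d e h k y y1 y2 y3"
      and nz: "\<exists>x\<in>{0..1}. y x \<noteq> 0"
      using ex[OF n(1)] unfolding n(2) by blast
    then have y: "DD y y1" "DD y1 y2" "DD y2 y3" "cont y3"
      and bc: "y 0 = 0" "y 1 = 0" "y2 0 = 0" "y2 1 = 0"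
      and weak: "\<And>s s1. DD s s1 \<Longrightarrow> cont s1 \<Longrightarrow> s 0 = 0 \<Longrightarrow> s 1 = 0 \<Longrightarrow>
        - ip (\<lambda>x. y3 x + p x * y1 x + q x * y x) s1
        + ip (\<lambda>x. d x * y2 x + e x * y1 x + h x * y x) s = k ^ 4 * ip y s"
      by (simp_all add: weak_mode_def)
    have "nrm y \<noteq> 0" using nz ip_self_eq_0[OF DD_cont[OF y(1)]] by (auto simp: nrm_def)
    \<comment> \<open>The equation is linear, so a nonzero solution may be normalized.\<close>
    define c where "c = 1 / nrm y"
    have "nrm (\<lambda>x. c * y x) = 1"
      unfolding nrm_scale using \<open>nrm y \<noteq> 0\<close> nrm_ge_0[OF DD_cont[OF y(1)]] by (simp add: c_def)
    moreover have "sin k = 0" using n by (simp add: sin_npi2)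
    moreover have "- ip (\<lambda>x. c * y3 x + p x * (c * y1 x) + q x * (c * y x)) s1
        + ip (\<lambda>x. d x * (c * y2 x) + e x * (c * y1 x) + h x * (c * y x)) s
        = k ^ 4 * ip (\<lambda>x. c * y x) s"
      if "DD s s1" "cont s1" "s 0 = 0" "s 1 = 0" for s s1
    proof -
      have "(\<lambda>x. c * y3 x + p x * (c * y1 x) + q x * (c * y x))
          = (\<lambda>x. c * (y3 x + p x * y1 x + q x * y x))"
        "(\<lambda>x. d x * (c * y2 x) + e x * (c * y1 x) + h x * (c * y x))
          = (\<lambda>x. c * (d x * y2 x + e x * y1 x + h x * y x))"
        by (auto simp: algebra_simps)
      then show ?thesis
        using arg_cong[OF weak[OF that], of "\<lambda>t. c * t"]
        by (simp only: ip_scale) (simp add: algebra_simps)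
    qed
    ultimately have "\<bar>ip Q (\<lambda>x. (cos (k * T x))\<^sup>2)\<bar> \<le> 76 * K ^ 3 / k"
      unfolding Q_def using y bc \<open>K \<ge> 1\<close> n(3)
      by (intro eigenfunction_close_to_sine[where y = "\<lambda>x. c * y x" and ?y1.0 = "\<lambda>x. c * y1 x"
          and ?y2.0 = "\<lambda>x. c * y2 x" and ?y3.0 = "\<lambda>x. c * y3 x" and ?d1.0 = d1,
          OF _ _ _ _ _ _ _ _ cc d])
        (auto intro: DD_cmult continuous_on_mult_left bounds)
    moreover have "ip Q (\<lambda>x. (cos (k * T x))\<^sup>2)
        = ip Q (\<lambda>_. 1) / 2 + ip Q (\<lambda>x. cos (2 * k * T x)) / 2"
    proof -
      have "ip Q (\<lambda>x. (cos (k * T x))\<^sup>2) = ip Q (\<lambda>x. (1 / 2) * (1 + cos (2 * k * T x)))"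
        by (intro ip_cong) (simp_all add: cos_double_cos mult.assoc)
      also have "\<dots> = (1 / 2) * (ip Q (\<lambda>_. 1) + ip Q (\<lambda>x. cos (2 * k * T x)))"
        unfolding ip_scale' using Q
        by (subst ip_add') (auto intro!: continuous_intros T_cont)
      finally show ?thesis by simp
    qed
    moreover have "\<bar>ip Q (\<lambda>x. cos (2 * k * T x))\<bar> \<le> nrm P1 / 2 / k"
    proof -
      have c2: "cont (\<lambda>x. 2 * k * cos (2 * k * T x))" "cont (\<lambda>x. sin (2 * k * T x))"
        by (intro continuous_intros T_cont)+
      \<comment> \<open>This removes the boundary term at \<open>T = 1\<close> when the oscillating
        factor is integrated.\<close>
      have "sin (2 * k) = 0" using n by (simp add: sin_double sin_npi2)
      then have "ip P1 (\<lambda>x. sin (2 * k * T x)) = - ip Q (\<lambda>x. 2 * k * cos (2 * k * T x))"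
        using ip_parts[OF Q(1) DD_sin[of "2 * k"] P1 c2(1)] by (simp add: T_0 T_1)
      also have "\<dots> = - 2 * k * ip Q (\<lambda>x. cos (2 * k * T x))" by (simp only: ip_scale')
      finally have "2 * k * \<bar>ip Q (\<lambda>x. cos (2 * k * T x))\<bar> = \<bar>ip P1 (\<lambda>x. sin (2 * k * T x))\<bar>"
        using \<open>k > 0\<close> by (simp add: abs_mult)
      also have "\<dots> \<le> nrm P1 * nrm (\<lambda>x. sin (2 * k * T x))"
        by (intro Cauchy_Schwarz P1 c2)
      also have "\<dots> \<le> nrm P1 * 1"
        by (intro mult_left_mono nrm_le_1 nrm_ge_0 P1 c2) auto
      finally show ?thesis using \<open>k > 0\<close> by (simp add: field_simps)
    qed
    ultimately have "\<bar>ip Q (\<lambda>_. 1)\<bar> \<le> 2 * (76 * K ^ 3 / k) + nrm P1 / 2 / k" by linarith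
    also have "\<dots> = M / k" by (simp add: M_def add_divide_distrib)
    finally show ?thesis .
  qed
  have "(\<lambda>n. M / (pi * real n)) \<longlonglongrightarrow> 0"
    by (intro tendsto_divide_0[OF tendsto_const] filterlim_at_top_imp_at_infinity
        filterlim_tendsto_pos_mult_at_top[OF tendsto_const pi_gt_zero] filterlim_real_sequentially)
  moreover have "\<forall>\<^sub>F n in sequentially. \<bar>ip Q (\<lambda>_. 1)\<bar> \<le> M / (pi * real n)"
  proof -
    have "\<forall>\<^sub>F n in sequentially. 32 * K\<^sup>2 \<le> pi * real n"
      using filterlim_tendsto_pos_mult_at_top[OF tendsto_const pi_gt_zero filterlim_real_sequentially]
      unfolding filterlim_at_top by blast
    then show ?thesis
      using eventually_ge_at_top[of 1] by eventually_elim (use bound in blast)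
  qed
  ultimately have "\<bar>ip Q (\<lambda>_. 1)\<bar> \<le> 0"
    by (intro tendsto_lowerbound[of _ _ sequentially]) auto
  then show ?thesis by (simp add: Q_def[abs_def])
qed

end

section \<open>Liouville transformation\<close>

text \<open>The conditions on \<xi> and \<rho> record their logarithmic derivatives in
  \<open>x\<close>. The last two assumptions amount to \<open>\<rho>\<^sup>2 = \<xi> / b\<close> and
  \<open>\<xi> ^ 4 = b / a\<close>.\<close>

locale EB_coefficients = time_change +
  fixes \<alpha> \<alpha>1 \<alpha>2 \<beta> \<beta>1 \<beta>2 a b \<rho> :: "real \<Rightarrow> real"
  assumes \<alpha>: "x \<in> {0..1} \<Longrightarrow> (\<alpha> has_real_derivative \<alpha>1 x) (at x within {0..1})"
    and \<alpha>1: "x \<in> {0..1} \<Longrightarrow> (\<alpha>1 has_real_derivative \<alpha>2 x) (at x within {0..1})"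
    and \<alpha>2: "continuous_on {0..1} \<alpha>2"
    and \<beta>: "x \<in> {0..1} \<Longrightarrow> (\<beta> has_real_derivative \<beta>1 x) (at x within {0..1})"
    and \<beta>1: "x \<in> {0..1} \<Longrightarrow> (\<beta>1 has_real_derivative \<beta>2 x) (at x within {0..1})"
    and \<beta>2: "continuous_on {0..1} \<beta>2"
    and \<xi>: "x \<in> {0..1} \<Longrightarrow> (\<xi> has_real_derivative (\<beta> x - \<alpha> x) * \<xi> x) (at x within {0..1})"
    and \<rho>: "x \<in> {0..1} \<Longrightarrow> (\<rho> has_real_derivative - ((3 * \<beta> x + \<alpha> x) / 2) * \<rho> x) (at x within {0..1})"
    and \<rho>_nz: "x \<in> {0..1} \<Longrightarrow> \<rho> x \<noteq> 0"
    and a\<rho>: "x \<in> {0..1} \<Longrightarrow> a x * (\<rho> x)\<^sup>2 * \<xi> x ^ 3 = 1"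
    and b\<rho>: "x \<in> {0..1} \<Longrightarrow> b x * (\<rho> x)\<^sup>2 = \<xi> x"
begin

text \<open>\<open>E\<close> and \<open>R\<close> are the logarithmic derivatives of \<xi> and
  \<rho> with respect to \<open>T\<close>. Suffixes 1 and 2 mark first and second
  \<open>T\<close>-derivatives, in the form in which the product rule delivers them.\<close>

definition "w x = inverse (\<xi> x)"
definition "A x = \<alpha> x * w x"
definition "B x = \<beta> x * w x"
definition "E x = B x - A x"
definition "A1 x = \<alpha>1 x * w x * w x + \<alpha> x * (- E x * w x)"
definition "B1 x = \<beta>1 x * w x * w x + \<beta> x * (- E x * w x)"
definition "E1 x = B1 x - A1 x"
definition "A2 x = (\<alpha>2 x * w x * w x + \<alpha>1 x * (- E x * w x)) * w x + \<alpha>1 x * w x * (- E x * w x)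
  + (\<alpha>1 x * w x * (- E x * w x) + \<alpha> x * (- E1 x * w x + - E x * (- E x * w x)))"
definition "B2 x = (\<beta>2 x * w x * w x + \<beta>1 x * (- E x * w x)) * w x + \<beta>1 x * w x * (- E x * w x)
  + (\<beta>1 x * w x * (- E x * w x) + \<beta> x * (- E1 x * w x + - E x * (- E x * w x)))"
definition "R x = (- 1 / 2) * (3 * B x + A x)"
definition "R1 x = (- 1 / 2) * (3 * B1 x + A1 x)"
definition "R2 x = (- 1 / 2) * (3 * B2 x + A2 x)"
text \<open>For \<open>u = \<rho> y\<close> the second \<open>x\<close>-derivative is
  \<open>\<xi>\<^sup>2 \<rho> (D\<^sup>2 y + c D y + d y)\<close>, which dictates
  \<open>c = 2 R + E\<close> and the formula for \<open>d\<close>.\<close>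

definition "c x = (- 2) * (A x + B x)"
definition "c1 x = (- 2) * (A1 x + B1 x)"
definition "c2 x = (- 2) * (A2 x + B2 x)"
definition "d x = R1 x + R x * R x + R x * E x"
definition "d1 x = R2 x + (R1 x * R x + R x * R1 x) + (R1 x * E x + R x * E1 x)"
text \<open>With \<open>Z = D\<^sup>2 y + c D y + d y\<close>, the coefficients \<open>p\<close> and
  \<open>q\<close> come from expanding \<open>D Z - c Z\<close>, and \<open>e\<close> and
  \<open>h\<close> from \<open>d Z\<close>.\<close>

definition "p x = c1 x + d x - c x * c x"
definition "q x = d1 x - c x * d x"
definition "e x = d x * c x"
definition "h x = d x * d x"

section \<open>Derivatives and continuity of the transformed coefficients\<close>

lemma \<xi>_nz: "x \<in> {0..1} \<Longrightarrow> \<xi> x \<noteq> 0"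
  using \<xi>_pos[of x] by simp

lemma DD_I:
  assumes "\<And>x. x \<in> {0..1} \<Longrightarrow> (f has_real_derivative f' x) (at x within {0..1})"
  shows "DD f (\<lambda>x. f' x * w x)"
  unfolding DD_def
  by (intro ballI DERIV_cong[OF assms]) (auto simp: w_def \<xi>_nz)

lemma DD_cong: "DD f f' \<Longrightarrow> (\<And>x. x \<in> {0..1} \<Longrightarrow> f' x = g' x) \<Longrightarrow> DD f g'"
  by (simp add: DD_def)

lemma DD_uminus: "DD f f' \<Longrightarrow> DD (\<lambda>x. - f x) (\<lambda>x. - f' x)"
  using DD_cmult[of f f' "- 1"] by simp

lemma DD_inverse:
  assumes "DD f f'" "\<And>x. x \<in> {0..1} \<Longrightarrow> f x \<noteq> 0"
  shows "DD (\<lambda>x. inverse (f x)) (\<lambda>x. - f' x * (inverse (f x) * inverse (f x)))"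
  unfolding DD_def
  by (intro ballI DERIV_cong[OF DERIV_inverse'[OF DD_D[OF assms(1)] assms(2)]])
    (auto simp: algebra_simps)

lemma D\<xi>: "DD \<xi> (\<lambda>x. E x * \<xi> x)"
  by (rule DD_cong[OF DD_I[OF \<xi>]]) (simp_all add: E_def A_def B_def algebra_simps)

lemma Dw: "DD w (\<lambda>x. - E x * w x)"
  unfolding w_def[abs_def]
  by (rule DD_cong[OF DD_inverse[OF D\<xi> \<xi>_nz]]) (simp_all add: \<xi>_nz)

lemma D\<rho>: "DD \<rho> (\<lambda>x. R x * \<rho> x)"
  by (rule DD_cong[OF DD_I[OF \<rho>]]) (simp_all add: R_def A_def B_def field_simps)

lemma DA: "DD A A1"
  unfolding A_def[abs_def] A1_def[abs_def] by (rule DD_mult[OF DD_I[OF \<alpha>] Dw])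

lemma DB: "DD B B1"
  unfolding B_def[abs_def] B1_def[abs_def] by (rule DD_mult[OF DD_I[OF \<beta>] Dw])

lemma DE: "DD E E1"
  unfolding E_def[abs_def] E1_def[abs_def] by (rule DD_diff[OF DB DA])

lemma DA1: "DD A1 A2"
  unfolding A1_def[abs_def] A2_def[abs_def]
  by (rule DD_add[OF DD_mult[OF DD_mult[OF DD_I[OF \<alpha>1] Dw] Dw]
      DD_mult[OF DD_I[OF \<alpha>] DD_mult[OF DD_uminus[OF DE] Dw]]])

lemma DB1: "DD B1 B2"
  unfolding B1_def[abs_def] B2_def[abs_def]
  by (rule DD_add[OF DD_mult[OF DD_mult[OF DD_I[OF \<beta>1] Dw] Dw]
      DD_mult[OF DD_I[OF \<beta>] DD_mult[OF DD_uminus[OF DE] Dw]]])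

lemma DR: "DD R R1"
  unfolding R_def[abs_def] R1_def[abs_def] by (rule DD_cmult[OF DD_add[OF DD_cmult[OF DB] DA]])

lemma DR1: "DD R1 R2"
  unfolding R1_def[abs_def] R2_def[abs_def]
  by (rule DD_cmult[OF DD_add[OF DD_cmult[OF DB1] DA1]])

lemma Dc: "DD c c1"
  unfolding c_def[abs_def] c1_def[abs_def] by (rule DD_cmult[OF DD_add[OF DA DB]])

lemma Dc1: "DD c1 c2"
  unfolding c1_def[abs_def] c2_def[abs_def] by (rule DD_cmult[OF DD_add[OF DA1 DB1]])

lemma Dd: "DD d d1"
  unfolding d_def[abs_def] d1_def[abs_def] by (intro DD_add DD_mult DR DR1 DE)

lemma DE1_cont: "cont E1"
  unfolding E1_def[abs_def] by (intro continuous_intros DD_cont[OF DA1] DD_cont[OF DB1])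

lemmas conts = DD_cont[OF Dw] DD_cont[OF DA] DD_cont[OF DB] DD_cont[OF DE] DD_cont[OF DA1]
  DD_cont[OF DB1] DE1_cont DD_cont[OF DR] DD_cont[OF DR1] DD_cont[OF Dc] DD_cont[OF Dc1]
  DD_cont[OF Dd] \<alpha>2 \<beta>2 DD_cont[OF DD_I[OF \<alpha>]] DD_cont[OF DD_I[OF \<alpha>1]]
  DD_cont[OF DD_I[OF \<beta>]] DD_cont[OF DD_I[OF \<beta>1]]

lemma A2_cont: "cont A2"
  unfolding A2_def[abs_def]
  by (intro conts continuous_on_add continuous_on_mult continuous_on_minus)

lemma B2_cont: "cont B2"
  unfolding B2_def[abs_def]
  by (intro conts continuous_on_add continuous_on_mult continuous_on_minus)

lemma R2_cont: "cont R2"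
  unfolding R2_def[abs_def]
  by (intro A2_cont B2_cont continuous_on_add continuous_on_mult continuous_on_const)

lemma c2_cont: "cont c2"
  unfolding c2_def[abs_def]
  by (intro A2_cont B2_cont continuous_on_add continuous_on_mult continuous_on_const)

lemma d1_cont: "cont d1"
  unfolding d1_def[abs_def] by (intro continuous_intros R2_cont conts)

lemma pqeh_cont: "cont p" "cont q" "cont e" "cont h"
  unfolding p_def[abs_def] q_def[abs_def] e_def[abs_def] h_def[abs_def]
  by (intro conts continuous_intros d1_cont)+

lemma DP: "DD (\<lambda>x. p x + d x) (\<lambda>x. c2 x + d1 x - (c1 x * c x + c x * c1 x) + d1 x)"
  unfolding p_def by (intro DD_add DD_diff DD_mult Dc Dc1 Dd)

lemma P1_cont: "cont (\<lambda>x. c2 x + d1 x - (c1 x * c x + c x * c1 x) + d1 x)"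
  by (intro conts continuous_intros c2_cont d1_cont)

text \<open>\<open>u = \<rho> y\<close>.  With \<open>Z = y'' + c y' + d y\<close>, where primes denote derivatives with respect to \<open>T\<close>,
  the moment is \<open>a u\<^sub>x\<^sub>x = Z / (\<rho> \<xi>)\<close> and the equation becomes \<open>(Z' - c Z)' + d Z = k\<^sup>4 y\<close>.\<close>

lemma eigenfunction_weak_mode:
  assumes u: "\<And>x. x \<in> {0..1} \<Longrightarrow> (u has_real_derivative u1 x) (at x within {0..1})"
    and u1: "\<And>x. x \<in> {0..1} \<Longrightarrow> (u1 has_real_derivative u2 x) (at x within {0..1})"
    and M: "\<And>x. x \<in> {0..1} \<Longrightarrow> ((\<lambda>x. a x * u2 x) has_real_derivative M1 x) (at x within {0..1})"
    and M1: "\<And>x. x \<in> {0..1} \<Longrightarrow> (M1 has_real_derivative k ^ 4 * b x * u x) (at x within {0..1})"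
    and bc: "\<And>x. x \<in> {0, 1} \<Longrightarrow> u x = 0 \<and> u2 x + 2 * (\<alpha> x + \<beta> x) * u1 x = 0"
    and nz: "\<exists>x\<in>{0..1}. u x \<noteq> 0"
  shows "\<exists>y y1 y2 y3. weak_mode p q d e h k y y1 y2 y3 \<and> (\<exists>x\<in>{0..1}. y x \<noteq> 0)"
proof -
  define r where "r x = inverse (\<rho> x)" for x
  have Dr: "DD r (\<lambda>x. - R x * r x)"
    unfolding r_def by (rule DD_cong[OF DD_inverse[OF D\<rho> \<rho>_nz]]) (simp_all add: \<rho>_nz)
  define y where "y x = u x * r x" for x
  define y1 where "y1 x = (u1 x * w x - R x * u x) * r x" for x
  define Z where "Z x = \<rho> x * \<xi> x * (a x * u2 x)" for x
  define Z1 where "Z1 x = (R x + E x) * Z x + \<rho> x * M1 x" for x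
  define y2 where "y2 x = Z x - c x * y1 x - d x * y x" for x
  define y3 where "y3 x = Z1 x - (c1 x * y1 x + c x * y2 x) - (d1 x * y x + d x * y1 x)" for x
  \<comment> \<open>Since \<open>c = 2 R + E\<close>, this is \<open>Z1 - c * Z\<close>. In this
    form it can be differentiated once more, whereas \<open>y3\<close> is only known to be
    continuous.\<close>
  define G where "G x = \<rho> x * M1 x - R x * Z x" for x
  have cRE: "c x = 2 * R x + E x" for x by (simp add: c_def R_def E_def field_simps)
  have Z_eq: "Z x = u2 x * w x * w x * r x" if "x \<in> {0..1}" for x
  proof -
    have "Z x = (a x * (\<rho> x)\<^sup>2 * \<xi> x ^ 3) * (u2 x * w x * w x * r x)"
      using \<xi>_nz[OF that] \<rho>_nz[OF that]
      by (simp add: Z_def w_def r_def power2_eq_square power3_eq_cube field_simps)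
    then show ?thesis using a\<rho>[OF that] by simp
  qed
  have Dy: "DD y y1"
    unfolding y_def[abs_def] y1_def[abs_def]
    by (rule DD_cong[OF DD_mult[OF DD_I[OF u] Dr]]) (simp_all add: algebra_simps)
  have Dy1: "DD y1 y2"
    unfolding y1_def[abs_def]
    by (rule DD_cong[OF DD_mult[OF DD_diff[OF DD_mult[OF DD_I[OF u1] Dw] DD_mult[OF DR DD_I[OF u]]] Dr]])
      (simp_all add: y2_def Z_eq cRE d_def y_def y1_def algebra_simps)
  have DZ: "DD Z Z1"
    unfolding Z_def[abs_def]
    by (rule DD_cong[OF DD_mult[OF DD_mult[OF D\<rho> D\<xi>] DD_I[OF M]]])
      (simp_all add: Z1_def Z_def w_def \<xi>_nz field_simps)
  have Dy2: "DD y2 y3"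
    unfolding y2_def[abs_def] y3_def[abs_def]
    by (intro DD_diff DD_mult DZ Dc Dd Dy Dy1[unfolded y2_def[abs_def]])
  have DG: "DD G (\<lambda>x. k ^ 4 * y x - d x * Z x)"
    unfolding G_def[abs_def]
  proof (rule DD_cong[OF DD_diff[OF DD_mult[OF D\<rho> DD_I[OF M1]] DD_mult[OF DR DZ]]])
    fix x :: real assume x: "x \<in> {0..1}"
    have "\<rho> x * b x * w x = r x"
      using b\<rho>[OF x] \<xi>_nz[OF x] \<rho>_nz[OF x]
      by (simp add: w_def r_def power2_eq_square field_simps)
    moreover have "\<rho> x * (k ^ 4 * b x * u x * w x) = k ^ 4 * (u x * (\<rho> x * b x * w x))"
      by (simp only: mult_ac)
    ultimately have "\<rho> x * (k ^ 4 * b x * u x * w x) = k ^ 4 * y x"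
      by (simp only: y_def)
    then show "R x * \<rho> x * M1 x + \<rho> x * (k ^ 4 * b x * u x * w x) - (R1 x * Z x + R x * Z1 x)
        = k ^ 4 * y x - d x * Z x"
      by (simp add: Z1_def d_def algebra_simps)
  qed
  have G_eq: "G x = y3 x + p x * y1 x + q x * y x" for x
    by (simp add: G_def y3_def y2_def p_def q_def Z1_def cRE algebra_simps)
  have dZ_eq: "d x * Z x = d x * y2 x + e x * y1 x + h x * y x" for x
    by (simp add: y2_def e_def h_def algebra_simps)
  have y3: "cont y3"
  proof -
    have M1c: "cont M1" using M1 by (rule DERIV_continuous_on)
    have "cont Z1" unfolding Z1_def
      by (intro conts continuous_intros M1c DD_cont[OF DZ] DD_cont[OF D\<rho>])
    then show ?thesis unfolding y3_def
      by (intro conts continuous_intros d1_cont DD_cont[OF Dy] DD_cont[OF Dy1] DD_cont[OF Dy2])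
  qed
  \<comment> \<open>At an end point \<open>u = 0\<close>, and the second boundary condition says
    \<open>Z = c * y1\<close>; hence \<open>y2 = Z - c * y1 - d * y\<close> vanishes.\<close>
  have bcy: "y x = 0" "y2 x = 0" if "x \<in> {0, 1}" for x
  proof -
    show "y x = 0" using bc[OF that] by (simp add: y_def)
    have x: "x \<in> {0..1}" using that by auto
    have u2: "u2 x = - (2 * (\<alpha> x + \<beta> x) * u1 x)" and u: "u x = 0"
      using bc[OF that] by (simp_all only: eq_neg_iff_add_eq_0)
    show "y2 x = 0"
      unfolding y2_def Z_eq[OF x] y_def y1_def c_def A_def B_def u2 u
      by (simp add: algebra_simps)
  qed
  have "- ip (\<lambda>x. y3 x + p x * y1 x + q x * y x) s1
      + ip (\<lambda>x. d x * y2 x + e x * y1 x + h x * y x) s = k ^ 4 * ip y s"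
    if s: "DD s s1" "cont s1" "s 0 = 0" "s 1 = 0" for s s1
  proof -
    have cZ: "cont (\<lambda>x. d x * Z x)" by (intro conts continuous_intros DD_cont[OF DZ])
    \<comment> \<open>The equation for \<open>D G\<close> is integrated by parts against
      \<open>s\<close>, which vanishes at both ends.\<close>
    have "ip (\<lambda>x. k ^ 4 * y x - d x * Z x) s = - ip G s1"
      using ip_parts[OF DG s(1)] cZ DD_cont[OF Dy] s
      by (simp add: continuous_on_diff continuous_on_mult)
    moreover have "ip (\<lambda>x. k ^ 4 * y x - d x * Z x) s = k ^ 4 * ip y s - ip (\<lambda>x. d x * Z x) s"
      using cZ DD_cont[OF Dy] DD_cont[OF s(1)] by (simp add: ip_linear)
    ultimately show ?thesis unfolding G_eq[abs_def] dZ_eq by simp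
  qed
  then have "weak_mode p q d e h k y y1 y2 y3"
    unfolding weak_mode_def using Dy Dy1 Dy2 y3 bcy by simp
  moreover have "\<exists>x\<in>{0..1}. y x \<noteq> 0"
    using nz \<rho>_nz by (auto simp: y_def r_def)
  ultimately show ?thesis by blast
qed

text \<open>\<open>p + d\<close> is a derivative \<open>N1\<close> minus a sum of squares. The
  derivative integrates to 0 by the condition on \<kappa>, so the zero mean of \<open>p + d\<close>
  forces both squares to vanish.\<close>

lemma coefficients_vanish:
  assumes modes: "\<And>n. n \<ge> 1 \<Longrightarrow> \<exists>y y1 y2 y3.
      weak_mode p q d e h (pi * real n) y y1 y2 y3 \<and> (\<exists>x\<in>{0..1}. y x \<noteq> 0)"
    and \<kappa>: "(3 * \<alpha> 0 + 5 * \<beta> 0) / \<xi> 0 = (3 * \<alpha> 1 + 5 * \<beta> 1) / \<xi> 1"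
    and x: "x \<in> {0..1}"
  shows "\<alpha> x = 0" "\<beta> x = 0"
proof -
  define S where "S x = A x + B x" for x
  \<comment> \<open>\<open>N\<close> is \<open>- 2 \<kappa>\<close>, so it has equal values at 0 and
    1.\<close>
  define N where "N x = c x + 2 * R x" for x
  define N1 where "N1 x = c1 x + 2 * R1 x" for x
  have S: "cont S" and SS: "cont (\<lambda>x. S x * S x)" "cont (\<lambda>x. E x * E x)"
    unfolding S_def[abs_def] by (intro conts continuous_intros)+
  have N: "DD N N1" unfolding N_def[abs_def] N1_def[abs_def] by (intro DD_add DD_cmult Dc DR)
  have N1: "cont N1" unfolding N1_def[abs_def]
    by (rule continuous_on_add[OF DD_cont[OF Dc1] continuous_on_mult_left[OF DD_cont[OF DR1]]])
  have "N x = - ((3 * \<alpha> x + 5 * \<beta> x) / \<xi> x)" for x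
  proof -
    have "(3 * \<alpha> x + 5 * \<beta> x) / \<xi> x = (3 * \<alpha> x + 5 * \<beta> x) * w x"
      by (simp only: w_def divide_inverse)
    then show ?thesis by (simp add: N_def c_def R_def A_def B_def algebra_simps)
  qed
  then have "N 1 = N 0" using \<kappa> by simp
  moreover have D1: "DD (\<lambda>_. 1) (\<lambda>_. 0)" by (simp add: DD_def)
  moreover have "ip N (\<lambda>_. 0) = 0" by (simp add: ip_def)
  ultimately have "ip N1 (\<lambda>_. 1) = 0"
    using ip_parts[OF N D1 N1 continuous_on_const] by simp
  \<comment> \<open>From \<open>R = - S - E / 2\<close> and \<open>c = - 2 S\<close> one gets
    \<open>2 R (R + E) - c\<^sup>2 = - 2 S\<^sup>2 - E\<^sup>2 / 2\<close>.\<close>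
  moreover have "ip (\<lambda>x. p x + d x) (\<lambda>_. 1)
      = ip (\<lambda>x. N1 x - (2 * (S x * S x) + (1 / 2) * (E x * E x))) (\<lambda>_. 1)"
    by (intro ip_cong) (simp_all add: p_def d_def N1_def c_def R_def S_def E_def field_simps)
  moreover have "\<dots> = ip N1 (\<lambda>_. 1) - (2 * ip S S + (1 / 2) * ip E E)"
  proof -
    have "ip (\<lambda>x. 2 * (S x * S x) + (1 / 2) * (E x * E x)) (\<lambda>_. 1)
      = ip (\<lambda>x. 2 * (S x * S x)) (\<lambda>_. 1) + ip (\<lambda>x. (1 / 2) * (E x * E x)) (\<lambda>_. 1)"
      by (intro ip_add continuous_intros SS)
    also have "\<dots> = 2 * ip S S + (1 / 2) * ip E E" by (simp only: ip_scale ip_square_one)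
    finally show ?thesis
      by (subst ip_diff) (auto intro!: continuous_intros N1 SS)
  qed
  ultimately have "2 * ip S S + (1 / 2) * ip E E = 0"
    using mean_zero_of_sine_eigenvalues[OF pqeh_cont d1_cont Dd DP P1_cont modes] by simp
  then have "ip S S = 0" "ip E E = 0"
    using ip_nonneg[OF S] ip_nonneg[of E] conts(4) by auto
  then have "S x = 0" "E x = 0" using ip_self_eq_0 S conts(4) x by auto
  then have "A x = 0" "B x = 0" by (auto simp: S_def E_def)
  then show "\<alpha> x = 0" "\<beta> x = 0" using \<xi>_nz[OF x] by (auto simp: A_def B_def w_def)
qed

end

section \<open>Eigenfunctions of the operator\<close>

lemma exp_integral_has_derivative:
  fixes f :: "real \<Rightarrow> real"
  assumes "continuous_on {0..1} f" "x \<in> {0..1}"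
  shows "((\<lambda>x. C * exp (c * integral {0..x} f)) has_real_derivative
    (c * f x) * (C * exp (c * integral {0..x} f))) (at x within {0..1})"
  by (rule DERIV_cong[OF DERIV_cmult[OF DERIV_chain2[OF DERIV_exp
        DERIV_cmult[OF integral_has_real_derivative[OF assms]]]]]) simp

lemma coeff_a_cont: "continuous_on {0..1} \<alpha> \<Longrightarrow> continuous_on {0..1} (coeff_a \<alpha>)"
  using DERIV_continuous_on[OF exp_integral_has_derivative[of \<alpha> _ 1 4]]
  by (simp add: coeff_a_def[abs_def])

lemma coeff_b_cont: "continuous_on {0..1} \<beta> \<Longrightarrow> continuous_on {0..1} (coeff_b b0 \<beta>)"
  using DERIV_continuous_on[OF exp_integral_has_derivative[of \<beta> _ b0 4]]
  by (simp add: coeff_b_def[abs_def])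

text \<open>A complex eigenfunction is studied through a real component \<open>L u\<close>. The weak
  equation for \<open>a u''\<close> has a continuous right-hand side, so \<open>a u''\<close> is
  twice differentiable in the classical sense.\<close>

lemma EB_graph_classical:
  fixes L :: "complex \<Rightarrow> real"
  assumes \<alpha>: "continuous_on {0..1} \<alpha>" and \<beta>: "continuous_on {0..1} \<beta>" and b0: "b0 > 0"
    and L: "bounded_linear L"
    and graph: "EB_graph \<alpha> b0 \<beta> (\<lambda>_. 0) u (\<lambda>x. complex_of_real \<mu> * u x)"
  obtains u1 u2 M1 where
    "\<And>x. x \<in> {0..1} \<Longrightarrow> ((\<lambda>x. L (u x)) has_real_derivative u1 x) (at x within {0..1})"
    "\<And>x. x \<in> {0..1} \<Longrightarrow> (u1 has_real_derivative u2 x) (at x within {0..1})"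
    "\<And>x. x \<in> {0..1} \<Longrightarrow> ((\<lambda>x. coeff_a \<alpha> x * u2 x) has_real_derivative M1 x) (at x within {0..1})"
    "\<And>x. x \<in> {0..1} \<Longrightarrow>
      (M1 has_real_derivative \<mu> * coeff_b b0 \<beta> x * L (u x)) (at x within {0..1})"
    "\<And>x. x \<in> {0, 1} \<Longrightarrow> L (u x) = 0 \<and> u2 x + 2 * (\<alpha> x + \<beta> x) * u1 x = 0"
proof -
  interpret L: bounded_linear L by fact
  obtain w where C2: "C2_01 u"
    and w: "weak_deriv 2 (\<lambda>x. coeff_a \<alpha> x *\<^sub>R D01 (D01 u) x) w"
    and ae: "AE x in lebesgue_on {0<..<1}. complex_of_real \<mu> * u x = (1 / coeff_b b0 \<beta> x) *\<^sub>R w x + 0 *\<^sub>R u x"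
    and bc: "\<And>x. x \<in> {0, 1} \<Longrightarrow> u x = 0 \<and> D01 (D01 u) x + (2 * (\<alpha> x + \<beta> x)) *\<^sub>R D01 u x = 0"
    using graph by (auto simp: EB_graph_def)
  have b_pos: "coeff_b b0 \<beta> x \<noteq> 0" for x using b0 by (simp add: coeff_b_def)
  \<comment> \<open>The equation is solved for \<open>w\<close>, which thereby acquires the
    continuous representative \<open>\<mu> b u\<close>.\<close>
  have "AE x in lebesgue_on {0<..<1}. w x = (\<mu> * coeff_b b0 \<beta> x) *\<^sub>R u x"
    using ae
  proof eventually_elim
    case (elim x)
    then have "coeff_b b0 \<beta> x *\<^sub>R (complex_of_real \<mu> * u x) = w x"
      using b_pos[of x] by simp
    then show ?case by (simp add: scaleR_conv_of_real mult_ac)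
  qed
  with w have w': "weak_deriv 2 (\<lambda>x. coeff_a \<alpha> x *\<^sub>R D01 (D01 u) x) (\<lambda>x. (\<mu> * coeff_b b0 \<beta> x) *\<^sub>R u x)"
    by (rule weak_deriv_cong_AE)
  have du: "(u has_vector_derivative D01 u x) (at x within {0..1})" if "x \<in> {0..1}" for x
    using C2 that unfolding C2_01_def D01_def by (simp add: vector_derivative_works)
  have ddu: "(D01 u has_vector_derivative D01 (D01 u) x) (at x within {0..1})" if "x \<in> {0..1}" for x
    using C2 that unfolding C2_01_def D01_def[of "D01 u"] by (simp add: vector_derivative_works)
  have u_cont: "continuous_on {0..1} u"
    using du by (intro continuous_on_vector_derivative)
  have d2_cont: "continuous_on {0..1} (D01 (D01 u))" using C2 by (simp add: C2_01_def)
  define u1 where "u1 x = L (D01 u x)" for x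
  define u2 where "u2 x = L (D01 (D01 u) x)" for x
  have 1: "((\<lambda>x. L (u x)) has_real_derivative u1 x) (at x within {0..1})" if "x \<in> {0..1}" for x
    using L.has_vector_derivative[OF du[OF that]]
    by (simp add: u1_def has_real_derivative_iff_has_vector_derivative)
  have 2: "(u1 has_real_derivative u2 x) (at x within {0..1})" if "x \<in> {0..1}" for x
    using L.has_vector_derivative[OF ddu[OF that]]
    by (simp add: u1_def[abs_def] u2_def has_real_derivative_iff_has_vector_derivative)
  have w2: "weak_deriv 2 (\<lambda>x. coeff_a \<alpha> x * u2 x) (\<lambda>x. \<mu> * coeff_b b0 \<beta> x * L (u x))"
    using weak_deriv_linear[OF L _ _ w'] coeff_a_cont[OF \<alpha>] coeff_b_cont[OF \<beta>] u_cont d2_cont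
    by (simp add: L.scaleR u2_def continuous_on_scaleR continuous_on_mult)
  have c: "continuous_on {0..1} (\<lambda>x. coeff_a \<alpha> x * u2 x)"
    "continuous_on {0..1} (\<lambda>x. \<mu> * coeff_b b0 \<beta> x * L (u x))"
    unfolding u2_def
    by (intro coeff_a_cont \<alpha> coeff_b_cont \<beta> u_cont d2_cont continuous_on_mult
        continuous_on_const L.continuous_on)+
  have "\<exists>M1. (\<forall>x\<in>{0..1}. ((\<lambda>x. coeff_a \<alpha> x * u2 x) has_real_derivative M1 x) (at x within {0..1})) \<and>
      (\<forall>x\<in>{0..1}. (M1 has_real_derivative \<mu> * coeff_b b0 \<beta> x * L (u x)) (at x within {0..1}))"
    by (rule weak_deriv_2_classical[OF c w2]) blast
  then obtain M1
    where 3: "\<And>x. x \<in> {0..1} \<Longrightarrow> ((\<lambda>x. coeff_a \<alpha> x * u2 x) has_real_derivative M1 x) (at x within {0..1})"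
      and 4: "\<And>x. x \<in> {0..1} \<Longrightarrow>
        (M1 has_real_derivative \<mu> * coeff_b b0 \<beta> x * L (u x)) (at x within {0..1})"
    by blast
  have 5: "L (u x) = 0 \<and> u2 x + 2 * (\<alpha> x + \<beta> x) * u1 x = 0" if "x \<in> {0, 1}" for x
  proof -
    have "u2 x + 2 * (\<alpha> x + \<beta> x) * u1 x
        = L (D01 (D01 u) x + (2 * (\<alpha> x + \<beta> x)) *\<^sub>R D01 u x)"
      by (simp only: u1_def u2_def L.add L.scaleR real_scaleR_def)
    then show ?thesis using bc[OF that] by (simp only: L.zero simp_thms)
  qed
  show thesis using 1 2 3 4 5 by (rule that)
qed

text \<open>\<open>T\<close> is the integral of \<xi> from 0, and \<rho> is the positive square root
  of \<open>\<xi> / b\<close>, written out as a product of exponentials.\<close>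

lemma EB_coefficients_of_functions:
  fixes \<alpha> \<beta> :: "real \<Rightarrow> real"
  assumes "b0 > 0" and \<xi>_int: "integral {0..1} (xi \<alpha> b0 \<beta>) = 1"
    and \<alpha>: "\<And>x. x \<in> {0..1} \<Longrightarrow> (\<alpha> has_real_derivative \<alpha>1 x) (at x within {0..1})"
      "\<And>x. x \<in> {0..1} \<Longrightarrow> (\<alpha>1 has_real_derivative \<alpha>2 x) (at x within {0..1})"
      "continuous_on {0..1} \<alpha>2"
    and \<beta>: "\<And>x. x \<in> {0..1} \<Longrightarrow> (\<beta> has_real_derivative \<beta>1 x) (at x within {0..1})"
      "\<And>x. x \<in> {0..1} \<Longrightarrow> (\<beta>1 has_real_derivative \<beta>2 x) (at x within {0..1})"
      "continuous_on {0..1} \<beta>2"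
  shows "\<exists>T \<rho>. EB_coefficients (xi \<alpha> b0 \<beta>) T \<alpha> \<alpha>1 \<alpha>2 \<beta> \<beta>1 \<beta>2 (coeff_a \<alpha>) (coeff_b b0 \<beta>) \<rho>"
proof -
  have \<alpha>c: "continuous_on {0..1} \<alpha>" and \<beta>c: "continuous_on {0..1} \<beta>"
    using DERIV_continuous_on[OF \<alpha>(1)] DERIV_continuous_on[OF \<beta>(1)] by blast+
  define I where "I f x = integral {0..x} f" for f :: "real \<Rightarrow> real" and x
  \<comment> \<open>With an eighth root of \<open>b0\<close>, only integral powers of
    \<open>s\<close> occur in \<xi> and \<rho>.\<close>
  define s where "s = b0 powr (1 / 8)"
  have s: "s > 0" "s ^ 8 = b0"
    using \<open>b0 > 0\<close> by (simp_all add: s_def powr_power)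
  have \<xi>_eq: "xi \<alpha> b0 \<beta> x = s\<^sup>2 * (exp (1 * I \<beta> x) * exp (- 1 * I \<alpha> x))" for x
  proof -
    have "coeff_b b0 \<beta> x / coeff_a \<alpha> x = (s\<^sup>2 * exp (I \<beta> x - I \<alpha> x)) ^ 4"
      by (simp add: coeff_a_def coeff_b_def I_def power_mult_distrib s(2) exp_diff
          exp_of_nat_mult[symmetric] power_divide flip: power_mult)
    moreover have "(z ^ 4) powr (1 / 4) = z" if "z > 0" for z :: real
      using that powr_realpow[of z 4] powr_powr[of z 4 "1 / 4"] by simp
    moreover have "s\<^sup>2 * exp (I \<beta> x - I \<alpha> x) > 0" using s(1) by simp
    ultimately have "xi \<alpha> b0 \<beta> x = s\<^sup>2 * exp (I \<beta> x - I \<alpha> x)"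
      unfolding xi_def by (simp only:)
    moreover have "exp (I \<beta> x - I \<alpha> x) = exp (1 * I \<beta> x) * exp (- 1 * I \<alpha> x)"
      by (simp flip: exp_add)
    ultimately show ?thesis by (simp only:)
  qed
  define r where "r = 1 / s ^ 3"
  define \<rho> where "\<rho> x = r * (exp ((- 3 / 2) * I \<beta> x) * exp ((- 1 / 2) * I \<alpha> x))" for x
  have dI: "((\<lambda>x. exp (c * I f x)) has_real_derivative (c * f x) * exp (c * I f x)) (at x within {0..1})"
    if "continuous_on {0..1} f" "x \<in> {0..1}" for c f x
    using exp_integral_has_derivative[OF that, of 1 c] by (simp add: I_def)
  have d\<xi>: "(xi \<alpha> b0 \<beta> has_real_derivative (\<beta> x - \<alpha> x) * xi \<alpha> b0 \<beta> x) (at x within {0..1})"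
    if "x \<in> {0..1}" for x
    unfolding \<xi>_eq[abs_def]
    by (rule DERIV_cong[OF DERIV_cmult[OF DERIV_mult[OF dI[OF \<beta>c that] dI[OF \<alpha>c that]]]])
      (simp add: algebra_simps)
  have d\<rho>: "(\<rho> has_real_derivative - ((3 * \<beta> x + \<alpha> x) / 2) * \<rho> x) (at x within {0..1})"
    if "x \<in> {0..1}" for x
    unfolding \<rho>_def[abs_def]
    by (rule DERIV_cong[OF DERIV_cmult[OF DERIV_mult[OF dI[OF \<beta>c that] dI[OF \<alpha>c that]]]])
      (simp add: field_simps)
  have \<xi>c: "continuous_on {0..1} (xi \<alpha> b0 \<beta>)" using d\<xi> by (rule DERIV_continuous_on)
  have sq: "exp (c * t) ^ n = exp (real n * c * t)" for c t :: real and n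
    by (simp add: exp_of_nat_mult mult.assoc)
  have "EB_coefficients (xi \<alpha> b0 \<beta>) (\<lambda>x. integral {0..x} (xi \<alpha> b0 \<beta>)) \<alpha> \<alpha>1 \<alpha>2 \<beta> \<beta>1 \<beta>2
      (coeff_a \<alpha>) (coeff_b b0 \<beta>) \<rho>"
  proof unfold_locales
    fix x :: real assume x: "x \<in> {0..1}"
    show "xi \<alpha> b0 \<beta> x > 0" using s by (simp add: \<xi>_eq)
    show "((\<lambda>x. integral {0..x} (xi \<alpha> b0 \<beta>)) has_real_derivative xi \<alpha> b0 \<beta> x) (at x within {0..1})"
      by (rule integral_has_real_derivative[OF \<xi>c x])
    show "\<rho> x \<noteq> 0" using s by (simp add: \<rho>_def r_def)
    \<comment> \<open>Half exponents turn both algebraic relations into identities between integral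
      powers of \<open>s\<close>, \<open>X\<close> and \<open>Y\<close>.\<close>
    define X Y where "X = exp (I \<alpha> x / 2)" and "Y = exp (I \<beta> x / 2)"
    have XY: "X \<noteq> 0" "Y \<noteq> 0" by (simp_all add: X_def Y_def)
    have a: "coeff_a \<alpha> x = X ^ 8" and b: "coeff_b b0 \<beta> x = s ^ 8 * Y ^ 8"
      by (simp_all add: coeff_a_def coeff_b_def X_def Y_def s(2) I_def flip: exp_of_nat_mult)
    have "X\<^sup>2 = exp (I \<alpha> x)" "Y ^ 3 = exp (3 * I \<beta> x / 2)"
      by (simp_all add: X_def Y_def flip: exp_of_nat_mult)
    moreover have "- 1 * I \<alpha> x = - I \<alpha> x" "(- 1 / 2) * I \<alpha> x = - (I \<alpha> x / 2)"
      "(- 3 / 2) * I \<beta> x = - (3 * I \<beta> x / 2)" by simp_all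
    ultimately have X2: "exp (- 1 * I \<alpha> x) = 1 / X\<^sup>2" and X1: "exp ((- 1 / 2) * I \<alpha> x) = 1 / X"
      and Y3: "exp ((- 3 / 2) * I \<beta> x) = 1 / Y ^ 3"
      by (simp_all only: X_def exp_minus inverse_eq_divide)
    have Y2: "exp (1 * I \<beta> x) = Y\<^sup>2"
      by (simp add: Y_def flip: exp_of_nat_mult)
    have \<xi>: "xi \<alpha> b0 \<beta> x = s\<^sup>2 * (Y\<^sup>2 / X\<^sup>2)"
      unfolding \<xi>_eq X2 Y2 by simp
    have \<rho>: "\<rho> x = 1 / (s ^ 3 * Y ^ 3 * X)"
      unfolding \<rho>_def r_def X1 Y3 by simp
    show "coeff_a \<alpha> x * (\<rho> x)\<^sup>2 * xi \<alpha> b0 \<beta> x ^ 3 = 1"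
      unfolding a \<xi> \<rho> using XY s
      by (simp add: power_mult_distrib power_divide flip: power_mult power_add)
    show "coeff_b b0 \<beta> x * (\<rho> x)\<^sup>2 = xi \<alpha> b0 \<beta> x"
      unfolding b \<xi> \<rho> using XY s(1)
      by (simp add: power_mult_distrib power_divide divide_simps) (simp add: eval_nat_numeral)
  qed (use \<alpha> \<beta> \<xi>c \<xi>_int d\<xi> d\<rho> in auto)
  then show ?thesis by blast
qed

section \<open>Recovering an ordered enumeration from multiplicities\<close>

text \<open>The index map \<sigma> with \<open>ev n = f (\<sigma> n)\<close> is injective because
  every value of \<open>f\<close> is taken once, and therefore strictly increasing because
  \<open>ev\<close> is monotone. Being onto as well, it is the identity.\<close>

lemma labelling_by_strict_mono:
  fixes ev f :: "nat \<Rightarrow> real"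
  assumes ev: "\<And>n. n \<ge> 1 \<Longrightarrow> ev n \<le> ev (Suc n)"
    and range: "\<And>n. n \<ge> 1 \<Longrightarrow> \<exists>m\<ge>1. ev n = f m"
    and card: "\<And>m. m \<ge> 1 \<Longrightarrow> card {n. 1 \<le> n \<and> ev n = f m} = 1"
    and f: "\<And>m n. 1 \<le> m \<Longrightarrow> m < n \<Longrightarrow> f m < f n"
    and "n \<ge> 1"
  shows "ev n = f n"
proof -
  obtain \<sigma> where \<sigma>: "\<And>n. n \<ge> 1 \<Longrightarrow> \<sigma> n \<ge> 1 \<and> ev n = f (\<sigma> n)"
    using range by metis
  have inj: "i = j" if ij: "1 \<le> i" "1 \<le> j" "ev i = ev j" for i j
  proof -
    obtain k where "{n. 1 \<le> n \<and> ev n = f (\<sigma> i)} = {k}"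
      using card[of "\<sigma> i"] \<sigma>[OF ij(1)] card_1_singletonE by blast
    then show ?thesis using ij \<sigma>[OF ij(1)] by (metis (mono_tags, lifting) mem_Collect_eq singletonD)
  qed
  have Suc: "\<sigma> n < \<sigma> (Suc n)" if n: "n \<ge> 1" for n
  proof (rule ccontr)
    assume "\<not> \<sigma> n < \<sigma> (Suc n)"
    then consider "\<sigma> (Suc n) < \<sigma> n" | "\<sigma> (Suc n) = \<sigma> n" by linarith
    then show False
    proof cases
      case 1
      then have "ev (Suc n) < ev n" using f \<sigma>[of "Suc n"] \<sigma>[OF n] by simp
      then show False using ev[OF n] by simp
    next
      case 2
      then have "ev (Suc n) = ev n" using \<sigma>[of "Suc n"] \<sigma>[OF n] by simp
      then show False using inj[of "Suc n" n] n by simp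
    qed
  qed
  have ge: "n \<le> \<sigma> n" if "n \<ge> 1" for n
    using that
  proof (induction n rule: dec_induct)
    case base
    then show ?case using \<sigma>[of 1] by simp
  next
    case (step n)
    then show ?case using Suc[of n] by simp
  qed
  have "\<sigma> n = n" if "n \<ge> 1" for n
    using that
  proof (induction n rule: less_induct)
    case (less n)
    \<comment> \<open>A preimage \<open>j\<close> of \<open>n\<close> under \<sigma> satisfies
      \<open>j \<le> \<sigma> j = n\<close>; for \<open>j < n\<close> the induction hypothesis
      \<open>\<sigma> j = j\<close> is contradictory.\<close>
    obtain j where j: "j \<ge> 1" "ev j = f n"
      using card_1_singletonE[OF card[OF less.prems]] by blast
    have "\<sigma> j = n"
      using f[of "\<sigma> j" n] f[of n "\<sigma> j"] \<sigma>[OF j(1)] j less.prems by (cases "\<sigma> j" n rule: linorder_cases) auto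
    then have "j \<le> n" using ge[OF j(1)] by simp
    then show ?case using less.IH[of j] j(1) \<open>\<sigma> j = n\<close> by (cases "j = n") auto
  qed
  then show ?thesis using \<sigma>[OF assms(5)] assms(5) by simp
qed

section \<open>The case of unit coefficients\<close>

text \<open>Testing with \<open>U\<close> gives \<open>\<mu> \<ge> 0\<close>, hence a real fourth
  root \<open>k\<close>. Then \<open>v = U2 + k\<^sup>2 * U\<close> vanishes, the oscillator
  estimate with zero right-hand side identifies \<open>U\<close> with a sine, and
  \<open>U 1 = 0\<close> quantizes \<open>k\<close>.\<close>

lemma unit_fourth_order_eigenfunction:
  fixes U :: "real \<Rightarrow> real"
  assumes U: "\<And>x. x \<in> {0..1} \<Longrightarrow> (U has_real_derivative U1 x) (at x within {0..1})"
    and U1: "\<And>x. x \<in> {0..1} \<Longrightarrow> (U1 has_real_derivative U2 x) (at x within {0..1})"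
    and U2: "\<And>x. x \<in> {0..1} \<Longrightarrow> (U2 has_real_derivative U3 x) (at x within {0..1})"
    and U3: "\<And>x. x \<in> {0..1} \<Longrightarrow> (U3 has_real_derivative \<mu> * U x) (at x within {0..1})"
    and bc: "U 0 = 0" "U 1 = 0" "U2 0 = 0" "U2 1 = 0"
    and nz: "\<exists>x\<in>{0..1}. U x \<noteq> 0"
  obtains m C where "m \<ge> 1" "\<mu> = (pi * real m) ^ 4"
    "\<And>x. x \<in> {0..1} \<Longrightarrow> U x = C * sin (pi * real m * x)"
proof -
  \<comment> \<open>The untransformed variable: \<open>DD\<close> is ordinary differentiation on the
    unit interval.\<close>
  interpret time_change "\<lambda>_. 1" "\<lambda>x. x"
    by unfold_locales (auto intro!: derivative_eq_intros)
  have D: "DD U U1" "DD U1 U2" "DD U2 U3" "DD U3 (\<lambda>x. \<mu> * U x)"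
    using U U1 U2 U3 by (simp_all add: DD_def)
  note c = D[THEN DD_cont]
  have const: "f x = f 0" if f: "DD f f'" "\<And>x. x \<in> {0..1} \<Longrightarrow> f' x = 0" and x: "x \<in> {0..1}" for f f' x
  proof -
    have "(f has_real_derivative 0) (at x within {0..1})" if "x \<in> {0..1}" for x
      using DD_D[OF f(1) that] f(2)[OF that] by simp
    from has_field_derivative_zero_constant[OF convex_real_interval(5) this]
    obtain k where "\<forall>x\<in>{0..1}. f x = k" by blast
    then show ?thesis using x by simp
  qed
  have UU: "ip U U > 0"
    using nz ip_self_eq_0[OF c(1)] ip_nonneg[OF c(1)] by (metis order_less_le)
  have "\<mu> * ip U U = ip U2 U2"
  proof -
    have "ip (\<lambda>x. \<mu> * U x) U = - ip U3 U1"
      using ip_parts[OF D(4,1)] c bc by (simp add: continuous_on_mult_left)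
    moreover have "ip U3 U1 = - ip U2 U2" using ip_parts[OF D(3,2)] c bc by simp
    ultimately show ?thesis by (simp add: ip_scale)
  qed
  then have "\<mu> * ip U U \<ge> 0" using ip_nonneg[OF c(3)] by simp
  then have "\<mu> \<ge> 0" using UU by (simp add: zero_le_mult_iff)
  define k where "k = sqrt (sqrt \<mu>)"
  have k0: "k \<ge> 0" and k4: "k ^ 4 = \<mu>"
  proof -
    have "k ^ 4 = (k\<^sup>2)\<^sup>2" by (simp flip: power_mult)
    then show "k ^ 4 = \<mu>" using \<open>\<mu> \<ge> 0\<close> by (simp add: k_def)
  qed (use \<open>\<mu> \<ge> 0\<close> in \<open>simp add: k_def\<close>)
  define v where "v x = U2 x + k\<^sup>2 * U x" for x
  define v1 where "v1 x = U3 x + k\<^sup>2 * U1 x" for x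
  have v: "DD v v1" unfolding v_def v1_def by (intro DD_add DD_cmult D)
  have v1: "DD v1 (\<lambda>x. k\<^sup>2 * v x)"
  proof -
    have "DD v1 (\<lambda>x. \<mu> * U x + k\<^sup>2 * U2 x)" unfolding v1_def by (intro DD_add DD_cmult D)
    moreover have "\<mu> * U x + k\<^sup>2 * U2 x = k\<^sup>2 * v x" for x
      by (simp add: v_def distrib_left k4[symmetric] flip: power_add mult.assoc)
    ultimately show ?thesis by simp
  qed
  have bcv: "v 0 = 0" "v 1 = 0" by (simp_all add: v_def bc)
  \<comment> \<open>The two sides have opposite signs, so \<open>v1\<close> vanishes and
    \<open>v\<close> is constant. Arguing with \<open>v1\<close> rather than \<open>v\<close> covers
    \<open>k = 0\<close> as well.\<close>
  have "k\<^sup>2 * ip v v = - ip v1 v1"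
    using ip_parts[OF v1 v] DD_cont[OF v] DD_cont[OF v1] bcv
    by (simp add: continuous_on_mult_left ip_scale)
  moreover have "k\<^sup>2 * ip v v \<ge> 0" by (simp add: ip_nonneg DD_cont[OF v])
  ultimately have "ip v1 v1 = 0" using ip_nonneg[OF DD_cont[OF v1]] by linarith
  then have v0: "v x = 0" if "x \<in> {0..1}" for x
    using const[OF v _ that] ip_self_eq_0[OF DD_cont[OF v1]] bcv by simp
  \<comment> \<open>For \<open>k = 0\<close> the function \<open>U\<close> would have zero second
    derivative and zero boundary values.\<close>
  have "k \<noteq> 0"
  proof
    assume "k = 0"
    then have "ip U2 U = ip (\<lambda>_. 0) U"
      using v0 by (intro ip_cong) (auto simp: v_def)
    then have "ip U1 U1 = 0" using ip_parts[OF D(2,1)] c bc by (simp add: ip_def)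
    then have "U x = 0" if "x \<in> {0..1}" for x
      using const[OF D(1) _ that] ip_self_eq_0[OF c(2)] bc by simp
    then show False using nz by blast
  qed
  then have "k > 0" using k0 by simp
  define A where "A = U1 0 / k"
  define z where "z x = U x - A * sin (k * x)" for x
  define z1 where "z1 x = U1 x - A * (k * cos (k * x))" for x
  have z: "DD z z1" unfolding z_def z1_def by (intro DD_diff DD_cmult D DD_sin)
  have "DD z1 (\<lambda>x. U2 x - A * (k * (- k * sin (k * x))))"
    unfolding z1_def by (intro DD_diff DD_cmult D DD_cos)
  moreover have "U2 x - A * (k * (- k * sin (k * x))) = 0 - k\<^sup>2 * z x" if "x \<in> {0..1}" for x
    using v0[OF that] by (simp add: v_def z_def power2_eq_square algebra_simps)
  ultimately have z1: "DD z1 (\<lambda>x. 0 - k\<^sup>2 * z x)" by (simp add: DD_def)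
  have "\<bar>k\<bar> * nrm z \<le> 2 * nrm (\<lambda>_. 0)"
    by (rule oscillator_energy[OF z z1]) (use \<open>k > 0\<close> in \<open>simp_all add: z_def z1_def bc A_def\<close>)
  also have "nrm (\<lambda>_. 0) = 0" by (simp add: nrm_def ip_def)
  finally have "nrm z \<le> 0" using \<open>k > 0\<close> by (simp add: mult_le_0_iff)
  then have "ip z z = 0"
    using nrm_ge_0[OF DD_cont[OF z]] nrm_sq[OF DD_cont[OF z]] by simp
  then have U_eq: "U x = A * sin (k * x)" if "x \<in> {0..1}" for x
    using ip_self_eq_0[OF DD_cont[OF z] _ that] by (simp add: z_def)
  have "A \<noteq> 0" using U_eq nz by auto
  then have "sin k = 0" using U_eq[of 1] bc by simp
  then obtain i :: int where i: "k = of_int i * pi" by (auto simp: sin_zero_iff_int2)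
  then have "i > 0" using \<open>k > 0\<close> by (simp add: zero_less_mult_iff)
  then have ki: "k = pi * real (nat i)" using i by simp
  show thesis
  proof (rule that)
    show "nat i \<ge> 1" using \<open>i > 0\<close> by simp
    show "\<mu> = (pi * real (nat i)) ^ 4" unfolding ki[symmetric] k4 ..
    show "U x = A * sin (pi * real (nat i) * x)" if "x \<in> {0..1}" for x
      using U_eq[OF that] unfolding ki .
  qed
qed

text \<open>The value 0 outside the interval matches the representative chosen for elements of the
  domain.\<close>

definition sine_mode :: "nat \<Rightarrow> real \<Rightarrow> complex" where
  "sine_mode m x = (if x \<in> {0..1} then complex_of_real (sin (pi * real m * x)) else 0)"

lemma D01_of_real:
  assumes "\<And>x. x \<in> {0..1} \<Longrightarrow> u x = complex_of_real (f x)"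
    and "\<And>x. x \<in> {0..1} \<Longrightarrow> (f has_real_derivative f' x) (at x within {0..1})"
    and "x \<in> {0..1}"
  shows "(u has_vector_derivative complex_of_real (f' x)) (at x within {0..1})"
    and "D01 u x = complex_of_real (f' x)"
proof -
  have "((\<lambda>x. complex_of_real (f x)) has_vector_derivative complex_of_real (f' x)) (at x within {0..1})"
    using bounded_linear.has_vector_derivative[OF bounded_linear_of_real] assms(2)[OF assms(3)]
    by (simp add: has_real_derivative_iff_has_vector_derivative)
  then show *: "(u has_vector_derivative complex_of_real (f' x)) (at x within {0..1})"
    by (rule has_vector_derivative_transform[OF assms(3), rotated]) (simp add: assms(1))
  show "D01 u x = complex_of_real (f' x)"
    unfolding D01_def using vector_derivative_within_closed_interval[OF _ _ *] assms(3) by simp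
qed

context
  fixes \<alpha> \<beta> :: "real \<Rightarrow> real" and b0 :: real
  assumes \<alpha>: "continuous_on {0..1} \<alpha>" and \<beta>: "continuous_on {0..1} \<beta>" and b0: "b0 > 0"
    and zero: "\<And>x. x \<in> {0..1} \<Longrightarrow> \<alpha> x = 0" "\<And>x. x \<in> {0..1} \<Longrightarrow> \<beta> x = 0"
    and unit: "\<And>x. x \<in> {0..1} \<Longrightarrow> coeff_a \<alpha> x = 1" "\<And>x. x \<in> {0..1} \<Longrightarrow> coeff_b b0 \<beta> x = 1"
begin

lemma sine_mode_eigenfunction:
  "sine_mode m \<in> eigenspace \<alpha> b0 \<beta> (\<lambda>_. 0) (complex_of_real ((pi * real m) ^ 4))"
proof -
  define k where "k = pi * real m"
  \<comment> \<open>Closed form of the \<open>n\<close>-th derivative of \<open>sin (k * x)\<close>;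
    the sign changes at every second step, whence \<open>n div 2\<close>.\<close>
  define f where "f n x = (if even n then (- 1) ^ (n div 2) * k ^ n * sin (k * x)
    else (- 1) ^ (n div 2) * k ^ n * cos (k * x))" for n x
  have df: "(f n has_real_derivative f (Suc n) x) (at x within {0..1})" for n x
    unfolding f_def[abs_def] by (cases "even n") (auto intro!: derivative_eq_intros elim!: evenE oddE)
  have fc: "continuous_on {0..1} (f n)" for n using df by (rule DERIV_continuous_on)
  have u: "sine_mode m x = complex_of_real (f 0 x)" if "x \<in> {0..1}" for x
    using that by (simp add: sine_mode_def f_def k_def)
  have d1: "(sine_mode m has_vector_derivative complex_of_real (f (Suc 0) x)) (at x within {0..1})"
    "D01 (sine_mode m) x = complex_of_real (f (Suc 0) x)" if "x \<in> {0..1}" for x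
    by (rule D01_of_real[of "sine_mode m" "f 0"]; use u df that in blast)+
  have d2: "(D01 (sine_mode m) has_vector_derivative complex_of_real (f (Suc (Suc 0)) x))
      (at x within {0..1})"
    "D01 (D01 (sine_mode m)) x = complex_of_real (f (Suc (Suc 0)) x)" if "x \<in> {0..1}" for x
    by (rule D01_of_real[of "D01 (sine_mode m)" "f (Suc 0)"]; use d1(2) df that in blast)+
  have u_cont: "continuous_on {0..1} (sine_mode m)"
    using d1(1) by (intro continuous_on_vector_derivative)
  have "C2_01 (sine_mode m)"
    unfolding C2_01_def
  proof (intro conjI ballI)
    show "sine_mode m differentiable at x within {0..1}" if "x \<in> {0..1}" for x
      using d1(1)[OF that] by (rule differentiableI_vector)
    show "D01 (sine_mode m) differentiable at x within {0..1}" if "x \<in> {0..1}" for x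
      using d2(1)[OF that] by (rule differentiableI_vector)
    show "continuous_on {0..1} (D01 (D01 (sine_mode m)))"
      by (rule continuous_on_eq[OF continuous_on_of_real[OF fc]]) (simp add: d2(2))
  qed
  moreover have "sine_mode m x = 0" if "x \<notin> {0..1}" for x
    by (simp only: sine_mode_def that if_False)
  moreover have L2: "L2_weighted (coeff_b b0 \<beta>) g" if g: "continuous_on {0..1} g" for g
    unfolding L2_weighted_def
  proof
    show "g \<in> borel_measurable (lebesgue_on {0<..<1})"
      by (rule continuous_imp_measurable_on_sets_lebesgue)
        (auto intro: continuous_on_subset[OF g])
    have "continuous_on {0..1} (\<lambda>x. coeff_b b0 \<beta> x * (cmod (g x))\<^sup>2)"
      by (intro coeff_b_cont \<beta> continuous_intros g)
    then show "(\<lambda>x. coeff_b b0 \<beta> x * (cmod (g x))\<^sup>2) absolutely_integrable_on {0<..<1}"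
      using absolutely_integrable_continuous_real absolutely_integrable_on_Icc_iff_Ioo by blast
  qed
  moreover have "L2_weighted (coeff_b b0 \<beta>) (\<lambda>x. complex_of_real (k ^ 4) * sine_mode m x)"
    by (intro L2 continuous_on_mult_left u_cont)
  moreover have "\<exists>w. w absolutely_integrable_on {0<..<1} \<and>
      weak_deriv 2 (\<lambda>x. coeff_a \<alpha> x *\<^sub>R D01 (D01 (sine_mode m)) x) w \<and>
      (AE x in lebesgue_on {0<..<1}. complex_of_real (k ^ 4) * sine_mode m x
        = (1 / coeff_b b0 \<beta> x) *\<^sub>R w x + 0 *\<^sub>R sine_mode m x)"
  \<comment> \<open>The witness is the fourth derivative of the sine function, as
    \<open>a = b = 1\<close>.\<close>
  proof (intro exI[of _ "\<lambda>x. complex_of_real (k ^ 4) * sine_mode m x"] conjI)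
    have "continuous_on {0..1} (\<lambda>x. complex_of_real (k ^ 4) * sine_mode m x)"
      by (intro continuous_on_mult_left u_cont)
    then show "(\<lambda>x. complex_of_real (k ^ 4) * sine_mode m x) absolutely_integrable_on {0<..<1}"
      using absolutely_integrable_continuous_real absolutely_integrable_on_Icc_iff_Ioo by blast
    have "weak_deriv 2 (f 2) (f 4)"
      by (rule classical_weak_deriv_2[of "f 2" "f 3" "f 4"]) (use df[of 2] df[of 3] fc in simp_all)
    then have "weak_deriv 2 (\<lambda>x. complex_of_real (f 2 x)) (\<lambda>x. complex_of_real (f 4 x))"
      by (rule weak_deriv_linear[OF bounded_linear_of_real fc fc])
    then show "weak_deriv 2 (\<lambda>x. coeff_a \<alpha> x *\<^sub>R D01 (D01 (sine_mode m)) x)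
        (\<lambda>x. complex_of_real (k ^ 4) * sine_mode m x)"
    proof (rule weak_deriv_cong)
      fix x :: real assume x: "x \<in> {0..1}"
      show "complex_of_real (f 2 x) = coeff_a \<alpha> x *\<^sub>R D01 (D01 (sine_mode m)) x"
        using x by (simp add: unit d2(2) numeral_2_eq_2)
      show "complex_of_real (f 4 x) = complex_of_real (k ^ 4) * sine_mode m x"
        using x by (simp add: u f_def)
    qed
    show "AE x in lebesgue_on {0<..<1}. complex_of_real (k ^ 4) * sine_mode m x
        = (1 / coeff_b b0 \<beta> x) *\<^sub>R (complex_of_real (k ^ 4) * sine_mode m x) + 0 *\<^sub>R sine_mode m x"
      by (rule AE_I2) (simp add: unit)
  qed
  moreover have "sine_mode m x = 0 \<and> D01 (D01 (sine_mode m)) x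
      + (2 * (\<alpha> x + \<beta> x)) *\<^sub>R D01 (sine_mode m) x = 0" if "x \<in> {0, 1}" for x
  proof -
    have "sin (k * x) = 0" using that by (auto simp: k_def sin_npi2)
    moreover have "x \<in> {0..1}" using that by auto
    ultimately show ?thesis
      by (simp add: u d2(2) zero f_def)
  qed
  ultimately show ?thesis
    unfolding eigenspace_def EB_graph_def k_def[symmetric] using L2[OF u_cont] by blast
qed

text \<open>As \<alpha> and \<beta> vanish, a component solves the constant coefficient problem with
  zero value and zero second derivative at both ends.\<close>

lemma eigenfunction_component:
  fixes L :: "complex \<Rightarrow> real"
  assumes L: "bounded_linear L"
    and u: "u \<in> eigenspace \<alpha> b0 \<beta> (\<lambda>_. 0) (complex_of_real \<mu>)"
    and nz: "\<exists>x\<in>{0..1}. L (u x) \<noteq> 0"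
  obtains m C where "m \<ge> 1" "\<mu> = (pi * real m) ^ 4"
    "\<And>x. x \<in> {0..1} \<Longrightarrow> L (u x) = C * sin (pi * real m * x)"
proof -
  have graph: "EB_graph \<alpha> b0 \<beta> (\<lambda>_. 0) u (\<lambda>x. complex_of_real \<mu> * u x)"
    using u by (simp add: eigenspace_def)
  obtain u1 u2 M1 where
    1: "\<And>x. x \<in> {0..1} \<Longrightarrow> ((\<lambda>x. L (u x)) has_real_derivative u1 x) (at x within {0..1})"
    and 2: "\<And>x. x \<in> {0..1} \<Longrightarrow> (u1 has_real_derivative u2 x) (at x within {0..1})"
    and 3: "\<And>x. x \<in> {0..1} \<Longrightarrow> ((\<lambda>x. coeff_a \<alpha> x * u2 x) has_real_derivative M1 x) (at x within {0..1})"
    and 4: "\<And>x. x \<in> {0..1} \<Longrightarrow>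
      (M1 has_real_derivative \<mu> * coeff_b b0 \<beta> x * L (u x)) (at x within {0..1})"
    and 5: "\<And>x. x \<in> {0, 1} \<Longrightarrow> L (u x) = 0 \<and> u2 x + 2 * (\<alpha> x + \<beta> x) * u1 x = 0"
    by (rule EB_graph_classical[OF \<alpha> \<beta> b0 L graph]) blast
  have d3: "(u2 has_real_derivative M1 x) (at x within {0..1})" if "x \<in> {0..1}" for x
    by (rule has_field_derivative_transform_within[OF 3[OF that] zero_less_one that])
      (simp add: unit)
  have d4: "(M1 has_real_derivative \<mu> * L (u x)) (at x within {0..1})" if "x \<in> {0..1}" for x
    using 4[OF that] that by (simp add: unit)
  have bc: "L (u 0) = 0" "L (u 1) = 0" "u2 0 = 0" "u2 1 = 0"
    using 5[of 0] 5[of 1] by (simp_all add: zero)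
  show thesis
    by (rule unit_fourth_order_eigenfunction[OF 1 2 d3 d4 bc nz]) (auto intro: that)
qed

text \<open>Real and imaginary parts are multiples of the same sine, because the eigenvalue
  determines the frequency; the two multiples form one complex factor.\<close>

lemma eigenspace_subset_sine_modes:
  assumes u: "u \<in> eigenspace \<alpha> b0 \<beta> (\<lambda>_. 0) (complex_of_real ((pi * real m) ^ 4))" and m: "m \<ge> 1"
  shows "\<exists>c. u = fscale c (sine_mode m)"
proof -
  have comp: "\<exists>C. \<forall>x\<in>{0..1}. L (u x) = C * sin (pi * real m * x)"
    if L: "bounded_linear L" for L :: "complex \<Rightarrow> real"
  proof (cases "\<exists>x\<in>{0..1}. L (u x) \<noteq> 0")
    case True
    obtain m' C where m': "m' \<ge> 1" "(pi * real m) ^ 4 = (pi * real m') ^ 4"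
      and C: "\<And>x. x \<in> {0..1} \<Longrightarrow> L (u x) = C * sin (pi * real m' * x)"
      by (rule eigenfunction_component[OF L u True]) blast
    have "pi * real m = pi * real m'"
      using power_eq_imp_eq_base[OF m'(2)] by simp
    then show ?thesis using C by auto
  qed (auto intro: exI[of _ 0])
  obtain c1 c2 where "\<forall>x\<in>{0..1}. Re (u x) = c1 * sin (pi * real m * x)"
    "\<forall>x\<in>{0..1}. Im (u x) = c2 * sin (pi * real m * x)"
    using comp[OF bounded_linear_Re] comp[OF bounded_linear_Im] by blast
  moreover have "u x = 0" if "x \<notin> {0..1}" for x
    using u that by (simp add: eigenspace_def EB_graph_def)
  ultimately have "u = fscale (Complex c1 c2) (sine_mode m)"
    by (auto simp: fun_eq_iff fscale_def sine_mode_def complex_eq_iff)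
  then show ?thesis ..
qed

lemma multiplicity_sine:
  assumes "m \<ge> 1"
  shows "multiplicity_EB \<alpha> b0 \<beta> (\<lambda>_. 0) (complex_of_real ((pi * real m) ^ 4)) = 1"
proof -
  interpret vs: vector_space fscale by (rule vector_space_fscale)
  let ?E = "eigenspace \<alpha> b0 \<beta> (\<lambda>_. 0) (complex_of_real ((pi * real m) ^ 4))"
  \<comment> \<open>At its first maximum the sine is 1, so the spanning vector is nonzero and hence
    independent.\<close>
  have "sine_mode m (1 / (2 * real m)) = 1"
    using assms by (simp add: sine_mode_def field_simps)
  then have "sine_mode m \<noteq> 0" by (auto simp: zero_fun_def)
  then have "vs.independent {sine_mode m}" by simp
  moreover have "vs.span {sine_mode m} = vs.span ?E"
    unfolding vs.span_eq
  proof
    show "{sine_mode m} \<subseteq> vs.span ?E"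
      using sine_mode_eigenfunction by (auto intro: vs.span_base)
    show "?E \<subseteq> vs.span {sine_mode m}"
      using eigenspace_subset_sine_modes[OF _ assms] by (auto intro: vs.span_scale vs.span_base)
  qed
  ultimately have "vs.dim ?E = card {sine_mode m}" by (intro vs.dim_eq_card)
  then show ?thesis by (simp add: multiplicity_EB_def)
qed

end

text \<open>A nonzero dimension excludes the zero space. Elements of the domain vanish outside the
  closed interval, so a nonzero one is nonzero somewhere inside it.\<close>

lemma multiplicity_pos_imp_eigenfunction:
  assumes "multiplicity_EB \<alpha> b0 \<beta> Q \<mu> \<noteq> 0"
  obtains u where "u \<in> eigenspace \<alpha> b0 \<beta> Q \<mu>" "\<exists>x\<in>{0..1}. u x \<noteq> 0"
proof -
  interpret vs: vector_space fscale by (rule vector_space_fscale)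
  let ?E = "eigenspace \<alpha> b0 \<beta> Q \<mu>"
  have "\<exists>u\<in>?E. \<exists>x\<in>{0..1}. u x \<noteq> 0"
  proof (rule ccontr)
    assume "\<not> (\<exists>u\<in>?E. \<exists>x\<in>{0..1}. u x \<noteq> 0)"
    then have *: "u x = 0" if "u \<in> ?E" "x \<in> {0..1}" for u x using that by blast
    have "u = 0" if "u \<in> ?E" for u
    proof
      fix x
      show "u x = 0 x"
        using *[OF that, of x] that
        by (cases "x \<in> {0..1}") (simp_all add: eigenspace_def EB_graph_def)
    qed
    then have "?E \<subseteq> {0}" by blast
    then have "vs.span {} = vs.span ?E"
      unfolding vs.span_eq by auto
    then have "vs.dim ?E = card ({} :: (real \<Rightarrow> complex) set)"
      by (rule vs.dim_eq_card) (rule vs.independent_empty)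
    then show False using assms by (simp add: multiplicity_EB_def)
  qed
  then show thesis using that by blast
qed

text \<open>The constant function is differentiated. The factor \<open>C\<close> allows both uses:
  \<open>C = 1\<close> for \<open>a\<close> and \<open>C = b0\<close> for \<open>b\<close>.\<close>

lemma coefficients_one_imp_zero:
  fixes \<alpha> :: "real \<Rightarrow> real"
  assumes \<alpha>: "continuous_on {0..1} \<alpha>" and "C > 0" and x: "x \<in> {0..1}"
    and const: "\<And>x. x \<in> {0..1} \<Longrightarrow> C * exp (4 * integral {0..x} \<alpha>) = 1"
  shows "\<alpha> x = 0"
proof -
  have "((\<lambda>x. C * exp (4 * integral {0..x} \<alpha>)) has_real_derivative 0) (at x within {0..1})"
    by (rule has_field_derivative_transform_within[OF DERIV_const zero_less_one x])
      (simp add: const)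
  then have "4 * \<alpha> x * (C * exp (4 * integral {0..x} \<alpha>)) = 0"
    using exp_integral_has_derivative[OF \<alpha> x, of C 4] x
    unfolding has_real_derivative_iff_has_vector_derivative
    by (intro vector_derivative_unique_within_closed_interval[OF zero_less_one]) simp_all
  then show ?thesis using const[OF x] by auto
qed

theorem theorem1p1:
  fixes \<alpha> \<beta> :: "real \<Rightarrow> real" and b0 :: real and ev :: "nat \<Rightarrow> real"
  assumes "\<alpha> \<in> sobolev 3" and "continuous_on {0..1} \<alpha>"
    and "\<beta> \<in> sobolev 3" and "continuous_on {0..1} \<beta>"
    and "b0 > 0"
    and "integral {0..1} (xi \<alpha> b0 \<beta>) = 1"
    and "kappa \<alpha> b0 \<beta> 0 = kappa \<alpha> b0 \<beta> 1"
    and "eigenvalue_labelling \<alpha> b0 \<beta> (\<lambda>_. 0) ev"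
  shows "(\<forall>n\<ge>1. ev n = (pi * real n) ^ 4) \<longleftrightarrow>
         (\<forall>x\<in>{0..1}. coeff_a \<alpha> x = 1 \<and> coeff_b b0 \<beta> x = 1)"
proof
  \<comment> \<open>The labelling condition for real \<mu>, with the count expressed among real
    numbers.\<close>
  have mult: "finite {n. 1 \<le> n \<and> complex_of_real (ev n) = complex_of_real \<mu>}"
    "card {n. 1 \<le> n \<and> ev n = \<mu>} = multiplicity_EB \<alpha> b0 \<beta> (\<lambda>_. 0) (complex_of_real \<mu>)" for \<mu>
    using assms(8) unfolding eigenvalue_labelling_def of_real_eq_iff[symmetric, where 'a = complex]
    by blast+
  {
    assume ev: "\<forall>n\<ge>1. ev n = (pi * real n) ^ 4"
    obtain \<alpha>1 \<alpha>2 where \<alpha>: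
      "\<And>x. x \<in> {0..1} \<Longrightarrow> (\<alpha> has_real_derivative \<alpha>1 x) (at x within {0..1})"
      "\<And>x. x \<in> {0..1} \<Longrightarrow> (\<alpha>1 has_real_derivative \<alpha>2 x) (at x within {0..1})"
      "continuous_on {0..1} \<alpha>2"
      by (rule sobolev_3_classical[OF assms(1,2)]) blast
    obtain \<beta>1 \<beta>2 where \<beta>:
      "\<And>x. x \<in> {0..1} \<Longrightarrow> (\<beta> has_real_derivative \<beta>1 x) (at x within {0..1})"
      "\<And>x. x \<in> {0..1} \<Longrightarrow> (\<beta>1 has_real_derivative \<beta>2 x) (at x within {0..1})"
      "continuous_on {0..1} \<beta>2"
      by (rule sobolev_3_classical[OF assms(3,4)]) blast
    obtain T \<rho> where "EB_coefficients (xi \<alpha> b0 \<beta>) T \<alpha> \<alpha>1 \<alpha>2 \<beta> \<beta>1 \<beta>2 (coeff_a \<alpha>) (coeff_b b0 \<beta>) \<rho>"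
      using EB_coefficients_of_functions[OF assms(5,6) \<alpha> \<beta>] by blast
    then interpret EB_coefficients "xi \<alpha> b0 \<beta>" T \<alpha> \<alpha>1 \<alpha>2 \<beta> \<beta>1 \<beta>2 "coeff_a \<alpha>" "coeff_b b0 \<beta>" \<rho> .
    have modes: "\<exists>y y1 y2 y3. weak_mode p q d e h (pi * real n) y y1 y2 y3 \<and> (\<exists>x\<in>{0..1}. y x \<noteq> 0)"
      if n: "n \<ge> 1" for n
    proof -
      let ?\<mu> = "(pi * real n) ^ 4"
      \<comment> \<open>The set contains \<open>n\<close> and is finite, so its cardinality, the
        multiplicity, is not 0.\<close>
      have "{m. 1 \<le> m \<and> ev m = ?\<mu>} \<noteq> {}" using ev n by blast
      then have "multiplicity_EB \<alpha> b0 \<beta> (\<lambda>_. 0) (complex_of_real ?\<mu>) \<noteq> 0"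
        using mult[of ?\<mu>] by (simp only: of_real_eq_iff mult(2)[symmetric] card_0_eq)
          (simp add: card_eq_0_iff)
      then obtain u where u: "u \<in> eigenspace \<alpha> b0 \<beta> (\<lambda>_. 0) (complex_of_real ?\<mu>)"
        and nz: "\<exists>x\<in>{0..1}. u x \<noteq> 0"
        by (rule multiplicity_pos_imp_eigenfunction)
      have graph: "EB_graph \<alpha> b0 \<beta> (\<lambda>_. 0) u (\<lambda>x. complex_of_real ?\<mu> * u x)"
        using u by (simp only: eigenspace_def mem_Collect_eq)
      \<comment> \<open>Either the real or the imaginary part of \<open>u\<close> is nonzero
        somewhere.\<close>
      obtain L :: "complex \<Rightarrow> real" where L: "bounded_linear L" "\<exists>x\<in>{0..1}. L (u x) \<noteq> 0"
        using nz bounded_linear_Re bounded_linear_Im by (metis complex_eq_iff zero_complex.sel)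
      obtain u1 u2 M1 where
        1: "\<And>x. x \<in> {0..1} \<Longrightarrow> ((\<lambda>x. L (u x)) has_real_derivative u1 x) (at x within {0..1})"
        and 2: "\<And>x. x \<in> {0..1} \<Longrightarrow> (u1 has_real_derivative u2 x) (at x within {0..1})"
        and 3: "\<And>x. x \<in> {0..1} \<Longrightarrow>
          ((\<lambda>x. coeff_a \<alpha> x * u2 x) has_real_derivative M1 x) (at x within {0..1})"
        and 4: "\<And>x. x \<in> {0..1} \<Longrightarrow>
          (M1 has_real_derivative ?\<mu> * coeff_b b0 \<beta> x * L (u x)) (at x within {0..1})"
        and 5: "\<And>x. x \<in> {0, 1} \<Longrightarrow> L (u x) = 0 \<and> u2 x + 2 * (\<alpha> x + \<beta> x) * u1 x = 0"
        by (rule EB_graph_classical[OF assms(2,4,5) L(1) graph]) blast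
      show ?thesis by (rule eigenfunction_weak_mode[OF 1 2 3 4 5 L(2)])
    qed
    have "t / (2 * z) = t / z / 2" for t z :: real by (simp add: mult.commute)
    then have "(3 * \<alpha> 0 + 5 * \<beta> 0) / xi \<alpha> b0 \<beta> 0 = (3 * \<alpha> 1 + 5 * \<beta> 1) / xi \<alpha> b0 \<beta> 1"
      using assms(7) by (simp add: kappa_def)
    note zero = coefficients_vanish[OF modes this]
    have int0: "integral {0..x} \<alpha> = 0" "integral {0..x} \<beta> = 0" if "x \<in> {0..1}" for x
      using integral_cong[of "{0..x}" \<alpha> "\<lambda>_. 0"] integral_cong[of "{0..x}" \<beta> "\<lambda>_. 0"] zero that
      by auto
    \<comment> \<open>With \<alpha> and \<beta> zero, \<xi> is constant, and the normalization of
      its integral forces \<open>b0 = 1\<close>.\<close>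
    have "xi \<alpha> b0 \<beta> x = b0 powr (1 / 4)" if "x \<in> {0..1}" for x
      using int0[OF that] by (simp add: xi_def coeff_a_def coeff_b_def)
    then have "integral {0..1} (xi \<alpha> b0 \<beta>) = integral {0..1} (\<lambda>_::real. b0 powr (1 / 4))"
      by (rule integral_cong)
    then have "b0 powr (1 / 4) = 1" using assms(6) by simp
    moreover have "b0 = (b0 powr (1 / 4)) powr 4" using assms(5) by (simp add: powr_powr)
    ultimately have "b0 = 1" by simp
    then show "\<forall>x\<in>{0..1}. coeff_a \<alpha> x = 1 \<and> coeff_b b0 \<beta> x = 1"
      using int0 by (simp add: coeff_a_def coeff_b_def)
  next
    assume unit: "\<forall>x\<in>{0..1}. coeff_a \<alpha> x = 1 \<and> coeff_b b0 \<beta> x = 1"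
    have zero: "\<alpha> x = 0" "\<beta> x = 0" if "x \<in> {0..1}" for x
      using coefficients_one_imp_zero[OF assms(2) zero_less_one that]
        coefficients_one_imp_zero[OF assms(4,5) that] unit
      by (simp_all add: coeff_a_def coeff_b_def)
    note unit = bspec[OF unit, THEN conjunct1] bspec[OF unit, THEN conjunct2]
    show "\<forall>n\<ge>1. ev n = (pi * real n) ^ 4"
    proof (intro allI impI, rule labelling_by_strict_mono[where f = "\<lambda>m. (pi * real m) ^ 4"])
      show "ev n \<le> ev (Suc n)" if "n \<ge> 1" for n
        using assms(8) that by (simp add: eigenvalue_labelling_def)
      show "\<exists>m\<ge>1. ev n = (pi * real m) ^ 4" if "n \<ge> 1" for n
      proof -
        \<comment> \<open>Each \<open>ev n\<close> is counted at least by its own index, so it is an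
          eigenvalue and has a nonzero eigenfunction, whose form gives \<open>m\<close>.\<close>
        have "card {m. 1 \<le> m \<and> ev m = ev n} \<noteq> 0"
          using mult(1)[of "ev n"] that by (auto simp: card_eq_0_iff)
        then have "multiplicity_EB \<alpha> b0 \<beta> (\<lambda>_. 0) (complex_of_real (ev n)) \<noteq> 0"
          unfolding mult(2) .
        then obtain u where u: "u \<in> eigenspace \<alpha> b0 \<beta> (\<lambda>_. 0) (complex_of_real (ev n))"
          and nz: "\<exists>x\<in>{0..1}. u x \<noteq> 0"
          by (rule multiplicity_pos_imp_eigenfunction)
        obtain L :: "complex \<Rightarrow> real" where L: "bounded_linear L" "\<exists>x\<in>{0..1}. L (u x) \<noteq> 0"
          using nz bounded_linear_Re bounded_linear_Im by (metis complex_eq_iff zero_complex.sel)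
        show ?thesis
          by (rule eigenfunction_component[OF assms(2,4,5) zero unit L(1) u L(2)])
            (assumption | intro exI conjI)+
      qed
      show "card {n. 1 \<le> n \<and> ev n = (pi * real m) ^ 4} = 1" if "m \<ge> 1" for m
        using multiplicity_sine[OF assms(2,4,5) zero unit that] by (simp only: mult(2))
      show "(pi * real m) ^ 4 < (pi * real n) ^ 4" if "1 \<le> m" "m < n" for m n
        using that by (intro power_strict_mono) auto
    qed
  }
qed

end
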